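(* The isomorphism types (disregarding the metric) of the $6$-dimensional non-abelian $2$-step nilpotent real Lie algebras are located in terms of the invariants $\alpha_\pm,\beta_\pm,t$ (resp. $\omega,\alpha,\beta$) of algebras with isometric $j$ as follows. (1) Any Lie algebra with $1$-dimensional commutator ideal is isomorphic to one with isometric $j$ and parameters either $\alpha_\pm=0=\beta_+$, $\beta_-=1$, $t=0$, which is $(0,0,0,0,0,12+34)=\mathfrak{h}_5\oplus\mathbb{R}$, or $\alpha_\pm=0$, $\beta_+=\beta_-=1/2$, $t=1/4$, which is $(0,0,0,0,0,12)=\mathfrak{h}_3\oplus\mathbb{R}^3$. (2) Any Lie algebra with $2$-dimensional commutator ideal is isomorphic to one with isometric $j$. For isometric $j$, labelled (after possibly interchanging $\pm$) so that $\beta_-\ge\beta_+$ (equivalently $\alpha_-\ge\alpha_+$), there are exactly four isomorphism types: (a) if $\alpha_\pm<1/2$, the Lie algebra is isomorphic to $(0,0,0,0,12,34)=\mathfrak{h}_3\oplus\mathfrak{h}_3$; (b) if $\alpha_+<1/2=\alpha_-$, it is isomorphic to $(0,0,0,0,12,14+23)$; (c) if $\alpha_+=1/2=\alpha_-$, it is isomorphic to $(0,0,0,0,12,13)=\mathfrak{n}_5\oplus\mathbb{R}$; (d) if $\alpha_+<1/2<\alpha_-$, it is isomorphic to $(0,0,0,0,13+42,14+23)=\mathfrak{h}_3^{\mathbb{C}}$. (3) Any Lie algebra with $3$-dimensional commutator ideal is isomorphic to $(0,0,0,12,13,23)$, represented by isometric $j$ with $\omega=\alpha=\beta=1/2$.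
   Context: Notation for Lie algebras: $(0,0,0,12,13,23)$ denotes the Lie algebra having a basis $(e^i)$ of its dual with $de^1=de^2=de^3=0$, $de^4=e^1\wedge e^2$, $de^5=e^1\wedge e^3$, $de^6=e^2\wedge e^3$, and similarly for the other symbols. $\mathfrak{h}_3$, $\mathfrak{h}_5$ are the real Heisenberg algebras of dimension $3$, $5$; $\mathfrak{h}_3^{\mathbb{C}}$ is the complex $3$-dimensional Heisenberg algebra regarded as a real $6$-dimensional Lie algebra; $\mathfrak{n}_5=(0,0,0,12,13)$. A $6$-dimensional metric $2$-step nilpotent Lie algebra with $k$-dimensional commutator ideal is given by a surjective bracket $c\in\operatorname{Hom}(\Lambda^2\mathbb{R}^{6-k},\mathbb{R}^k)$ on $\mathbb{R}^6=\mathbb{R}^{6-k}\oplus\mathbb{R}^k$ (extended by $0$), equivalently by the injective map $j=c^*\colon\mathbb{R}^k\to\Lambda^2\mathbb{R}^{6-k}\cong\mathfrak{so}(6-k)$; here $1\le k\le3$. Split $\mathfrak{so}(4)\cong\Lambda^2\mathbb{R}^4=\mathbb{R}^3_+\oplus\mathbb{R}^3_-$, where $\mathbb{R}^3_\pm$ has basis $e_1^\pm=e^{12}\pm e^{34}$, $e_2^\pm=e^{13}\mp e^{24}$, $e_3^\pm=e^{14}\pm e^{23}$ ($e^{ij}=e^i\wedge e^j$), and give $\mathfrak{so}(4)$ the invariant scalar product making $(e_i^\pm)$ orthonormal; "isometric $j$" refers to this scalar product. The components of a linear map $j$ into $\mathfrak{so}(4)$ are denoted $j_\pm$ (values in $\mathbb{R}^3_\pm$).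 - For $k=2$: $\operatorname{Spec}(j_\pm^*j_\pm)=\{\alpha_\pm,\beta_\pm\}$ with $0\le\alpha_\pm\le\beta_\pm$ and $t=\operatorname{Tr}(j_+^*j_+j_-^*j_-)$; these are invariants of $j$ under $\mathrm{O}(2)\times\mathrm{O}(4)$ up to interchanging $+$ and $-$ (which elements of $\mathrm{O}(4)$ of determinant $-1$ do). For isometric $j$ one has $\alpha_-+\beta_+=1=\alpha_++\beta_-$. - For $k=1$: any $j\colon\mathbb{R}\to\mathfrak{so}(5)$ is $\mathrm{O}(5)$-conjugate to one with values in $\mathfrak{so}(4)\subset\mathfrak{so}(5)$; extend it by $0$ to a map $\mathbb{R}^2\to\mathfrak{so}(4)$ and use the same invariants (isometric means isometric on $\mathbb{R}$), labelled so that $\beta_+\le\beta_-$. - For $k=3$: compose $j\colon\mathbb{R}^3\to\mathfrak{so}(3)$ with the inclusion $\mathfrak{so}(3)\hookrightarrow\mathfrak{so}(4)$ induced by $\mathbb{R}^3\hookrightarrow\mathbb{R}^4$; then $\operatorname{Spec}(j_-^*j_-)=\operatorname{Spec}(j_+^*j_+)=\{\omega,\alpha,\beta\}$ with $0\le\omega\le\alpha\le\beta$. *)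

theory Defs
  imports "HOL-Analysis.Analysis"
begin

section \<open>Lie algebras\<close>

text \<open>A real Lie algebra is given by its bracket on a real vector space, the universe of a type.\<close>

definition lie_algebra :: "('a::real_vector \<Rightarrow> 'a \<Rightarrow> 'a) \<Rightarrow> bool" where
  "lie_algebra br \<longleftrightarrow> bilinear br \<and> (\<forall>x. br x x = 0) \<and>
     (\<forall>x y z. br x (br y z) + br y (br z x) + br z (br x y) = 0)"

definition commutator_ideal :: "('a::real_vector \<Rightarrow> 'a \<Rightarrow> 'a) \<Rightarrow> 'a set" where
  "commutator_ideal br = span {br x y |x y. True}"

definition abelian :: "('a::real_vector \<Rightarrow> 'a \<Rightarrow> 'a) \<Rightarrow> bool" where
  "abelian br \<longleftrightarrow> (\<forall>x y. br x y = 0)"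

definition two_step_nilpotent :: "('a::real_vector \<Rightarrow> 'a \<Rightarrow> 'a) \<Rightarrow> bool" where
  "two_step_nilpotent br \<longleftrightarrow> lie_algebra br \<and> (\<forall>x. \<forall>y\<in>commutator_ideal br. br x y = 0)"

definition nonabelian_2step_dim6 :: "('a::real_vector \<Rightarrow> 'a \<Rightarrow> 'a) \<Rightarrow> bool" where
  "nonabelian_2step_dim6 br \<longleftrightarrow>
     dim (UNIV :: 'a set) = 6 \<and> two_step_nilpotent br \<and> \<not> abelian br"

definition lie_iso :: "('a::real_vector \<Rightarrow> 'a \<Rightarrow> 'a) \<Rightarrow> ('b::real_vector \<Rightarrow> 'b \<Rightarrow> 'b) \<Rightarrow> bool"
    (infix "\<cong>\<^sub>L" 50) where
  "br \<cong>\<^sub>L br' \<longleftrightarrow> (\<exists>f. linear f \<and> bij f \<and> (\<forall>x y. f (br x y) = br' (f x) (f y)))"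

definition direct_sum ::
    "('a \<Rightarrow> 'a \<Rightarrow> 'a) \<Rightarrow> ('b \<Rightarrow> 'b \<Rightarrow> 'b) \<Rightarrow> 'a \<times> 'b \<Rightarrow> 'a \<times> 'b \<Rightarrow> 'a \<times> 'b" (infixr "\<oplus>\<^sub>L" 65) where
  "br \<oplus>\<^sub>L br' = (\<lambda>(x, x') (y, y'). (br x y, br' x' y'))"

definition zero_bracket :: "'a::real_vector \<Rightarrow> 'a \<Rightarrow> 'a" where
  "zero_bracket x y = 0"


section \<open>Two-forms and structure equations\<close>

text \<open>A two-form on \<^term>\<open>UNIV :: (real^'n) set\<close> is identified with the skew-symmetric matrix
  of its values on the standard basis, so \<^term>\<open>A\<close> stands for the form sending
  \<^term>\<open>x\<close>, \<^term>\<open>y\<close> to \<^term>\<open>inner x (A *v y)\<close>.\<close>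

definition so :: "(real^'n^'n) set" where
  "so = {A. transpose A = - A}"

definition wedge :: "'n \<Rightarrow> 'n \<Rightarrow> real^'n^'n" where
  "wedge i j = (\<chi> a b. of_bool (a = i \<and> b = j) - of_bool (a = j \<and> b = i))"

text \<open>The bracket on \<^term>\<open>UNIV :: (real^'n) set\<close> with \<open>de\<^sup>k = \<omega> $ k\<close> for the dual standard basis
  \<open>(e\<^sup>k)\<close>, where \<open>de\<^sup>k(x, y) = - e\<^sup>k([x, y])\<close>.\<close>

definition structure_bracket :: "real^'n^'n^'n \<Rightarrow> real^'n \<Rightarrow> real^'n \<Rightarrow> real^'n" where
  "structure_bracket \<omega> x y = (\<chi> k. - (x \<bullet> (\<omega> $ k *v y)))"

text \<open>The numeral types are cyclic (for instance \<^term>\<open>6 = (0 :: 6)\<close>), and \<^const>\<open>vector\<close> fills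
  the positions \<open>1, 2, \<dots>, n\<close> in this order.\<close>

definition lie6 :: "(real^6^6) list \<Rightarrow> real^6 \<Rightarrow> real^6 \<Rightarrow> real^6" where
  "lie6 \<omega>s = structure_bracket (vector \<omega>s)"

definition n5 :: "real^5 \<Rightarrow> real^5 \<Rightarrow> real^5" where
  "n5 = structure_bracket (vector [0, 0, 0, wedge 1 2, wedge 1 3])"

text \<open>The Heisenberg algebra of dimension \<open>2n + 1\<close>, where \<open>n\<close> is the dimension of \<^typ>\<open>'a::euclidean_space\<close>.\<close>

definition heisenberg ::
    "'a::euclidean_space \<times> 'a \<times> real \<Rightarrow> 'a \<times> 'a \<times> real \<Rightarrow> 'a \<times> 'a \<times> real" where
  "heisenberg = (\<lambda>(p, q, _) (p', q', _). (0, 0, p \<bullet> q' - p' \<bullet> q))"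

definition h3 :: "real \<times> real \<times> real \<Rightarrow> real \<times> real \<times> real \<Rightarrow> real \<times> real \<times> real" where
  "h3 = heisenberg"

definition h5 ::
    "(real^2) \<times> (real^2) \<times> real \<Rightarrow> (real^2) \<times> (real^2) \<times> real \<Rightarrow> (real^2) \<times> (real^2) \<times> real" where
  "h5 = heisenberg"

definition h3_complex ::
    "complex \<times> complex \<times> complex \<Rightarrow> complex \<times> complex \<times> complex \<Rightarrow> complex \<times> complex \<times> complex" where
  "h3_complex = (\<lambda>(p, q, _) (p', q', _). (0, 0, p * q' - p' * q))"


section \<open>Metric two-step nilpotent Lie algebras\<close>

text \<open>The Lie algebra on the orthogonal sum of \<^term>\<open>UNIV :: (real^'n) set\<close> and
  \<^term>\<open>UNIV :: 'b set\<close> whose bracket \<open>c\<close> satisfies \<open>j = c\<^sup>*\<close>, i.e.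
  \<open>\<langle>z, c(x, y)\<rangle>\<close> is the value of the two-form \<^term>\<open>j z\<close> on \<open>x, y\<close>.\<close>

definition metric_lie ::
    "('b::euclidean_space \<Rightarrow> real^'n^'n) \<Rightarrow> (real^'n) \<times> 'b \<Rightarrow> (real^'n) \<times> 'b \<Rightarrow> (real^'n) \<times> 'b" where
  "metric_lie j = (\<lambda>(x, _) (y, _). (0, adjoint (\<lambda>z. j z *v y) x))"

lemma inner_metric_lie:
  assumes "linear j"
  shows "z \<bullet> snd (metric_lie j (x, u) (y, v)) = x \<bullet> (j z *v y)"
proof -
  have "linear (\<lambda>z. j z *v y)"
    using assms by (auto simp: linear_iff matrix_vector_mult_add_rdistrib scaleR_matrix_vector_assoc)
  then show ?thesis
    by (simp add: metric_lie_def adjoint_works inner_commute)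
qed

definition so4_inner :: "real^4^4 \<Rightarrow> real^4^4 \<Rightarrow> real" where
  "so4_inner A B = (A \<bullet> B) / 4"

definition e_plus :: "(real^4^4)^3" where
  "e_plus = vector [wedge 1 2 + wedge 3 4, wedge 1 3 - wedge 2 4, wedge 1 4 + wedge 2 3]"

definition e_minus :: "(real^4^4)^3" where
  "e_minus = vector [wedge 1 2 - wedge 3 4, wedge 1 3 + wedge 2 4, wedge 1 4 - wedge 2 3]"

text \<open>The components of \<open>j\<close>, written in the orthonormal bases \<^const>\<open>e_plus\<close>, \<^const>\<open>e_minus\<close>.\<close>

definition j_plus :: "('b \<Rightarrow> real^4^4) \<Rightarrow> 'b \<Rightarrow> real^3" where
  "j_plus j z = (\<chi> i. so4_inner (j z) (e_plus $ i))"

definition j_minus :: "('b \<Rightarrow> real^4^4) \<Rightarrow> 'b \<Rightarrow> real^3" where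
  "j_minus j z = (\<chi> i. so4_inner (j z) (e_minus $ i))"

lemma inner_wedge: "A \<bullet> wedge i j = A $ i $ j - A $ j $ i"
proof -
  have "(\<Sum>a\<in>UNIV. \<Sum>b\<in>UNIV. A $ a $ b * of_bool (a = k \<and> b = l)) = A $ k $ l" for k l
  proof -
    have "(\<Sum>a\<in>UNIV. \<Sum>b\<in>UNIV. A $ a $ b * of_bool (a = k \<and> b = l)) =
        (\<Sum>a\<in>UNIV. \<Sum>b\<in>UNIV. if b = l then if a = k then A $ a $ b else 0 else 0)"
      by (intro sum.cong) auto
    then show ?thesis by simp
  qed
  then show ?thesis
    by (simp add: inner_vec_def wedge_def right_diff_distrib sum_subtractf)
qed

lemma so4_inner_basis:
  "so4_inner A (e_plus $ 1) = (A $ 1 $ 2 - A $ 2 $ 1 + (A $ 3 $ 4 - A $ 4 $ 3)) / 4"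
  "so4_inner A (e_plus $ 2) = (A $ 1 $ 3 - A $ 3 $ 1 - (A $ 2 $ 4 - A $ 4 $ 2)) / 4"
  "so4_inner A (e_plus $ 3) = (A $ 1 $ 4 - A $ 4 $ 1 + (A $ 2 $ 3 - A $ 3 $ 2)) / 4"
  "so4_inner A (e_minus $ 1) = (A $ 1 $ 2 - A $ 2 $ 1 - (A $ 3 $ 4 - A $ 4 $ 3)) / 4"
  "so4_inner A (e_minus $ 2) = (A $ 1 $ 3 - A $ 3 $ 1 + (A $ 2 $ 4 - A $ 4 $ 2)) / 4"
  "so4_inner A (e_minus $ 3) = (A $ 1 $ 4 - A $ 4 $ 1 - (A $ 2 $ 3 - A $ 3 $ 2)) / 4"
  by (simp_all add: so4_inner_def e_plus_def e_minus_def inner_add_right inner_diff_right inner_wedge)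

lemma e_plus_minus_orthonormal:
  "so4_inner (e_plus $ i) (e_plus $ k) = of_bool (i = k)"
  "so4_inner (e_minus $ i) (e_minus $ k) = of_bool (i = k)"
  "so4_inner (e_plus $ i) (e_minus $ k) = 0"
  using exhaust_3[of i] exhaust_3[of k]
  by (elim disjE; simp add: so4_inner_basis; simp add: e_plus_def e_minus_def wedge_def)+

lemma so4_decomposition:
  assumes "j z \<in> so"
  shows "j z = (\<Sum>i\<in>UNIV. j_plus j z $ i *\<^sub>R e_plus $ i) + (\<Sum>i\<in>UNIV. j_minus j z $ i *\<^sub>R e_minus $ i)"
proof -
  have t: "transpose (j z) = - j z"
    using assms by (simp only: so_def mem_Collect_eq)
  have s: "j z $ b $ a = - (j z $ a $ b)" for a b
  proof -
    have "j z $ b $ a = transpose (j z) $ a $ b"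
      by (simp only: transpose_def vec_lambda_beta)
    then show ?thesis
      by (simp only: t uminus_vec_def vec_lambda_beta)
  qed
  have d: "j z $ a $ a = 0" for a
    using s[of a a] by linarith
  have e: "(A + B) $ a $ b = A $ a $ b + B $ a $ b" "(c *\<^sub>R A) $ a $ b = c * A $ a $ b"
      "(A - B) $ a $ b = A $ a $ b - B $ a $ b"
    for A B :: "real^4^4" and a b c by simp_all
  show ?thesis
    unfolding vec_eq_iff forall_4 sum_3 e j_plus_def j_minus_def vec_lambda_beta so4_inner_basis d
      s[of 1 2] s[of 1 3] s[of 1 4] s[of 2 3] s[of 2 4] s[of 3 4]
    unfolding e_plus_def e_minus_def vector_3 e
    by (intro conjI; simp add: wedge_def field_simps)
qed

definition isometric_so4 :: "('b::euclidean_space \<Rightarrow> real^4^4) \<Rightarrow> bool" where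
  "isometric_so4 j \<longleftrightarrow> linear j \<and> range j \<subseteq> so \<and> (\<forall>z w. so4_inner (j z) (j w) = z \<bullet> w)"

text \<open>The multiset of eigenvalues of a self-adjoint operator, each repeated according to the
  dimension of its eigenspace.\<close>

definition has_Spec :: "('b::euclidean_space \<Rightarrow> 'b) \<Rightarrow> real multiset \<Rightarrow> bool" where
  "has_Spec T M \<longleftrightarrow> (\<forall>\<mu>. count M \<mu> = dim {v. T v = \<mu> *\<^sub>R v})"

definition invariants :: "(real^2 \<Rightarrow> real^4^4) \<Rightarrow> real \<Rightarrow> real \<Rightarrow> real \<Rightarrow> real \<Rightarrow> real \<Rightarrow> bool" where
  "invariants j \<alpha>p \<beta>p \<alpha>m \<beta>m t \<longleftrightarrow>
     (let P = adjoint (j_plus j) \<circ> j_plus j; M = adjoint (j_minus j) \<circ> j_minus j in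
       0 \<le> \<alpha>p \<and> \<alpha>p \<le> \<beta>p \<and> has_Spec P {#\<alpha>p, \<beta>p#} \<and>
       0 \<le> \<alpha>m \<and> \<alpha>m \<le> \<beta>m \<and> has_Spec M {#\<alpha>m, \<beta>m#} \<and>
       t = trace (matrix (P \<circ> M)))"

text \<open>The invariants after possibly interchanging the signs so that \<open>\<beta>\<^sub>+ \<le> \<beta>\<^sub>-\<close>.\<close>

definition labelled_invariants ::
    "(real^2 \<Rightarrow> real^4^4) \<Rightarrow> real \<Rightarrow> real \<Rightarrow> real \<Rightarrow> real \<Rightarrow> real \<Rightarrow> bool" where
  "labelled_invariants j \<alpha>p \<beta>p \<alpha>m \<beta>m t \<longleftrightarrow> \<beta>p \<le> \<beta>m \<and>
     (invariants j \<alpha>p \<beta>p \<alpha>m \<beta>m t \<or> invariants j \<alpha>m \<beta>m \<alpha>p \<beta>p t)"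


subsection \<open>One-dimensional commutator ideal\<close>

definition R4_to_R5 :: "real^4 \<Rightarrow> real^5" where
  "R4_to_R5 x = vector [x $ 1, x $ 2, x $ 3, x $ 4, 0]"

definition so4_to_so5 :: "real^4^4 \<Rightarrow> real^5^5" where
  "so4_to_so5 A = matrix R4_to_R5 ** A ** transpose (matrix R4_to_R5)"

definition conjugate_to_so4 :: "(real \<Rightarrow> real^5^5) \<Rightarrow> (real \<Rightarrow> real^4^4) \<Rightarrow> bool" where
  "conjugate_to_so4 j j' \<longleftrightarrow> linear j' \<and> range j' \<subseteq> so \<and>
     (\<exists>g. orthogonal_matrix g \<and> (\<forall>z. j z = g ** so4_to_so5 (j' z) ** transpose g))"

definition isometric_so5 :: "(real \<Rightarrow> real^5^5) \<Rightarrow> bool" where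
  "isometric_so5 j \<longleftrightarrow> (\<exists>j'. conjugate_to_so4 j j' \<and> isometric_so4 j')"

definition invariants_so5 :: "(real \<Rightarrow> real^5^5) \<Rightarrow> real \<Rightarrow> real \<Rightarrow> real \<Rightarrow> real \<Rightarrow> real \<Rightarrow> bool" where
  "invariants_so5 j \<alpha>p \<beta>p \<alpha>m \<beta>m t \<longleftrightarrow>
     (\<exists>j'. conjugate_to_so4 j j' \<and> labelled_invariants (\<lambda>z. j' (z $ 1)) \<alpha>p \<beta>p \<alpha>m \<beta>m t)"


subsection \<open>Three-dimensional commutator ideal\<close>

definition R3_to_R4 :: "real^3 \<Rightarrow> real^4" where
  "R3_to_R4 x = vector [x $ 1, x $ 2, x $ 3, 0]"

definition so3_to_so4 :: "real^3^3 \<Rightarrow> real^4^4" where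
  "so3_to_so4 A = matrix R3_to_R4 ** A ** transpose (matrix R3_to_R4)"

definition isometric_so3 :: "(real^3 \<Rightarrow> real^3^3) \<Rightarrow> bool" where
  "isometric_so3 j \<longleftrightarrow> linear j \<and> range j \<subseteq> so \<and> isometric_so4 (so3_to_so4 \<circ> j)"

definition invariants_so3 :: "(real^3 \<Rightarrow> real^3^3) \<Rightarrow> real \<Rightarrow> real \<Rightarrow> real \<Rightarrow> bool" where
  "invariants_so3 j \<omega> \<alpha> \<beta> \<longleftrightarrow>
     (let j4 = so3_to_so4 \<circ> j in
       0 \<le> \<omega> \<and> \<omega> \<le> \<alpha> \<and> \<alpha> \<le> \<beta> \<and>
       has_Spec (adjoint (j_plus j4) \<circ> j_plus j4) {#\<omega>, \<alpha>, \<beta>#} \<and>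
       has_Spec (adjoint (j_minus j4) \<circ> j_minus j4) {#\<omega>, \<alpha>, \<beta>#})"

end

theory Submission
  imports Defs
begin

text \<open>A bracket with \<open>k\<close>-dimensional commutator ideal is a \<open>k\<close>-dimensional space of two-forms on
  \<open>\<real>\<^bsup>6-k\<^esup>\<close>. For \<open>k = 2\<close> the Pfaffian restricts to a quadratic form on this plane of two-forms,
  and diagonalizing it leaves two forms \<open>A\<close>, \<open>B\<close> with \<open>A \<and> B = 0\<close> and \<open>A \<and> A\<close> proportional to
  \<open>B \<and> B\<close>. Inserting two vectors \<open>x\<close>, \<open>y\<close> with \<open>A(x,y) = 1\<close>, \<open>B(x,y) = 0\<close> into these two
  identities between four-forms yields the normal forms, so the isomorphism type is
  decided by the signature of the Pfaffian. For isometric \<open>j\<close> the Pfaffian at \<open>z\<close> is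
  \<open>\<bar>j\<^sub>+ z\<bar>\<^sup>2 - \<bar>j\<^sub>- z\<bar>\<^sup>2\<close>, with eigenvalues \<open>2\<alpha>\<^sub>+ - 1\<close> and \<open>1 - 2\<alpha>\<^sub>-\<close>. For \<open>k = 1\<close> a two-form on
  \<open>\<real>\<^sup>5\<close> has a kernel and comes from \<open>\<real>\<^sup>4\<close>, where the Pfaffian detects its rank; for
  \<open>k = 3\<close> all two-forms on \<open>\<real>\<^sup>3\<close> occur.\<close>

section \<open>Vectors and isomorphisms\<close>

text \<open>Only isomorphism types matter, so the change of basis of R^2 need not be orthogonal and
  the coordinates on R^4 need not fit the metric: it is enough to find four linear functionals with
  trivial common kernel in which the two forms look right. Contractions of the forms supply them
  unless the Pfaffian vanishes on the whole plane; then only three functionals occur, or two if a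
  single decomposable form is left, and a complement has to be added. The condition B(x,y) = 0 is
  met by subtracting a multiple of A from B when A is isotropic; a definite Pfaffian does not allow
  this and calls for a rotation of the plane, while an indefinite one is handled through its two
  isotropic forms. Isometric representatives do not come from deforming a given metric: each type
  gets an explicit isometric example. That the types differ is shown without the Pfaffian, by
  properties of the bracket: the elements x with ad x of rank at most one, whether these commute,
  and whether every central vector is a bracket; for k = 1, by the Pluecker relation.\<close>

lemma exhaust_5: "x = 1 \<or> x = 2 \<or> x = 3 \<or> x = 4 \<or> x = 5" for x :: 5
proof (induct x)
  case (of_int z)
  then have "z = 0 \<or> z = 1 \<or> z = 2 \<or> z = 3 \<or> z = 4" by fastforce
  then show ?case by auto
qed

lemma exhaust_6: "x = 1 \<or> x = 2 \<or> x = 3 \<or> x = 4 \<or> x = 5 \<or> x = 6" for x :: 6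
proof (induct x)
  case (of_int z)
  then have "z = 0 \<or> z = 1 \<or> z = 2 \<or> z = 3 \<or> z = 4 \<or> z = 5" by fastforce
  then show ?case by auto
qed

lemma forall_5: "(\<forall>i::5. P i) \<longleftrightarrow> P 1 \<and> P 2 \<and> P 3 \<and> P 4 \<and> P 5"
  by (metis exhaust_5)

lemma forall_6: "(\<forall>i::6. P i) \<longleftrightarrow> P 1 \<and> P 2 \<and> P 3 \<and> P 4 \<and> P 5 \<and> P 6"
  by (metis exhaust_6)

lemma sum_5: "sum f (UNIV :: 5 set) = f 1 + f 2 + f 3 + f 4 + f 5"
proof -
  have U: "(UNIV :: 5 set) = {1, 2, 3, 4, 5}" using exhaust_5 by auto
  show ?thesis unfolding U by (simp add: ac_simps)
qed

lemma vector_4 [simp]: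
  "(vector [a, b, c, d] :: 'a::zero^4) $ 1 = a"
  "(vector [a, b, c, d] :: 'a::zero^4) $ 2 = b"
  "(vector [a, b, c, d] :: 'a::zero^4) $ 3 = c"
  "(vector [a, b, c, d] :: 'a::zero^4) $ 4 = d"
  unfolding vector_def by simp_all

lemma vector_5 [simp]:
  "(vector [a, b, c, d, e] :: 'a::zero^5) $ 1 = a"
  "(vector [a, b, c, d, e] :: 'a::zero^5) $ 2 = b"
  "(vector [a, b, c, d, e] :: 'a::zero^5) $ 3 = c"
  "(vector [a, b, c, d, e] :: 'a::zero^5) $ 4 = d"
  "(vector [a, b, c, d, e] :: 'a::zero^5) $ 5 = e"
  unfolding vector_def by simp_all

lemma vector_6 [simp]:
  "(vector [a, b, c, d, e, f] :: 'a::zero^6) $ 1 = a"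
  "(vector [a, b, c, d, e, f] :: 'a::zero^6) $ 2 = b"
  "(vector [a, b, c, d, e, f] :: 'a::zero^6) $ 3 = c"
  "(vector [a, b, c, d, e, f] :: 'a::zero^6) $ 4 = d"
  "(vector [a, b, c, d, e, f] :: 'a::zero^6) $ 5 = e"
  "(vector [a, b, c, d, e, f] :: 'a::zero^6) $ 6 = f"
  unfolding vector_def by simp_all

lemma lie_iso_sym: "br \<cong>\<^sub>L br' \<Longrightarrow> br' \<cong>\<^sub>L br"
proof -
  assume "br \<cong>\<^sub>L br'"
  then obtain f where f: "linear f" "bij f" "\<And>x y. f (br x y) = br' (f x) (f y)"
    unfolding lie_iso_def by blast
  obtain g where g: "linear g" "g \<circ> f = id"
    using linear_injective_left_inverse[of f] f by (auto simp: bij_is_inj)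
  have gf: "g (f x) = x" for x using g(2) by (metis comp_apply id_apply)
  have fg: "f (g y) = y" for y using f(2) gf by (metis bij_pointE)
  have "bij g" using gf fg by (intro bijI') metis+
  moreover have "g (br' x y) = br (g x) (g y)" for x y
    by (metis f(3) fg gf)
  ultimately show ?thesis unfolding lie_iso_def using g(1) by blast
qed

lemma lie_iso_trans [trans]: "br \<cong>\<^sub>L br' \<Longrightarrow> br' \<cong>\<^sub>L br'' \<Longrightarrow> br \<cong>\<^sub>L br''"
proof -
  assume "br \<cong>\<^sub>L br'" "br' \<cong>\<^sub>L br''"
  then obtain f g where "linear f" "bij f" "\<And>x y. f (br x y) = br' (f x) (f y)"
     "linear g" "bij g" "\<And>x y. g (br' x y) = br'' (g x) (g y)"
    unfolding lie_iso_def by blast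
  then have "linear (g \<circ> f)" "bij (g \<circ> f)" "\<And>x y. (g \<circ> f) (br x y) = br'' ((g \<circ> f) x) ((g \<circ> f) y)"
    by (auto simp: linear_compose bij_comp)
  then show ?thesis unfolding lie_iso_def by blast
qed

lemma linear_kernel_zero_bij:
  fixes f :: "'a::euclidean_space \<Rightarrow> 'b::euclidean_space"
  assumes "linear f" "\<And>x. f x = 0 \<Longrightarrow> x = 0" "DIM('a) = DIM('b)"
  shows "bij f"
proof -
  have "inj f" using assms by (simp add: linear_injective_0)
  have "dim (range f) = DIM('b)"
    using dim_image_eq[of f UNIV] assms \<open>inj f\<close> by simp
  then have "range f = UNIV"
    using dim_eq_full[of "range f"] assms(1)
    by (metis linear_subspace_image span_eq_iff subspace_UNIV)
  with \<open>inj f\<close> show ?thesis by (simp add: bij_def)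
qed

text \<open>In equal finite dimensions a trivial kernel already gives bijectivity, so no inverse has
  to be written down for the coordinate changes below.\<close>

lemma lie_isoI:
  fixes f :: "'a::euclidean_space \<Rightarrow> 'b::euclidean_space"
  assumes "linear f" "\<And>x. f x = 0 \<Longrightarrow> x = 0" "DIM('a) = DIM('b)"
    and "\<And>x y. f (br x y) = br' (f x) (f y)"
  shows "br \<cong>\<^sub>L br'"
  unfolding lie_iso_def using linear_kernel_zero_bij assms by blast

section \<open>Coordinate formulas for the model brackets and their named counterparts\<close>

lemma inner_2: "x \<bullet> y = x $ 1 * y $ 1 + x $ 2 * y $ 2" for x y :: "real^2"
  by (simp add: inner_vec_def sum_2)

lemma wedge_form: "x \<bullet> (wedge i k *v y) = x $ i * y $ k - x $ k * y $ i"
proof -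
  have "(\<Sum>b\<in>UNIV. of_bool (a = i \<and> b = k) * y $ b) = (if a = i then y $ k else 0)" for a i k
  proof -
    have "(\<Sum>b\<in>UNIV. of_bool (a = i \<and> b = k) * y $ b) =
        (\<Sum>b\<in>UNIV. if b = k then if a = i then y $ b else 0 else 0)"
      by (intro sum.cong) auto
    then show ?thesis by simp
  qed
  then have "wedge i k *v y = axis i (y $ k) - axis k (y $ i)"
    by (simp add: vec_eq_iff matrix_vector_mult_def wedge_def axis_def left_diff_distrib sum_subtractf)
  then show ?thesis by (simp add: inner_diff_right inner_axis)
qed

lemma lie6_eq:
  "lie6 [a, b, c, d, e, f] x y =
    - vector [x \<bullet> (a *v y), x \<bullet> (b *v y), x \<bullet> (c *v y), x \<bullet> (d *v y), x \<bullet> (e *v y), x \<bullet> (f *v y)]"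
  by (simp add: lie6_def structure_bracket_def vec_eq_iff forall_6)

lemmas lie6_simps = lie6_eq wedge_form matrix_vector_mult_add_rdistrib inner_add_right

lemma linear_vectorI:
  "linear g1 \<Longrightarrow> linear g2 \<Longrightarrow> linear g3 \<Longrightarrow> linear g4 \<Longrightarrow> linear g5 \<Longrightarrow> linear g6 \<Longrightarrow>
    linear (\<lambda>x. vector [g1 x, g2 x, g3 x, g4 x, g5 x, g6 x] :: real^6)"
  by (simp add: linear_iff vec_eq_iff forall_6)

text \<open>The central coordinate carries a minus sign because de(x,y) = - e([x,y]) in
  \<open>structure_bracket\<close>. The coordinates of p and q are interleaved to match 12 +
  34.\<close>

lemma lie6_h5: "lie6 [0, 0, 0, 0, 0, wedge 1 2 + wedge 3 4] \<cong>\<^sub>L h5 \<oplus>\<^sub>L (zero_bracket :: real \<Rightarrow> _)"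
  by (rule lie_iso_sym, rule lie_isoI[where f = "\<lambda>((p, q, r), s). vector [p $ 1, q $ 1, p $ 2, q $ 2, s, - r]"])
    (auto simp: linear_iff vec_eq_iff forall_6 lie6_simps h5_def heisenberg_def direct_sum_def
     zero_bracket_def inner_2 forall_2 zero_prod_def)

lemma lie6_h3: "lie6 [0, 0, 0, 0, 0, wedge 1 2] \<cong>\<^sub>L h3 \<oplus>\<^sub>L (zero_bracket :: real^3 \<Rightarrow> _)"
  by (rule lie_iso_sym, rule lie_isoI[where f = "\<lambda>((p, q, r), s). vector [p, q, s $ 1, s $ 2, s $ 3, - r]"])
    (auto simp: linear_iff vec_eq_iff forall_6 lie6_simps h3_def heisenberg_def direct_sum_def
     zero_bracket_def forall_3 zero_prod_def)

lemma lie6_h3_h3: "lie6 [0, 0, 0, 0, wedge 1 2, wedge 3 4] \<cong>\<^sub>L h3 \<oplus>\<^sub>L h3"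
  by (rule lie_iso_sym, rule lie_isoI[where f = "\<lambda>((p, q, r), (p', q', r')). vector [p, q, p', q', - r, - r']"])
    (auto simp: linear_iff vec_eq_iff forall_6 lie6_simps h3_def heisenberg_def direct_sum_def
      zero_prod_def)

lemma lie6_n5: "lie6 [0, 0, 0, 0, wedge 1 2, wedge 1 3] \<cong>\<^sub>L n5 \<oplus>\<^sub>L (zero_bracket :: real \<Rightarrow> _)"
  by (rule lie_iso_sym, rule lie_isoI[where f = "\<lambda>(x, s). vector [x $ 1, x $ 2, x $ 3, s, x $ 4, x $ 5]"])
    (auto simp: linear_iff vec_eq_iff forall_6 forall_5 lie6_simps n5_def direct_sum_def
      zero_bracket_def structure_bracket_def zero_prod_def)

text \<open>The two forms are the real and imaginary parts of (e1 + i e2) \<and> (e3 + i e4), which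
  is the complex Heisenberg form in the coordinates p and q.\<close>

lemma lie6_h3_complex:
  "lie6 [0, 0, 0, 0, wedge 1 3 + wedge 4 2, wedge 1 4 + wedge 2 3] \<cong>\<^sub>L h3_complex"
  by (rule lie_iso_sym, rule lie_isoI[where f = "\<lambda>(p, q, r). vector [Re p, Im p, Re q, Im q, - Re r, - Im r]"])
    (auto simp: linear_iff vec_eq_iff forall_6 lie6_simps h3_complex_def complex_eq_iff
      zero_prod_def)

section \<open>Non-isomorphic algebras\<close>

text \<open>The range of ad x lies in a line. This refers to the bracket alone, so isomorphisms
  preserve it; it separates most of the types with two-dimensional commutator ideal.\<close>

definition ad_rank_le_1 :: "('a::real_vector \<Rightarrow> 'a \<Rightarrow> 'a) \<Rightarrow> 'a \<Rightarrow> bool" where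
  "ad_rank_le_1 br x \<longleftrightarrow> (\<exists>w. \<forall>y. \<exists>c. br x y = c *\<^sub>R w)"

text \<open>Multiples of one vector have vanishing 2x2 minors. Suitable y and z turn this into
  quadratic equations for the coordinates of x.\<close>

lemma ad_rank_le_1_lie6:
  assumes "ad_rank_le_1 (lie6 \<omega>s) x"
  shows "lie6 \<omega>s x y $ i * lie6 \<omega>s x z $ k = lie6 \<omega>s x y $ k * lie6 \<omega>s x z $ i"
proof -
  obtain w a b where "lie6 \<omega>s x y = a *\<^sub>R w" "lie6 \<omega>s x z = b *\<^sub>R w"
    using assms unfolding ad_rank_le_1_def by metis
  then show ?thesis by simp
qed

lemma linear_bij_nonzero: "linear f \<Longrightarrow> bij f \<Longrightarrow> x \<noteq> 0 \<Longrightarrow> f x \<noteq> 0"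
  using bij_is_inj linear_injective_0 by blast

lemma ad_rank_le_1_transfer:
  assumes "linear f" "bij f" "\<And>x y. f (br x y) = br' (f x) (f y)" "ad_rank_le_1 br x"
  shows "ad_rank_le_1 br' (f x)"
proof -
  obtain w where w: "\<forall>y. \<exists>c. br x y = c *\<^sub>R w" using assms(4) unfolding ad_rank_le_1_def by blast
  have "\<exists>c. br' (f x) y = c *\<^sub>R f w" for y
  proof -
    obtain y' where "y = f y'" using assms(2) by (metis bij_pointE)
    then show ?thesis using w assms(1,3) by (metis linear_cmul)
  qed
  then show ?thesis unfolding ad_rank_le_1_def by blast
qed

lemma lie_iso_noncentral_rank_1:
  assumes "br \<cong>\<^sub>L br'" "ad_rank_le_1 br x" "br x y \<noteq> 0"
  shows "\<exists>x y. ad_rank_le_1 br' x \<and> br' x y \<noteq> 0"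
proof -
  obtain f where f: "linear f" "bij f" "\<And>x y. f (br x y) = br' (f x) (f y)"
    using assms(1) unfolding lie_iso_def by blast
  have "br' (f x) (f y) \<noteq> 0"
    using linear_bij_nonzero[OF f(1,2) assms(3)] f(3) by simp
  moreover have "ad_rank_le_1 br' (f x)" by (rule ad_rank_le_1_transfer[of f br br', OF f assms(2)])
  ultimately show ?thesis by blast
qed

lemma lie_iso_noncommuting_rank_1:
  assumes "br \<cong>\<^sub>L br'" "ad_rank_le_1 br x" "ad_rank_le_1 br y" "br x y \<noteq> 0"
  shows "\<exists>x y. ad_rank_le_1 br' x \<and> ad_rank_le_1 br' y \<and> br' x y \<noteq> 0"
proof -
  obtain f where f: "linear f" "bij f" "\<And>x y. f (br x y) = br' (f x) (f y)"
    using assms(1) unfolding lie_iso_def by blast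
  have "br' (f x) (f y) \<noteq> 0"
    using linear_bij_nonzero[OF f(1,2) assms(4)] f(3) by simp
  moreover have "ad_rank_le_1 br' (f x)" by (rule ad_rank_le_1_transfer[of f br br', OF f assms(2)])
  moreover have "ad_rank_le_1 br' (f y)" by (rule ad_rank_le_1_transfer[of f br br', OF f assms(3)])
  ultimately show ?thesis by blast
qed

text \<open>The property is carried back along the isomorphism, so that a concrete witness in
  \<open>br'\<close> can be confronted with an algebra in which every central vector is a
  bracket.\<close>

lemma lie_iso_central_noncommutator:
  assumes "br \<cong>\<^sub>L br'" "\<And>y. br' x y = 0" "\<And>u v. br' u v \<noteq> x"
  shows "\<exists>x. (\<forall>y. br x y = 0) \<and> (\<forall>u v. br u v \<noteq> x)"
proof -
  obtain f where f: "linear f" "bij f" "\<And>x y. f (br' x y) = br (f x) (f y)"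
    using lie_iso_sym[OF assms(1)] unfolding lie_iso_def by blast
  have "br (f x) y = 0" for y
    using f assms(2) by (metis bij_pointE linear_0)
  moreover have "br u v \<noteq> f x" for u v
    using f assms(3) by (metis bij_pointE)
  ultimately show ?thesis by blast
qed

lemma ad_rank_le_1_h3_h3:
  "ad_rank_le_1 (lie6 [0, 0, 0, 0, wedge 1 2, wedge 3 4]) (vector [1, 0, 0, 0, 0, 0])"
  "ad_rank_le_1 (lie6 [0, 0, 0, 0, wedge 1 2, wedge 3 4]) (vector [0, 1, 0, 0, 0, 0])"
  unfolding ad_rank_le_1_def lie6_simps
  by (rule exI[of _ "vector [0, 0, 0, 0, 1, 0]"]; simp add: vec_eq_iff forall_6)+

text \<open>The minors for the basis vectors 1, 3 and for 2, 4 are, up to sign, the squares of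
  \<open>x $ 2\<close> and \<open>x $ 1\<close>.\<close>

lemma ad_rank_le_1_semidefinite:
  assumes "ad_rank_le_1 (lie6 [0, 0, 0, 0, wedge 1 2, wedge 1 4 + wedge 2 3]) x"
  shows "x $ 1 = 0 \<and> x $ 2 = 0"
  using ad_rank_le_1_lie6[OF assms, of "vector [1, 0, 0, 0, 0, 0]" 5 "vector [0, 0, 1, 0, 0, 0]" 6]
    ad_rank_le_1_lie6[OF assms, of "vector [0, 1, 0, 0, 0, 0]" 5 "vector [0, 0, 0, 1, 0, 0]" 6]
  by (simp add: lie6_simps)

lemma ad_rank_le_1_n5:
  assumes "ad_rank_le_1 (lie6 [0, 0, 0, 0, wedge 1 2, wedge 1 3]) x"
  shows "x $ 1 = 0"
  using ad_rank_le_1_lie6[OF assms, of "vector [0, 1, 0, 0, 0, 0]" 5 "vector [0, 0, 1, 0, 0, 0]" 6]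
  by (simp add: lie6_simps)

text \<open>Here ad x is complex linear, so its real rank is even and rank at most one forces x to
  be central. In coordinates, the chosen minors are sums of two squares.\<close>

lemma ad_rank_le_1_h3_complex:
  assumes "ad_rank_le_1 (lie6 [0, 0, 0, 0, wedge 1 3 + wedge 4 2, wedge 1 4 + wedge 2 3]) x"
  shows "x $ 1 = 0 \<and> x $ 2 = 0 \<and> x $ 3 = 0 \<and> x $ 4 = 0"
proof -
  have "(x $ 3)\<^sup>2 + (x $ 4)\<^sup>2 = 0"
    using ad_rank_le_1_lie6[OF assms, of "vector [1, 0, 0, 0, 0, 0]" 5 "vector [0, 1, 0, 0, 0, 0]" 6]
    by (simp add: lie6_simps power2_eq_square)
  moreover have "(x $ 1)\<^sup>2 + (x $ 2)\<^sup>2 = 0"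
    using ad_rank_le_1_lie6[OF assms, of "vector [0, 0, 1, 0, 0, 0]" 5 "vector [0, 0, 0, 1, 0, 0]" 6]
    by (simp add: lie6_simps power2_eq_square)
  ultimately show ?thesis by (simp add: sum_power2_eq_zero_iff)
qed

lemma h3_h3_not_iso:
  assumes "lie6 [0, 0, 0, 0, wedge 1 2, wedge 3 4] \<cong>\<^sub>L br"
  shows "\<exists>x y. ad_rank_le_1 br x \<and> ad_rank_le_1 br y \<and> br x y \<noteq> 0"
proof (rule lie_iso_noncommuting_rank_1[OF assms ad_rank_le_1_h3_h3])
  show "lie6 [0, 0, 0, 0, wedge 1 2, wedge 3 4] (vector [1, 0, 0, 0, 0, 0]) (vector [0, 1, 0, 0, 0, 0]) \<noteq> 0"
    by (simp add: lie6_simps vec_eq_iff forall_6)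
qed

text \<open>In the direct sum of two Heisenberg algebras the two generators of one summand both have
  ad of rank one and do not commute. In each of the other three algebras the elements of rank at
  most one lie in a subspace on which the bracket vanishes.\<close>

lemma h3_h3_not_iso_others:
  "\<not> lie6 [0, 0, 0, 0, wedge 1 2, wedge 3 4] \<cong>\<^sub>L lie6 [0, 0, 0, 0, wedge 1 2, wedge 1 4 + wedge 2 3]"
  "\<not> lie6 [0, 0, 0, 0, wedge 1 2, wedge 3 4] \<cong>\<^sub>L lie6 [0, 0, 0, 0, wedge 1 2, wedge 1 3]"
  "\<not> lie6 [0, 0, 0, 0, wedge 1 2, wedge 3 4] \<cong>\<^sub>L
    lie6 [0, 0, 0, 0, wedge 1 3 + wedge 4 2, wedge 1 4 + wedge 2 3]"
proof -
  have 0: "lie6 [0, 0, 0, 0, wedge 1 2, wedge 1 4 + wedge 2 3] x y = 0"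
    if "x $ 1 = 0 \<and> x $ 2 = 0" "y $ 1 = 0 \<and> y $ 2 = 0" for x y
    using that by (simp add: lie6_simps vec_eq_iff forall_6)
  show "\<not> lie6 [0, 0, 0, 0, wedge 1 2, wedge 3 4] \<cong>\<^sub>L lie6 [0, 0, 0, 0, wedge 1 2, wedge 1 4 + wedge 2 3]"
    using h3_h3_not_iso ad_rank_le_1_semidefinite 0 by blast
  have 0: "lie6 [0, 0, 0, 0, wedge 1 2, wedge 1 3] x y = 0" if "x $ 1 = 0" "y $ 1 = 0" for x y
    using that by (simp add: lie6_simps vec_eq_iff forall_6)
  show "\<not> lie6 [0, 0, 0, 0, wedge 1 2, wedge 3 4] \<cong>\<^sub>L lie6 [0, 0, 0, 0, wedge 1 2, wedge 1 3]"
    using h3_h3_not_iso ad_rank_le_1_n5 0 by blast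
  have 0: "lie6 [0, 0, 0, 0, wedge 1 3 + wedge 4 2, wedge 1 4 + wedge 2 3] x y = 0"
    if "x $ 1 = 0 \<and> x $ 2 = 0 \<and> x $ 3 = 0 \<and> x $ 4 = 0" for x y
    using that by (simp add: lie6_simps vec_eq_iff forall_6)
  show "\<not> lie6 [0, 0, 0, 0, wedge 1 2, wedge 3 4] \<cong>\<^sub>L
    lie6 [0, 0, 0, 0, wedge 1 3 + wedge 4 2, wedge 1 4 + wedge 2 3]"
    using h3_h3_not_iso ad_rank_le_1_h3_complex 0 by blast
qed

text \<open>The fourth basis vector on the left pairs only with the first, so it is noncentral with
  ad of rank one; the complex Heisenberg algebra has no such element.\<close>

lemma semidefinite_not_iso_h3_complex:
  "\<not> lie6 [0, 0, 0, 0, wedge 1 2, wedge 1 4 + wedge 2 3] \<cong>\<^sub>L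
    lie6 [0, 0, 0, 0, wedge 1 3 + wedge 4 2, wedge 1 4 + wedge 2 3]" (is "\<not> ?B \<cong>\<^sub>L ?D")
proof
  assume iso: "?B \<cong>\<^sub>L ?D"
  have "ad_rank_le_1 ?B (vector [0, 0, 0, 1, 0, 0])"
    unfolding ad_rank_le_1_def lie6_simps
    by (rule exI[of _ "vector [0, 0, 0, 0, 0, 1]"]; simp add: vec_eq_iff forall_6)
  moreover have "?B (vector [0, 0, 0, 1, 0, 0]) (vector [1, 0, 0, 0, 0, 0]) \<noteq> 0"
    by (simp add: lie6_simps vec_eq_iff forall_6)
  ultimately obtain x y where "ad_rank_le_1 ?D x" "?D x y \<noteq> 0"
    using lie_iso_noncentral_rank_1[OF iso] by blast
  then show False
    using ad_rank_le_1_h3_complex[of x] by (simp add: lie6_simps vec_eq_iff forall_6)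
qed

lemma n5_not_iso_h3_complex:
  "\<not> lie6 [0, 0, 0, 0, wedge 1 2, wedge 1 3] \<cong>\<^sub>L
    lie6 [0, 0, 0, 0, wedge 1 3 + wedge 4 2, wedge 1 4 + wedge 2 3]" (is "\<not> ?C \<cong>\<^sub>L ?D")
proof
  assume iso: "?C \<cong>\<^sub>L ?D"
  have "ad_rank_le_1 ?C (vector [0, 1, 0, 0, 0, 0])"
    unfolding ad_rank_le_1_def lie6_simps
    by (rule exI[of _ "vector [0, 0, 0, 0, 1, 0]"]; simp add: vec_eq_iff forall_6)
  moreover have "?C (vector [0, 1, 0, 0, 0, 0]) (vector [1, 0, 0, 0, 0, 0]) \<noteq> 0"
    by (simp add: lie6_simps vec_eq_iff forall_6)
  ultimately obtain x y where "ad_rank_le_1 ?D x" "?D x y \<noteq> 0"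
    using lie_iso_noncentral_rank_1[OF iso] by blast
  then show False
    using ad_rank_le_1_h3_complex[of x] by (simp add: lie6_simps vec_eq_iff forall_6)
qed

text \<open>Both algebras have noncentral elements of rank one, and in both these commute, so the
  center is used instead: on the right the fourth basis vector is central without being a bracket,
  on the left every central vector is a bracket.\<close>

lemma semidefinite_not_iso_n5:
  "\<not> lie6 [0, 0, 0, 0, wedge 1 2, wedge 1 4 + wedge 2 3] \<cong>\<^sub>L
    lie6 [0, 0, 0, 0, wedge 1 2, wedge 1 3]" (is "\<not> ?B \<cong>\<^sub>L ?C")
proof
  assume iso: "?B \<cong>\<^sub>L ?C"
  have "?C (vector [0, 0, 0, 1, 0, 0]) y = 0" for y
    by (simp add: lie6_simps vec_eq_iff forall_6)
  moreover have "?C u v \<noteq> vector [0, 0, 0, 1, 0, 0]" for u v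
    by (simp add: lie6_simps vec_eq_iff forall_6)
  ultimately obtain x where x: "\<And>y. ?B x y = 0" "\<And>u v. ?B u v \<noteq> x"
    using lie_iso_central_noncommutator[OF iso] by metis
  have "x $ 1 = 0 \<and> x $ 2 = 0" "x $ 3 = 0 \<and> x $ 4 = 0"
    using x(1)[of "vector [1, 0, 0, 0, 0, 0]"] x(1)[of "vector [0, 1, 0, 0, 0, 0]"]
    by (auto simp: lie6_simps vec_eq_iff forall_6)
  \<comment> \<open>Bracketing with the first basis vector reaches both central directions at once,
    through the coordinates 2 and 4; the entry -1 cancels the sign in
    \<open>structure_bracket\<close>.\<close>
  then have "?B (vector [-1, 0, 0, 0, 0, 0]) (vector [0, x $ 5, 0, x $ 6, 0, 0]) = x"
    by (simp add: lie6_simps vec_eq_iff forall_6)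
  with x(2) show False by blast
qed

text \<open>A decomposable form satisfies the Pluecker relation for any four vectors. The form 12 +
  34 violates it on the standard basis: all mixed values vanish, while its values on (1,2) and (3,4)
  are equal and nonzero.\<close>

lemma h5_not_iso_h3:
  "\<not> lie6 [0, 0, 0, 0, 0, wedge 1 2 + wedge 3 4] \<cong>\<^sub>L lie6 [0, 0, 0, 0, 0, wedge 1 2]" (is "\<not> ?A \<cong>\<^sub>L ?B")
proof
  assume "?A \<cong>\<^sub>L ?B"
  then obtain f where f: "linear f" "bij f" "\<And>x y. f (?A x y) = ?B (f x) (f y)"
    unfolding lie_iso_def by blast
  let ?e1 = "vector [1, 0, 0, 0, 0, 0] :: real^6" and ?e2 = "vector [0, 1, 0, 0, 0, 0] :: real^6"
  let ?e3 = "vector [0, 0, 1, 0, 0, 0] :: real^6" and ?e4 = "vector [0, 0, 0, 1, 0, 0] :: real^6"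
  have br: "?A ?e1 ?e3 = 0" "?A ?e1 ?e4 = 0" "?A ?e2 ?e3 = 0" "?A ?e2 ?e4 = 0" "?A ?e3 ?e4 = ?A ?e1 ?e2"
    "?A ?e1 ?e2 \<noteq> 0"
    by (auto simp: lie6_simps vec_eq_iff forall_6)
  have nz: "?B (f ?e1) (f ?e2) \<noteq> 0"
    using linear_bij_nonzero[OF f(1,2) br(6)] by (simp only: f(3) not_False_eq_True)
  have "?B (f ?e1) (f ?e3) = 0" "?B (f ?e1) (f ?e4) = 0" "?B (f ?e2) (f ?e3) = 0" "?B (f ?e2) (f ?e4) = 0"
      "?B (f ?e3) (f ?e4) = ?B (f ?e1) (f ?e2)"
    by (simp_all only: br(1-5) linear_0[OF f(1)] flip: f(3))
  moreover have "?B x y $ 6 * ?B z w $ 6 = ?B x z $ 6 * ?B y w $ 6 - ?B x w $ 6 * ?B y z $ 6" for x y z w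
    by (simp add: lie6_simps) algebra
  from this[of "f ?e1" "f ?e2" "f ?e3" "f ?e4"] calculation have "?B (f ?e1) (f ?e2) $ 6 * ?B (f ?e1) (f ?e2) $ 6 = 0"
    by (simp only: zero_index mult_zero_left diff_self)
  with nz show False by (simp add: lie6_simps vec_eq_iff forall_6)
qed

section \<open>Pencils of two-forms on four-space\<close>

text \<open>The value at \<open>A\<close>, \<open>A\<close> is twice the Pfaffian of \<open>A\<close>.\<close>

definition pfaffian_form :: "real^4^4 \<Rightarrow> real^4^4 \<Rightarrow> real" where
  "pfaffian_form A B = A $ 1 $ 2 * B $ 3 $ 4 - A $ 1 $ 3 * B $ 2 $ 4 + A $ 1 $ 4 * B $ 2 $ 3
     + A $ 2 $ 3 * B $ 1 $ 4 - A $ 2 $ 4 * B $ 1 $ 3 + A $ 3 $ 4 * B $ 1 $ 2"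

text \<open>The Pluecker coordinates of x \<and> y. The index type is left open: on R^2 this is the
  determinant testing for a basis, on R^3 and R^4 it expands two-forms.\<close>

definition minor2 :: "'n \<Rightarrow> 'n \<Rightarrow> real^'n \<Rightarrow> real^'n \<Rightarrow> real" where
  "minor2 i k x y = x $ i * y $ k - x $ k * y $ i"

lemma so_entries:
  assumes "A \<in> so"
  shows "A $ k $ i = - (A $ i $ k)"
proof -
  have "transpose A $ i $ k = (- A) $ i $ k" using assms by (simp add: so_def)
  then show ?thesis by (simp add: transpose_def)
qed

lemma soI:
  assumes "\<And>i k. A $ k $ i = - (A $ i $ k)"
  shows "A \<in> so"
proof -
  have "transpose A $ i $ k = (- A) $ i $ k" for i k using assms[of k i] by (simp add: transpose_def)
  then show ?thesis unfolding so_def vec_eq_iff by blast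
qed

lemma so4_form:
  assumes "A \<in> so"
  shows "x \<bullet> (A *v y) = A $ 1 $ 2 * minor2 1 2 x y + A $ 1 $ 3 * minor2 1 3 x y + A $ 1 $ 4 * minor2 1 4 x y
    + A $ 2 $ 3 * minor2 2 3 x y + A $ 2 $ 4 * minor2 2 4 x y + A $ 3 $ 4 * minor2 3 4 (x :: real^4) y"
proof -
  note s = so_entries[OF assms]
  have d: "A $ i $ i = 0" for i using s[of i i] by simp
  show ?thesis
    unfolding inner_vec_def matrix_vector_mult_def minor2_def
    by (simp add: sum_4 d s[of 2 1] s[of 3 1] s[of 4 1] s[of 3 2] s[of 4 2] s[of 4 3]) algebra
qed

text \<open>The determinant of x, y, u, v by Laplace expansion along the pairs (x,y) and (u,v),
  arranged to match \<open>pfaffian_form\<close> term by term.\<close>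

definition det4 :: "real^4 \<Rightarrow> real^4 \<Rightarrow> real^4 \<Rightarrow> real^4 \<Rightarrow> real" where
  "det4 x y u v = minor2 1 2 x y * minor2 3 4 u v - minor2 1 3 x y * minor2 2 4 u v
     + minor2 1 4 x y * minor2 2 3 u v + minor2 2 3 x y * minor2 1 4 u v
     - minor2 2 4 x y * minor2 1 3 u v + minor2 3 4 x y * minor2 1 2 u v"

text \<open>\<open>A \<and> B\<close> is a multiple of the volume form.\<close>

lemma wedge_product_so4:
  assumes "A \<in> so" "B \<in> so"
  shows "x \<bullet> (A *v y) * (u \<bullet> (B *v v)) + x \<bullet> (B *v y) * (u \<bullet> (A *v v))
    - x \<bullet> (A *v u) * (y \<bullet> (B *v v)) - x \<bullet> (B *v u) * (y \<bullet> (A *v v))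
    + x \<bullet> (A *v v) * (y \<bullet> (B *v u)) + x \<bullet> (B *v v) * (y \<bullet> (A *v u))
    = pfaffian_form A B * det4 x y u v"
  unfolding so4_form[OF assms(1)] so4_form[OF assms(2)] pfaffian_form_def det4_def minor2_def
  by algebra

text \<open>The common last step of the normal forms with R^4 as complement: a, b, c, d are
  coordinates in which \<open>j e\<close> and \<open>j f\<close> become the model forms, and e, f
  are any basis of R^2. The free s, t say that the model forms do not see the two central
  coordinates, which in the isomorphism are minus the products with e and f.\<close>

lemma metric_lie_iso_lie6:
  fixes j :: "real^2 \<Rightarrow> real^4^4"
  assumes "linear j" and ef: "\<And>u. e \<bullet> u = 0 \<Longrightarrow> f \<bullet> u = 0 \<Longrightarrow> u = 0"
    and "linear a" "linear b" "linear c" "linear d"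
    and inj: "\<And>x. a x = 0 \<Longrightarrow> b x = 0 \<Longrightarrow> c x = 0 \<Longrightarrow> d x = 0 \<Longrightarrow> x = 0"
    and e: "\<And>x y s t s' t'. x \<bullet> (j e *v y) =
       vector [a x, b x, c x, d x, s, t] \<bullet> (\<omega>5 *v vector [a y, b y, c y, d y, s', t'])"
    and f: "\<And>x y s t s' t'. x \<bullet> (j f *v y) =
       vector [a x, b x, c x, d x, s, t] \<bullet> (\<omega>6 *v vector [a y, b y, c y, d y, s', t'])"
  shows "metric_lie j \<cong>\<^sub>L lie6 [0, 0, 0, 0, \<omega>5, \<omega>6]"
proof (rule lie_isoI)
  let ?f = "\<lambda>p. vector [a (fst p), b (fst p), c (fst p), d (fst p), - (e \<bullet> snd p), - (f \<bullet> snd p)] :: real^6"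
  show "linear ?f"
    using assms by (intro linear_vectorI)
      (auto simp: linear_iff inner_add_right)
  show "x = 0" if "?f x = 0" for x
  proof -
    have "fst x = 0" using that inj[of "fst x"] by (simp add: vec_eq_iff forall_6)
    moreover have "snd x = 0" using that ef[of "snd x"] by (simp add: vec_eq_iff forall_6)
    ultimately show ?thesis by (simp add: prod_eq_iff)
  qed
  show "DIM((real^4) \<times> (real^2)) = DIM(real^6)" by simp
  have fst: "fst (metric_lie j p q) = 0" for p q by (simp add: metric_lie_def split: prod.split)
  have snd: "z \<bullet> snd (metric_lie j p q) = fst p \<bullet> (j z *v fst q)" for z p q
    using inner_metric_lie[OF assms(1), of z "fst p" "snd p" "fst q" "snd q"] by simp
  show "?f (metric_lie j p q) = lie6 [0, 0, 0, 0, \<omega>5, \<omega>6] (?f p) (?f q)" for p q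
    unfolding vec_eq_iff forall_6 lie6_eq fst snd
    using assms(3-6)[THEN linear_0] e[of "fst p" "fst q"] f[of "fst p" "fst q"] by simp
qed

lemma pfaffian_form_simps:
  "pfaffian_form (A + B) C = pfaffian_form A C + pfaffian_form B C"
  "pfaffian_form A (B + C) = pfaffian_form A B + pfaffian_form A C"
  "pfaffian_form (A - B) C = pfaffian_form A C - pfaffian_form B C"
  "pfaffian_form A (B - C) = pfaffian_form A B - pfaffian_form A C"
  "pfaffian_form (r *\<^sub>R A) B = r * pfaffian_form A B"
  "pfaffian_form A (r *\<^sub>R B) = r * pfaffian_form A B"
  by (simp_all add: pfaffian_form_def algebra_simps)

lemma pfaffian_form_commute: "pfaffian_form A B = pfaffian_form B A"
  by (simp add: pfaffian_form_def)

lemma so_form_skew: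
  assumes "A \<in> so"
  shows "x \<bullet> (A *v y) = - (y \<bullet> (A *v x))"
proof -
  have "x \<bullet> (A *v y) = (transpose A *v x) \<bullet> y"
    by (simp add: dot_lmul_matrix)
  also have "transpose A = - A" using assms by (simp add: so_def)
  finally show ?thesis
    using matrix_vector_mult_diff_rdistrib[of 0 A x] by (simp add: inner_commute)
qed

lemma so_form_self: "A \<in> so \<Longrightarrow> x \<bullet> (A *v x) = 0"
  using so_form_skew[of A x x] by simp

lemma matrix_form_eq_0_iff: "A = 0 \<longleftrightarrow> (\<forall>x y. x \<bullet> (A *v y) = 0)" for A :: "real^'n^'m"
proof
  assume "\<forall>x y. x \<bullet> (A *v y) = 0"
  then have "A *v y = 0" for y by (metis inner_eq_zero_iff)
  then show "A = 0" by (simp add: matrix_eq)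
qed simp

lemma linear_form: "linear (\<lambda>v. x \<bullet> (A *v v))" for A :: "real^'n^'m"
  using linear_compose[OF matrix_vector_mul_linear[of A] bounded_linear.linear[OF bounded_linear_inner_right[of x]]]
  by (simp add: o_def)

lemma so_normalized_pair:
  assumes "A \<noteq> (0 :: real^'n^'n)"
  obtains x y where "x \<bullet> (A *v y) = 1"
proof -
  obtain x y where "x \<bullet> (A *v y) \<noteq> 0" using assms matrix_form_eq_0_iff by blast
  then have "(x /\<^sub>R (x \<bullet> (A *v y))) \<bullet> (A *v y) = 1" by simp
  then show ?thesis using that by blast
qed

lemma det4_nondegenerate:
  assumes "\<And>x y u. det4 x y u v = 0"
  shows "v = 0"
  using assms[of "vector [0, 1, 0, 0]" "vector [0, 0, 1, 0]" "vector [0, 0, 0, 1]"]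
    assms[of "vector [1, 0, 0, 0]" "vector [0, 0, 1, 0]" "vector [0, 0, 0, 1]"]
    assms[of "vector [1, 0, 0, 0]" "vector [0, 1, 0, 0]" "vector [0, 0, 0, 1]"]
    assms[of "vector [1, 0, 0, 0]" "vector [0, 1, 0, 0]" "vector [0, 0, 1, 0]"]
  by (simp add: det4_def minor2_def vec_eq_iff forall_4)

text \<open>Every term in \<open>wedge_product_so4\<close> contracts v with A or B, so a common
  kernel vector would make a nonzero multiple of the determinant degenerate. This yields the trivial
  common kernel of the contractions used as coordinates.\<close>

lemma pfaffian_form_nondegenerate:
  assumes "A \<in> so" "B \<in> so" "pfaffian_form A B \<noteq> 0"
    and A: "\<And>u. u \<bullet> (A *v v) = 0" and B: "\<And>u. u \<bullet> (B *v v) = 0"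
  shows "v = 0"
proof (rule det4_nondegenerate)
  show "det4 x y u v = 0" for x y u
    using wedge_product_so4[OF assms(1,2), of x y u v] assms(3) by (simp only: A B) simp
qed

text \<open>Inserting x, y into A \<and> A = 0 exhibits A as the wedge product of its contractions
  with x and y.\<close>

lemma decomposable_form:
  assumes "A \<in> so" "pfaffian_form A A = 0" "x \<bullet> (A *v y) = 1"
  shows "u \<bullet> (A *v v) = x \<bullet> (A *v u) * (y \<bullet> (A *v v)) - x \<bullet> (A *v v) * (y \<bullet> (A *v u))"
  using wedge_product_so4[OF assms(1,1), of x y u v] assms(2,3) by simp

text \<open>With \<open>\<epsilon>\<^sup>2 = - \<kappa>\<close>, the two identities say that \<open>A + \<epsilon> B = (a + \<epsilon> b) \<and> (c + \<epsilon> d)\<close>.\<close>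

lemma pencil_normal_form:
  assumes "A \<in> so" "B \<in> so" "pfaffian_form A B = 0" "pfaffian_form A A = \<kappa> * pfaffian_form B B"
    and xy: "x \<bullet> (A *v y) = 1" "x \<bullet> (B *v y) = 0"
  defines "a \<equiv> \<lambda>u. x \<bullet> (A *v u)" and "b \<equiv> \<lambda>u. x \<bullet> (B *v u)"
    and "c \<equiv> \<lambda>u. y \<bullet> (A *v u)" and "d \<equiv> \<lambda>u. y \<bullet> (B *v u)"
  shows "u \<bullet> (A *v v) = a u * c v - a v * c u - \<kappa> * (b u * d v - b v * d u)"
    and "u \<bullet> (B *v v) = a u * d v - a v * d u + (b u * c v - b v * c u)"
proof -
  have "2 * (u \<bullet> (A *v v) - a u * c v + a v * c u) = \<kappa> * (2 * (- (b u * d v) + b v * d u))"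
    using wedge_product_so4[OF assms(1,1), of x y u v] wedge_product_so4[OF assms(2,2), of x y u v]
    unfolding assms(4) xy a_def b_def c_def d_def by simp
  then show "u \<bullet> (A *v v) = a u * c v - a v * c u - \<kappa> * (b u * d v - b v * d u)"
    by (simp add: algebra_simps)
  show "u \<bullet> (B *v v) = a u * d v - a v * d u + (b u * c v - b v * c u)"
    using wedge_product_so4[OF assms(1,2), of x y u v]
    unfolding assms(3) xy a_def b_def c_def d_def by simp
qed

lemma minor2_nondegenerate:
  fixes e f u :: "real^2"
  assumes "minor2 1 2 e f \<noteq> 0" "e \<bullet> u = 0" "f \<bullet> u = 0"
  shows "u = 0"
proof -
  have "minor2 1 2 e f * u $ 1 = 0" "minor2 1 2 e f * u $ 2 = 0"
    using assms(2,3) unfolding minor2_def inner_2 by algebra+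
  then show ?thesis using assms(1) by (simp add: vec_eq_iff forall_2)
qed

lemma minor2_combination:
  "minor2 i k (p *\<^sub>R e + q *\<^sub>R f) (r *\<^sub>R e + s *\<^sub>R f) = (p * s - q * r) * minor2 i k e f"
  unfolding minor2_def by simp algebra

text \<open>Only linearity and skew-symmetry are assumed, so that a single two-form extended by zero
  to R^2 is also a pencil; injectivity is added where it is used.\<close>

locale so4_pencil =
  fixes j :: "real^2 \<Rightarrow> real^4^4"
  assumes lin: "linear j" and so: "j z \<in> so"
begin

lemmas pencil_simps = linear_add[OF lin] linear_diff[OF lin] linear_cmul[OF lin] pfaffian_form_simps
  matrix_vector_mult_add_rdistrib matrix_vector_mult_diff_rdistrib scaleR_matrix_vector_assoc[symmetric]
  inner_add_right inner_diff_right

text \<open>After scaling f the Pfaffian is a multiple of a sum of two squares. Similarities of the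
  plane preserve this shape, and one of them arranges the values 1 and 0 at (x,y). Then \<kappa> =
  1, so \<epsilon> is the imaginary unit in the normal form.\<close>

lemma iso_h3_complex:
  assumes ef: "minor2 1 2 e f \<noteq> 0" and ortho: "pfaffian_form (j e) (j f) = 0"
    and pos: "pfaffian_form (j e) (j e) * pfaffian_form (j f) (j f) > 0"
  shows "metric_lie j \<cong>\<^sub>L lie6 [0, 0, 0, 0, wedge 1 3 + wedge 4 2, wedge 1 4 + wedge 2 3]"
proof -
  have quot: "pfaffian_form (j e) (j e) / pfaffian_form (j f) (j f) > 0"
    using pos by (simp add: zero_less_mult_iff zero_less_divide_iff)
  obtain r where r: "r > 0" "r * (r * pfaffian_form (j f) (j f)) = pfaffian_form (j e) (j e)"
  proof
    let ?r = "sqrt (pfaffian_form (j e) (j e) / pfaffian_form (j f) (j f))"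
    show "?r > 0" using quot by simp
    have "?r * ?r = pfaffian_form (j e) (j e) / pfaffian_form (j f) (j f)"
      using quot by (simp only: real_sqrt_mult_self abs_of_pos)
    then show "?r * (?r * pfaffian_form (j f) (j f)) = pfaffian_form (j e) (j e)"
      using pos by (auto simp flip: mult.assoc)
  qed
  define g where "g = r *\<^sub>R f"
  have nz: "pfaffian_form (j e) (j e) \<noteq> 0" using pos by auto
  have g: "pfaffian_form (j g) (j g) = pfaffian_form (j e) (j e)" "pfaffian_form (j e) (j g) = 0"
    "pfaffian_form (j g) (j e) = 0"
    using r ortho by (simp_all add: g_def pencil_simps pfaffian_form_commute[of "j f" "j e"])
  have "j e \<noteq> 0" using nz by (auto simp: pfaffian_form_def)
  then obtain x y where xy: "x \<bullet> (j e *v y) = 1" by (rule so_normalized_pair)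
  define \<beta> where "\<beta> = x \<bullet> (j g *v y)"
  define n where "n = 1 + \<beta> * \<beta>"
  have n: "n \<noteq> 0" using zero_le_square[of \<beta>] unfolding n_def by linarith
  \<comment> \<open>The pair (e, g) takes the values (1, \<beta>) at (x,y). Dividing e + i g by 1 +
    i \<beta> makes them (1, 0); n is the squared modulus of the divisor.\<close>
  define e' where "e' = (1 / n) *\<^sub>R e + (\<beta> / n) *\<^sub>R g"
  define f' where "f' = (- \<beta> / n) *\<^sub>R e + (1 / n) *\<^sub>R g"
  have "minor2 1 2 e g = r * minor2 1 2 e f" by (simp add: g_def minor2_def algebra_simps)
  then have "minor2 1 2 e g \<noteq> 0" using ef r by simp
  moreover have "1 / n * (1 / n) - \<beta> / n * (- \<beta> / n) = 1 / n"
  proof -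
    have "1 / n * (1 / n) - \<beta> / n * (- \<beta> / n) = n / (n * n)" by (simp add: n_def add_divide_distrib)
    then show ?thesis using n by simp
  qed
  ultimately have m: "minor2 1 2 e' f' \<noteq> 0"
    unfolding e'_def f'_def minor2_combination using n by simp
  have e'1: "x \<bullet> (j e' *v y) = 1"
  proof -
    have "1 / n + \<beta> / n * \<beta> = 1" using n by (simp add: n_def flip: add_divide_distrib)
    then show ?thesis by (simp add: e'_def pencil_simps xy flip: \<beta>_def)
  qed
  have f'0: "x \<bullet> (j f' *v y) = 0"
    by (simp add: f'_def pencil_simps xy flip: \<beta>_def)
  have pf: "pfaffian_form (j e') (j f') = 0" "pfaffian_form (j e') (j e') = 1 * pfaffian_form (j f') (j f')"
    by (simp_all add: e'_def f'_def pencil_simps g)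
  have "pfaffian_form (j f') (j f') = pfaffian_form (j e) (j e) * ((1 + \<beta> * \<beta>) / (n * n))"
    by (simp add: f'_def pencil_simps g field_simps) (simp add: add_divide_distrib)
  then have pf': "pfaffian_form (j f') (j f') \<noteq> 0" using nz n by (simp flip: n_def)
  note nf = pencil_normal_form[OF so so pf e'1 f'0]
  show ?thesis
  proof (rule metric_lie_iso_lie6[OF lin _ linear_form linear_form linear_form linear_form, where e = e' and f = f'])
    show "u = 0" if "e' \<bullet> u = 0" "f' \<bullet> u = 0" for u
      by (rule minor2_nondegenerate[OF m that])
    show "v = 0" if "x \<bullet> (j e' *v v) = 0" "x \<bullet> (j f' *v v) = 0" "y \<bullet> (j e' *v v) = 0" "y \<bullet> (j f' *v v) = 0" for v
      by (rule pfaffian_form_nondegenerate[OF so so pf']; subst nf(2); use that in simp)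
  qed (subst nf(1), simp add: lie6_simps, subst nf(2), simp add: lie6_simps)
qed

text \<open>Since \<open>j e\<close> is isotropic and orthogonal to \<open>j f\<close>, subtracting
  a multiple of e from f keeps the pencil diagonal. Then \<kappa> = 0 and \<epsilon> is a dual
  number: \<open>j e\<close> is a \<and> c and \<open>j g\<close> is a \<and> d + b \<and>
  c.\<close>

lemma iso_semidefinite:
  assumes ef: "minor2 1 2 e f \<noteq> 0" and ortho: "pfaffian_form (j e) (j f) = 0"
    and pf: "pfaffian_form (j e) (j e) = 0" "pfaffian_form (j f) (j f) \<noteq> 0" and "j e \<noteq> 0"
  shows "metric_lie j \<cong>\<^sub>L lie6 [0, 0, 0, 0, wedge 1 2, wedge 1 4 + wedge 2 3]"
proof -
  obtain x y where xy: "x \<bullet> (j e *v y) = 1" using \<open>j e \<noteq> 0\<close> by (rule so_normalized_pair)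
  define g where "g = f - (x \<bullet> (j f *v y)) *\<^sub>R e"
  have m: "minor2 1 2 e g \<noteq> 0"
    using ef minor2_combination[of 1 2 1 e 0 f "- (x \<bullet> (j f *v y))" 1] by (simp add: g_def)
  have g: "x \<bullet> (j g *v y) = 0" "pfaffian_form (j e) (j g) = 0"
    "pfaffian_form (j g) (j g) \<noteq> 0"
    "pfaffian_form (j e) (j e) = 0 * pfaffian_form (j g) (j g)"
    using pf ortho xy by (simp_all add: g_def pencil_simps pfaffian_form_commute[of "j f" "j e"])
  note nf = pencil_normal_form[OF so so g(2,4) xy g(1)]
  show ?thesis
  \<comment> \<open>In the letters of \<open>pencil_normal_form\<close> the coordinates are a, c,
    -b, d; the sign turns b \<and> c into the model term 23.\<close>
  proof (rule metric_lie_iso_lie6[OF lin, where e = e and f = g and a = "\<lambda>v. x \<bullet> (j e *v v)" and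
        b = "\<lambda>v. y \<bullet> (j e *v v)" and c = "\<lambda>v. - (x \<bullet> (j g *v v))" and d = "\<lambda>v. y \<bullet> (j g *v v)"])
    show "v = 0" if "x \<bullet> (j e *v v) = 0" "y \<bullet> (j e *v v) = 0" "- (x \<bullet> (j g *v v)) = 0" "y \<bullet> (j g *v v) = 0" for v
      by (rule pfaffian_form_nondegenerate[OF so so g(3)]; subst nf(2); use that in simp)
    show "u = 0" if "e \<bullet> u = 0" "g \<bullet> u = 0" for u
      by (rule minor2_nondegenerate[OF m that])
  qed ((rule linear_form linear_compose_neg[OF linear_form])+, subst nf(1), simp add: lie6_simps,
      subst nf(2), simp add: lie6_simps)
qed

text \<open>An indefinite Pfaffian has two isotropic directions, hence two decomposable forms. Their
  mixed Pfaffian is nonzero, so the four factors are coordinates, and each form may use its own pair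
  of vectors.\<close>

lemma iso_h3_h3:
  assumes ef: "minor2 1 2 e f \<noteq> 0" and ortho: "pfaffian_form (j e) (j f) = 0"
    and neg: "pfaffian_form (j e) (j e) * pfaffian_form (j f) (j f) < 0"
  shows "metric_lie j \<cong>\<^sub>L lie6 [0, 0, 0, 0, wedge 1 2, wedge 3 4]"
proof -
  have quot: "- pfaffian_form (j e) (j e) / pfaffian_form (j f) (j f) > 0"
    using neg by (simp add: mult_less_0_iff divide_less_0_iff)
  obtain t where t: "t > 0" "t * (t * pfaffian_form (j f) (j f)) = - pfaffian_form (j e) (j e)"
  proof
    let ?t = "sqrt (- pfaffian_form (j e) (j e) / pfaffian_form (j f) (j f))"
    show "?t > 0" using quot by simp
    have "?t * ?t = - pfaffian_form (j e) (j e) / pfaffian_form (j f) (j f)"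
      using quot by (simp only: real_sqrt_mult_self abs_of_pos)
    then show "?t * (?t * pfaffian_form (j f) (j f)) = - pfaffian_form (j e) (j e)"
      using neg by (auto simp flip: mult.assoc)
  qed
  \<comment> \<open>The factor t makes the Pfaffians of e and t f opposite, so e + t f and e - t f
    are isotropic.\<close>
  define g where "g = 1 *\<^sub>R e + t *\<^sub>R f"
  define h where "h = 1 *\<^sub>R e + (- t) *\<^sub>R f"
  have m: "minor2 1 2 g h \<noteq> 0"
    unfolding g_def h_def minor2_combination using t ef by simp
  have pf: "pfaffian_form (j g) (j g) = 0" "pfaffian_form (j h) (j h) = 0" "pfaffian_form (j g) (j h) \<noteq> 0"
    using t neg by (auto simp: g_def h_def pencil_simps ortho pfaffian_form_commute[of "j f" "j e"])
  have "j g \<noteq> 0" "j h \<noteq> 0" using pf(3) by (auto simp: pfaffian_form_def)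
  then obtain x y x' y' where xy: "x \<bullet> (j g *v y) = 1" "x' \<bullet> (j h *v y') = 1"
    by (metis so_normalized_pair)
  note nf = decomposable_form[OF so pf(1) xy(1)] decomposable_form[OF so pf(2) xy(2)]
  show ?thesis
  proof (rule metric_lie_iso_lie6[OF lin, where e = g and f = h and a = "\<lambda>v. x \<bullet> (j g *v v)" and
        b = "\<lambda>v. y \<bullet> (j g *v v)" and c = "\<lambda>v. x' \<bullet> (j h *v v)" and d = "\<lambda>v. y' \<bullet> (j h *v v)"])
    show "v = 0" if "x \<bullet> (j g *v v) = 0" "y \<bullet> (j g *v v) = 0" "x' \<bullet> (j h *v v) = 0" "y' \<bullet> (j h *v v) = 0" for v
    proof (rule pfaffian_form_nondegenerate[OF so so pf(3)])
      show "u \<bullet> (j g *v v) = 0" for u by (subst nf(1)) (use that in simp)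
      show "u \<bullet> (j h *v v) = 0" for u by (subst nf(2)) (use that in simp)
    qed
    show "u = 0" if "g \<bullet> u = 0" "h \<bullet> u = 0" for u
      by (rule minor2_nondegenerate[OF m that])
  qed ((rule linear_form)+, subst nf(1), simp add: lie6_simps, subst nf(2), simp add: lie6_simps)
qed

end

lemma basis_orthogonal_zero:
  fixes v :: "'a::euclidean_space"
  assumes "span B = UNIV" "\<And>b. b \<in> B \<Longrightarrow> b \<bullet> v = 0"
  shows "v = 0"
proof -
  have "orthogonal v v"
    by (rule orthogonal_to_span[of v B]) (use assms in \<open>auto simp: orthogonal_def inner_commute\<close>)
  then show ?thesis by (simp add: orthogonal_def)
qed

text \<open>Needed where the forms involve only three functionals: the missing coordinate comes from
  extending them to a basis of R^4.\<close>

lemma obtain_fourth_functional: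
  fixes P Q R :: "real^4"
  assumes "P \<noteq> 0" "Q \<notin> span {P}" "R \<notin> span {Q, P}"
  obtains S where "\<And>v. P \<bullet> v = 0 \<Longrightarrow> Q \<bullet> v = 0 \<Longrightarrow> R \<bullet> v = 0 \<Longrightarrow> S \<bullet> v = 0 \<Longrightarrow> v = 0"
proof -
  have ind: "independent {R, Q, P}" and "P \<noteq> Q" "P \<noteq> R" "Q \<noteq> R"
    using assms by (auto simp: independent_insert span_base)
  then obtain B where B: "{R, Q, P} \<subseteq> B" "independent B" "UNIV \<subseteq> span B"
    by (meson maximal_independent_subset_extend subset_UNIV)
  have "card B = 4" using B basis_card_eq_dim[of B UNIV] by simp
  then have "card (B - {R, Q, P}) = 1"
    using B(1) \<open>P \<noteq> Q\<close> \<open>P \<noteq> R\<close> \<open>Q \<noteq> R\<close> by (subst card_Diff_subset) auto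
  then obtain S where "B - {R, Q, P} = {S}" by (metis card_1_singletonE)
  then have "B \<subseteq> {R, Q, P, S}" by auto
  then show ?thesis using that[of S] basis_orthogonal_zero[of B] B(3) by blast
qed

context so4_pencil
begin

text \<open>Both forms are decomposable with zero wedge product, so they share a factor P; this
  gives P \<and> Q and P \<and> R. Injectivity of j makes P, Q, R independent.\<close>

lemma iso_n5:
  assumes ef: "minor2 1 2 e f \<noteq> 0" and ortho: "pfaffian_form (j e) (j f) = 0"
    and pf: "pfaffian_form (j e) (j e) = 0" "pfaffian_form (j f) (j f) = 0"
    and inj: "\<And>z. j z = 0 \<Longrightarrow> z = 0"
  shows "metric_lie j \<cong>\<^sub>L lie6 [0, 0, 0, 0, wedge 1 2, wedge 1 3]"
proof -
  have "e \<noteq> 0" using ef by (auto simp: minor2_def)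
  then have "j e \<noteq> 0" using inj by blast
  then obtain x y where xy: "x \<bullet> (j e *v y) = 1" by (rule so_normalized_pair)
  define g where "g = f - (x \<bullet> (j f *v y)) *\<^sub>R e"
  have m: "minor2 1 2 e g \<noteq> 0"
    using ef minor2_combination[of 1 2 1 e 0 f "- (x \<bullet> (j f *v y))" 1] by (simp add: g_def)
  have g: "x \<bullet> (j g *v y) = 0" "pfaffian_form (j e) (j g) = 0"
    "pfaffian_form (j g) (j g) = 0"
    "pfaffian_form (j e) (j e) = 0 * pfaffian_form (j g) (j g)"
    using pf ortho xy by (simp_all add: g_def pencil_simps pfaffian_form_commute[of "j f" "j e"])
  note nf = pencil_normal_form[OF so so g(2,4) xy g(1)]
  let ?a = "- (j e *v x)" and ?b = "- (j g *v x)" and ?c = "- (j e *v y)" and ?d = "- (j g *v y)"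
  have form: "u \<bullet> (j z *v v) = (- (j z *v u)) \<bullet> v" for u z v
    using so_form_skew[OF so, of u z v] by (simp add: inner_commute)
  \<comment> \<open>Inserting x, y into the vanishing square of \<open>j g\<close> leaves b \<and> d
    = 0, so b = 0 or d is a multiple of b.\<close>
  have bd: "?b \<bullet> u * (?d \<bullet> v) = ?b \<bullet> v * (?d \<bullet> u)" for u v
    using wedge_product_so4[OF so so, of x g y u g v] g(1,3) by (simp add: form)
  obtain P Q R where PQR: "\<And>u v. u \<bullet> (j e *v v) = P \<bullet> u * (Q \<bullet> v) - P \<bullet> v * (Q \<bullet> u)"
      "\<And>u v. u \<bullet> (j g *v v) = P \<bullet> u * (R \<bullet> v) - P \<bullet> v * (R \<bullet> u)"
  proof (cases "?b = 0")
    case True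
    have zero: "x \<bullet> (j g *v v) = 0" for v using True by (simp add: form)
    have "u \<bullet> (j e *v v) = ?a \<bullet> u * (?c \<bullet> v) - ?a \<bullet> v * (?c \<bullet> u)"
      "u \<bullet> (j g *v v) = ?a \<bullet> u * (?d \<bullet> v) - ?a \<bullet> v * (?d \<bullet> u)" for u v
      unfolding nf(1)[of u v] nf(2)[of u v] zero form[symmetric] by simp_all
    then show ?thesis using that by blast
  next
    case False
    \<comment> \<open>With d = l b the second form is a \<and> d + b \<and> c = b \<and> (c - l a),
      and a \<and> c = a \<and> (c - l a): the common factor is c - l a.\<close>
    define l where "l = (?d \<bullet> ?b) / (?b \<bullet> ?b)"
    have D: "?d \<bullet> v = l * (?b \<bullet> v)" for v
      using bd[of ?b v] False by (simp add: l_def field_simps)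
    have "u \<bullet> (j e *v v) = (?c - l *\<^sub>R ?a) \<bullet> u * ((- ?a) \<bullet> v) - (?c - l *\<^sub>R ?a) \<bullet> v * ((- ?a) \<bullet> u)"
      "u \<bullet> (j g *v v) = (?c - l *\<^sub>R ?a) \<bullet> u * ((- ?b) \<bullet> v) - (?c - l *\<^sub>R ?a) \<bullet> v * ((- ?b) \<bullet> u)" for u v
      unfolding nf(1)[of u v] nf(2)[of u v]
      unfolding form D
      unfolding inner_diff_left inner_scaleR_left inner_minus_left by algebra+
    then show ?thesis using that by blast
  qed
  have nz: "\<not> (\<forall>u v. u \<bullet> (j (g - k *\<^sub>R e) *v v) = 0)" for k
  proof
    assume "\<forall>u v. u \<bullet> (j (g - k *\<^sub>R e) *v v) = 0"
    then have "g - k *\<^sub>R e = 0" using inj matrix_form_eq_0_iff by blast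
    then have "g = k *\<^sub>R e" by simp
    then show False using m by (simp add: minor2_def)
  qed
  have "P \<noteq> 0" using xy PQR by auto
  moreover have "Q \<notin> span {P}"
    using xy PQR(1)[of x y] by (auto simp: span_singleton)
  \<comment> \<open>A relation R = k Q + l P would give \<open>j g\<close> = k \<open>j e\<close>,
    against injectivity.\<close>
  moreover have "R \<notin> span {Q, P}"
  proof
    assume "R \<in> span {Q, P}"
    then obtain k l where "R = k *\<^sub>R Q + l *\<^sub>R P"
      by (auto simp: span_insert span_singleton) (metis diff_eq_eq add.commute)
    then have "u \<bullet> (j (g - k *\<^sub>R e) *v v) = 0" for u v
      by (simp add: pencil_simps PQR inner_add_left algebra_simps)
    then show False using nz by blast
  qed
  ultimately obtain S where S: "\<And>v. P \<bullet> v = 0 \<Longrightarrow> Q \<bullet> v = 0 \<Longrightarrow> R \<bullet> v = 0 \<Longrightarrow> S \<bullet> v = 0 \<Longrightarrow> v = 0"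
    using obtain_fourth_functional[of P Q R] by blast
  show ?thesis
  proof (rule metric_lie_iso_lie6[OF lin, where e = e and f = g and a = "(\<bullet>) P" and b = "(\<bullet>) Q" and
        c = "(\<bullet>) R" and d = "(\<bullet>) S"])
    show "u = 0" if "e \<bullet> u = 0" "g \<bullet> u = 0" for u
      by (rule minor2_nondegenerate[OF m that])
    show "v = 0" if "P \<bullet> v = 0" "Q \<bullet> v = 0" "R \<bullet> v = 0" "S \<bullet> v = 0" for v
      by (rule S[OF that])
  qed (simp_all add: PQR linear_iff inner_add_right lie6_simps)
qed

end

section \<open>Metric realization\<close>

text \<open>\<open>dim\<close> is 0 for an infinite-dimensional space, so positivity of
  \<open>dim\<close> is what makes the bases finite.\<close>

lemma obtain_adapted_basis:
  fixes D :: "'a::real_vector set"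
  assumes "dim (UNIV :: 'a set) > 0" "subspace D"
  obtains B C where "finite B" "finite C" "B \<inter> C = {}" "independent (B \<union> C)" "span B = D"
    "span (B \<union> C) = UNIV" "card B = dim D" "card B + card C = dim (UNIV :: 'a set)"
proof -
  obtain B where B: "B \<subseteq> D" "independent B" "D \<subseteq> span B" "card B = dim D"
    using basis_exists by blast
  obtain A where A: "B \<subseteq> A" "independent A" "UNIV \<subseteq> span A"
    by (rule maximal_independent_subset_extend[OF subset_UNIV B(2)])
  have "card A = dim (UNIV :: 'a set)" using A basis_card_eq_dim[of A UNIV] by simp
  then have "finite A" using assms(1) by (metis card.infinite less_irrefl)
  have "card B + card (A - B) = card A"
    using A(1) \<open>finite A\<close> by (metis add_diff_inverse_nat card_Diff_subset card_mono finite_subset not_less)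
  moreover have "span B = D"
    using B(1,3) assms(2) by (metis span_minimal subset_antisym)
  ultimately show ?thesis
    using that[of B "A - B"] A B \<open>finite A\<close> \<open>card A = _\<close>
    by (auto simp: Un_absorb1 intro: finite_subset)
qed

lemma bilinear_alternating_skew:
  assumes "bilinear br" "\<And>x. br x x = 0"
  shows "br x y = - br y x"
proof -
  have "br (x + y) (x + y) = br x x + br y x + (br x y + br y y)"
    by (simp only: bilinear_ladd[OF assms(1)] bilinear_radd[OF assms(1)])
  then have "br x y + br y x = 0" by (simp add: assms(2) add.commute)
  then show ?thesis by (simp add: eq_neg_iff_add_eq_0)
qed

lemma two_step_nilpotentD:
  assumes "two_step_nilpotent br"
  shows "bilinear br" "br x x = 0" "br x y = - br y x" "br x y \<in> commutator_ideal br"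
    "z \<in> commutator_ideal br \<Longrightarrow> br x z = 0" "z \<in> commutator_ideal br \<Longrightarrow> br z x = 0"
proof -
  show bil: "bilinear br" and alt: "br x x = 0" for x
    using assms unfolding two_step_nilpotent_def lie_algebra_def by auto
  show skew: "br x y = - br y x" for x y by (rule bilinear_alternating_skew[OF bil alt])
  show "br x y \<in> commutator_ideal br"
    unfolding commutator_ideal_def by (rule span_base) auto
  show c: "br x z = 0" if "z \<in> commutator_ideal br" for x z
    using assms that unfolding two_step_nilpotent_def by blast
  show "br z x = 0" if "z \<in> commutator_ideal br"
    using c[OF that, of x] skew[of z x] by simp
qed

lemma subspace_commutator_ideal: "subspace (commutator_ideal br)"
  by (simp add: commutator_ideal_def)

lemma commutator_ideal_eq_0_abelian:
  assumes "commutator_ideal br = {0}"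
  shows "abelian br"
proof -
  have "br x y \<in> commutator_ideal br" for x y
    unfolding commutator_ideal_def by (rule span_base) auto
  then show ?thesis using assms by (simp add: abelian_def)
qed

text \<open>The commutator ideal is central, so the bracket depends only on classes modulo it. If it
  had dimension above 3, at most two generators u, v would remain, and all brackets would be
  multiples of \<open>br u v\<close>.\<close>

lemma dim_commutator_ideal:
  fixes br :: "'a::real_vector \<Rightarrow> 'a \<Rightarrow> 'a"
  assumes "nonabelian_2step_dim6 br"
  shows "dim (commutator_ideal br) \<in> {1, 2, 3}"
proof -
  let ?D = "commutator_ideal br"
  have nil: "two_step_nilpotent br" and "\<not> abelian br" and dim6: "dim (UNIV :: 'a set) = 6"
    using assms unfolding nonabelian_2step_dim6_def by auto
  note br = two_step_nilpotentD[OF nil]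
  note bil = bilinear_ladd[OF br(1)] bilinear_radd[OF br(1)] bilinear_lmul[OF br(1)] bilinear_rmul[OF br(1)]
  have "dim (UNIV :: 'a set) > 0" using dim6 by simp
  then obtain B C where BC: "finite B" "finite C" "B \<inter> C = {}" "independent (B \<union> C)" "span B = ?D"
    "span (B \<union> C) = UNIV" "card B = dim ?D" "card B + card C = dim (UNIV :: 'a set)"
    by (rule obtain_adapted_basis[OF _ subspace_commutator_ideal])
  have "dim ?D \<noteq> 0"
  proof
    assume "dim ?D = 0"
    then have "B = {}" using BC by simp
    then show False using BC(5) \<open>\<not> abelian br\<close> commutator_ideal_eq_0_abelian[of br] by simp
  qed
  moreover have "\<not> dim ?D > 3"
  proof
    assume gt: "dim ?D > 3"
    then have "card C \<le> 2" using BC(7,8) dim6 by simp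
    then obtain u v where uv: "C \<subseteq> {u, v}"
    proof -
      consider "C = {}" | u where "C = {u}" | u v where "C = {u, v}"
        using \<open>card C \<le> 2\<close> BC(2)
        by (metis One_nat_def card_0_eq card_1_singletonE card_2_iff le_Suc_eq le_zero_eq numeral_2_eq_2)
      then show ?thesis using that by cases blast+
    qed
    have ex: "\<exists>a b. x - a *\<^sub>R u - b *\<^sub>R v \<in> ?D" for x
    proof -
      have "x \<in> span (B \<union> {u, v})" using BC(6) uv span_mono[of "B \<union> C" "B \<union> {u, v}"] by blast
      then have "x \<in> span (insert u (insert v B))" by simp
      then show ?thesis by (simp add: span_breakdown_eq BC(5))
    qed
    have "br x y \<in> span {br u v}" for x y
    proof -
      obtain a b a' b' where d: "x - a *\<^sub>R u - b *\<^sub>R v \<in> ?D" "y - a' *\<^sub>R u - b' *\<^sub>R v \<in> ?D"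
        using ex by metis
      define d d' where "d = x - a *\<^sub>R u - b *\<^sub>R v" and "d' = y - a' *\<^sub>R u - b' *\<^sub>R v"
      have "x = a *\<^sub>R u + b *\<^sub>R v + d" "y = a' *\<^sub>R u + b' *\<^sub>R v + d'" by (simp_all add: d_def d'_def)
      moreover have "br z d' = 0" "br d z = 0" for z using d br(5,6) by (simp_all add: d_def d'_def)
      ultimately have "br x y = (a * b' - b * a') *\<^sub>R br u v"
        using br(3)[of v u] by (simp add: bil br(2)) (simp add: algebra_simps)
      then show ?thesis by (simp add: span_base span_scale)
    qed
    then have "?D \<subseteq> span {br u v}"
      unfolding commutator_ideal_def by (intro span_minimal) auto
    then have "dim ?D \<le> 1"
      using dim_le_card[of ?D "{br u v}"] by simp
    with gt show False by simp
  qed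
  ultimately show ?thesis by auto
qed

text \<open>An arbitrary basis adapted to the commutator ideal is declared orthonormal. No
  compatibility of the metric is needed beyond this, and j is injective because the brackets span
  the ideal.\<close>

lemma obtain_metric_lie:
  fixes br :: "'a::real_vector \<Rightarrow> 'a \<Rightarrow> 'a"
  assumes nil: "two_step_nilpotent br"
    and dimV: "dim (UNIV :: 'a set) = CARD('n) + DIM('b)" and dimD: "dim (commutator_ideal br) = DIM('b)"
  obtains j :: "'b::euclidean_space \<Rightarrow> real^'n^'n"
  where "linear j" "range j \<subseteq> so" "\<And>w. j w = 0 \<Longrightarrow> w = 0" "br \<cong>\<^sub>L metric_lie j"
proof -
  let ?D = "commutator_ideal br"
  note br = two_step_nilpotentD[OF nil]
  have "dim (UNIV :: 'a set) > 0" using dimV by simp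
  then obtain B C where BC: "finite B" "finite C" "B \<inter> C = {}" "independent (B \<union> C)" "span B = ?D"
    "span (B \<union> C) = UNIV" "card B = dim ?D" "card B + card C = dim (UNIV :: 'a set)"
    by (rule obtain_adapted_basis[OF _ subspace_commutator_ideal])
  obtain b where b: "bij_betw b (Basis :: 'b set) B"
    using finite_same_card_bij[of "Basis :: 'b set" B] BC dimD by auto
  obtain c where c: "bij_betw c (UNIV :: 'n set) C"
    using finite_same_card_bij[of "UNIV :: 'n set" C] BC dimV dimD by auto
  define G where "G p = (\<Sum>i\<in>UNIV. (fst p $ i) *\<^sub>R c i) + (\<Sum>k\<in>Basis. (snd p \<bullet> k) *\<^sub>R b k)"
    for p :: "(real^'n) \<times> 'b"
  have linG: "linear G"
    by (rule linearI) (simp_all add: G_def scaleR_left_distrib sum.distrib inner_add_left scaleR_sum_right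
        scaleR_right_distrib)
  \<comment> \<open>The coordinate map on the adapted basis: B goes to the basis of the central
    factor, C to the axes of the complement. Its linear extension F is inverse to G.\<close>
  define \<phi> where "\<phi> x = (if x \<in> B then (0, inv_into Basis b x) else (axis (inv_into UNIV c x) 1 :: real^'n, 0 :: 'b))" for x
  obtain F where F: "linear F" "\<forall>x \<in> B \<union> C. F x = \<phi> x"
    using linear_independent_extend[OF BC(4)] by blast
  have Fb: "F (b k) = (0, k)" if "k \<in> Basis" for k
    using that F(2) b by (simp add: \<phi>_def bij_betwE bij_betw_inv_into_left)
  have cB: "c i \<in> C" "c i \<notin> B" for i
    using c BC(3) bij_betwE by blast+
  have Fc: "F (c i) = (axis i 1, 0)" for i
    using F(2) cB[of i] bij_betw_inv_into_left[OF c, of i] by (simp add: \<phi>_def)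
  have FG: "F (G p) = p" for p
  proof (rule prod_eqI)
    have "F (G p) = (\<Sum>i\<in>UNIV. (fst p $ i) *\<^sub>R (axis i 1, 0)) + (\<Sum>k\<in>Basis. (snd p \<bullet> k) *\<^sub>R (0, k))"
      unfolding G_def by (simp add: linear_add[OF F(1)] linear_sum[OF F(1)] linear_cmul[OF F(1)] Fb Fc)
    also have "\<dots> = ((\<Sum>i\<in>UNIV. (fst p $ i) *\<^sub>R axis i 1), (\<Sum>k\<in>Basis. (snd p \<bullet> k) *\<^sub>R k))"
      by (simp add: prod_eq_iff fst_sum snd_sum)
    finally show "fst (F (G p)) = fst p" "snd (F (G p)) = snd p"
      using basis_expansion[of "fst p"] by (simp_all add: euclidean_representation scalar_mult_eq_scaleR)
  qed
  have Gc: "G (axis i 1, 0) = c i" for i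
  proof -
    have "(\<Sum>k\<in>UNIV. (axis i 1 $ k) *\<^sub>R c k) = (\<Sum>k\<in>UNIV. if k = i then c k else 0)"
      by (intro sum.cong) (auto simp: axis_def)
    then show ?thesis by (simp add: G_def)
  qed
  have Gb: "G (0, k) = b k" if "k \<in> Basis" for k
  proof -
    have "(\<Sum>l\<in>Basis. (k \<bullet> l) *\<^sub>R b l) = (\<Sum>l\<in>Basis. if l = k then b l else 0)"
      using that by (intro sum.cong) (auto simp: inner_Basis)
    then show ?thesis using that by (simp add: G_def)
  qed
  have "B \<union> C \<subseteq> range G"
    using b c Gb Gc unfolding bij_betw_def by (metis (no_types, lifting) Un_subset_iff image_subsetI rangeI)
  then have "span (B \<union> C) \<subseteq> range G"
    using linG by (intro span_minimal) (simp_all add: linear_subspace_image)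
  then have GF: "G (F x) = x" for x using BC(6) FG by (metis UNIV_I imageE subsetD)
  have bijF: "bij F" using FG GF by (intro bijI') metis+
  have "span B \<subseteq> {x. fst (F x) = 0}"
  proof (rule span_minimal)
    show "B \<subseteq> {x. fst (F x) = 0}" using b Fb unfolding bij_betw_def by force
    show "subspace {x. fst (F x) = 0}"
      by (auto simp: subspace_def linear_0[OF F(1)] linear_add[OF F(1)] linear_cmul[OF F(1)])
  qed
  then have fstF: "fst (F x) = 0" if "x \<in> ?D" for x using BC(5) that by blast
  \<comment> \<open>The matrix entries are the structure constants contracted with w, that is, the
    matrix of the adjoint of the bracket.\<close>
  define j where "j w = (\<chi> i k. w \<bullet> snd (F (br (c i) (c k))))" for w
  have linj: "linear j"
    by (rule linearI) (simp_all add: j_def vec_eq_iff inner_add_left)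
  have form: "fst p \<bullet> (j w *v fst q) = w \<bullet> snd (F (br (G p) (G q)))" for w p q
  proof -
    let ?c = "\<lambda>p :: (real^'n) \<times> 'b. \<Sum>i\<in>UNIV. (fst p $ i) *\<^sub>R c i"
    let ?b = "\<lambda>p :: (real^'n) \<times> 'b. \<Sum>k\<in>Basis. (snd p \<bullet> k) *\<^sub>R b k"
    have "?b p \<in> span B" for p
      using b by (intro span_sum span_scale span_base) (auto simp: bij_betw_def)
    then have "br x (?b p) = 0" "br (?b p) x = 0" for x p using br(5,6) BC(5) by auto
    then have "br (G p) (G q) = br (?c p) (?c q)"
      unfolding G_def by (simp add: bilinear_ladd[OF br(1)] bilinear_radd[OF br(1)])
    also have "\<dots> = (\<Sum>i\<in>UNIV. \<Sum>k\<in>UNIV. (fst q $ k * fst p $ i) *\<^sub>R br (c i) (c k))"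
      by (simp add: bilinear_sum[OF br(1)] sum.cartesian_product bilinear_lmul[OF br(1)] bilinear_rmul[OF br(1)])
    finally have "w \<bullet> snd (F (br (G p) (G q))) =
        (\<Sum>i\<in>UNIV. \<Sum>k\<in>UNIV. fst q $ k * fst p $ i * (w \<bullet> snd (F (br (c i) (c k)))))"
      by (simp add: linear_sum[OF F(1)] linear_cmul[OF F(1)] snd_sum inner_sum_right)
    then show ?thesis
      by (simp add: inner_vec_def matrix_vector_mult_def j_def sum_distrib_left algebra_simps)
  qed
  have "range j \<subseteq> so"
  proof clarify
    fix w
    have "F (br (c k) (c i)) = - F (br (c i) (c k))" for i k
      by (subst br(3)) (rule linear_neg[OF F(1)])
    then have *: "w \<bullet> snd (F (br (c k) (c i))) = - (w \<bullet> snd (F (br (c i) (c k))))" for i k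
      by (metis inner_minus_right snd_uminus)
    show "j w \<in> so" by (rule soI) (unfold j_def vec_lambda_beta, rule *)
  qed
  moreover have "w = 0" if "j w = 0" for w
  proof -
    have "w \<bullet> snd (F (br x y)) = 0" for x y
      using form[of "F x" w "F y"] that by (simp add: GF)
    then have "{br x y |x y. True} \<subseteq> {x. w \<bullet> snd (F x) = 0}" by auto
    then have "?D \<subseteq> {x. w \<bullet> snd (F x) = 0}"
      unfolding commutator_ideal_def
      by (intro span_minimal) (auto simp: subspace_def linear_0[OF F(1)] linear_add[OF F(1)]
          linear_cmul[OF F(1)] inner_add_right)
    moreover have "b k \<in> ?D" if "k \<in> Basis" for k
      using b BC(5) that by (metis bij_betwE span_base)
    ultimately have "w \<bullet> k = 0" if "k \<in> Basis" for k
      using that Fb by fastforce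
    then show "w = 0" using euclidean_all_zero_iff[of w] by blast
  qed
  moreover have "br \<cong>\<^sub>L metric_lie j"
  proof -
    have "F (br x y) = metric_lie j (F x) (F y)" for x y
    proof (rule prod_eqI)
      show "fst (F (br x y)) = fst (metric_lie j (F x) (F y))"
        using fstF[OF br(4)] by (simp add: metric_lie_def split: prod.split)
      have "w \<bullet> snd (F (br x y)) = w \<bullet> snd (metric_lie j (F x) (F y))" for w
        using form[of "F x" w "F y"] inner_metric_lie[OF linj, of w "fst (F x)" "snd (F x)" "fst (F y)" "snd (F y)"]
        by (simp add: GF)
      then show "snd (F (br x y)) = snd (metric_lie j (F x) (F y))" using vector_eq_ldot by blast
    qed
    then show ?thesis unfolding lie_iso_def using F(1) bijF by blast
  qed
  ultimately show ?thesis using that linj by blast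
qed

text \<open>so(3) has dimension three, so an injective j is bijective and p, q, r can be chosen with
  images 12, 13, 23. The complement R^3 keeps its coordinates; only the center is
  re-coordinatized.\<close>

lemma so3_iso_free:
  fixes j :: "real^3 \<Rightarrow> real^3^3"
  assumes lin: "linear j" and so: "range j \<subseteq> so" and inj: "\<And>z. j z = 0 \<Longrightarrow> z = 0"
  shows "metric_lie j \<cong>\<^sub>L lie6 [0, 0, 0, wedge 1 2, wedge 1 3, wedge 2 3]"
proof -
  define v where "v z = (vector [j z $ 1 $ 2, j z $ 1 $ 3, j z $ 2 $ 3] :: real^3)" for z
  have skew: "j z $ k $ i = - (j z $ i $ k)" for z i k using so by (intro so_entries) auto
  have diag: "j z $ i $ i = 0" for z i using skew[of z i i] by simp
  have linv: "linear v"
    by (simp add: linear_iff v_def vec_eq_iff forall_3 linear_add[OF lin] linear_cmul[OF lin])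
  have "z = 0" if "v z = 0" for z
  proof (rule inj)
    show "j z = 0"
      using that skew[of z 2 1] skew[of z 3 1] skew[of z 3 2]
      by (simp add: v_def vec_eq_iff forall_3 diag)
  qed
  then have "bij v" using linv by (intro linear_kernel_zero_bij) auto
  then obtain p q r where pqr: "v p = vector [1, 0, 0]" "v q = vector [0, 1, 0]" "v r = vector [0, 0, 1]"
    by (metis bij_pointE)
  have form: "x \<bullet> (j z *v y) = v z $ 1 * minor2 1 2 x y + v z $ 2 * minor2 1 3 x y + v z $ 3 * minor2 2 3 x y" for x y z
    unfolding inner_vec_def matrix_vector_mult_def minor2_def v_def
    by (simp add: sum_3 diag skew[of z 2 1] skew[of z 3 1] skew[of z 3 2]) algebra
  have span: "w = (v w $ 1) *\<^sub>R p + (v w $ 2) *\<^sub>R q + (v w $ 3) *\<^sub>R r" for w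
  proof -
    have "v ((v w $ 1) *\<^sub>R p + (v w $ 2) *\<^sub>R q + (v w $ 3) *\<^sub>R r) = v w"
      by (simp add: linear_add[OF linv] linear_cmul[OF linv] pqr) (simp add: vec_eq_iff forall_3)
    then show ?thesis using \<open>bij v\<close> by (metis bij_is_inj injD)
  qed
  let ?f = "\<lambda>x :: (real^3) \<times> (real^3). vector [fst x $ 1, fst x $ 2, fst x $ 3, - (p \<bullet> snd x), - (q \<bullet> snd x), - (r \<bullet> snd x)] :: real^6"
  show ?thesis
  proof (rule lie_isoI)
    show "linear ?f" by (intro linear_vectorI) (auto simp: linear_iff inner_add_right)
    show "x = 0" if "?f x = 0" for x
    proof -
      have "p \<bullet> snd x = 0" "q \<bullet> snd x = 0" "r \<bullet> snd x = 0" using that by (simp_all add: vec_eq_iff forall_6)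
      then have "snd x \<bullet> snd x = 0"
        by (subst (1) span[of "snd x"]) (simp add: inner_add_left)
      then show ?thesis using that by (simp add: prod_eq_iff vec_eq_iff forall_6 forall_3)
    qed
    show "DIM((real^3) \<times> (real^3)) = DIM(real^6)" by simp
    have fst: "fst (metric_lie j x y) = 0" for x y by (simp add: metric_lie_def split: prod.split)
    have snd: "z \<bullet> snd (metric_lie j x y) = fst x \<bullet> (j z *v fst y)" for z x y
      using inner_metric_lie[OF lin, of z "fst x" "snd x" "fst y" "snd y"] by simp
    show "?f (metric_lie j x y) = lie6 [0, 0, 0, wedge 1 2, wedge 1 3, wedge 2 3] (?f x) (?f y)" for x y
      unfolding vec_eq_iff forall_6 lie6_eq fst snd form pqr wedge_form minor2_def by simp
  qed
qed

section \<open>Pencils spanned by a single two-form\<close>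

lemma obtain_complementary_functionals:
  fixes P Q :: "real^4"
  assumes "P \<noteq> 0" "Q \<notin> span {P}"
  obtains R S where "\<And>v. P \<bullet> v = 0 \<Longrightarrow> Q \<bullet> v = 0 \<Longrightarrow> R \<bullet> v = 0 \<Longrightarrow> S \<bullet> v = 0 \<Longrightarrow> v = 0"
proof -
  have "dim (span {Q, P}) \<le> card {Q, P}" by (rule dim_le_card) auto
  also have "\<dots> \<le> 2" by (simp add: card_insert_if)
  finally have "dim (span {Q, P}) < dim (UNIV :: (real^4) set)" by simp
  then have "span {Q, P} \<noteq> UNIV" by force
  then obtain R where "R \<notin> span {Q, P}" by blast
  then show ?thesis using obtain_fourth_functional[OF assms] that by blast
qed

context so4_pencil
begin

text \<open>The direction e killed by j yields a closed fifth coordinate. The remaining form is P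
  \<and> Q, and R, S only complete the coordinates.\<close>

lemma iso_h3_rank1:
  assumes ef: "minor2 1 2 e f \<noteq> 0" and "j e = 0" "j f \<noteq> 0" "pfaffian_form (j f) (j f) = 0"
  shows "metric_lie j \<cong>\<^sub>L lie6 [0, 0, 0, 0, 0, wedge 1 2]"
proof -
  obtain x y where xy: "x \<bullet> (j f *v y) = 1" using \<open>j f \<noteq> 0\<close> by (rule so_normalized_pair)
  define P where "P = - (j f *v x)"
  define Q where "Q = - (j f *v y)"
  have PQ: "x \<bullet> (j f *v u) = P \<bullet> u" "y \<bullet> (j f *v u) = Q \<bullet> u" for u
    using so_form_skew[OF so, of x f u] so_form_skew[OF so, of y f u] by (simp_all add: P_def Q_def inner_commute)
  have nf: "u \<bullet> (j f *v v) = P \<bullet> u * (Q \<bullet> v) - P \<bullet> v * (Q \<bullet> u)" for u v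
    using decomposable_form[OF so assms(4) xy, of u v] by (simp only: PQ)
  have "P \<noteq> 0" "Q \<notin> span {P}"
    using xy nf[of x y] by (auto simp: span_singleton)
  then obtain R S where RS: "\<And>v. P \<bullet> v = 0 \<Longrightarrow> Q \<bullet> v = 0 \<Longrightarrow> R \<bullet> v = 0 \<Longrightarrow> S \<bullet> v = 0 \<Longrightarrow> v = 0"
    using obtain_complementary_functionals[of P Q] by blast
  show ?thesis
  proof (rule metric_lie_iso_lie6[OF lin, where e = e and f = f and a = "(\<bullet>) P" and b = "(\<bullet>) Q" and
        c = "(\<bullet>) R" and d = "(\<bullet>) S"])
    show "u = 0" if "e \<bullet> u = 0" "f \<bullet> u = 0" for u
      by (rule minor2_nondegenerate[OF ef that])
    show "v = 0" if "P \<bullet> v = 0" "Q \<bullet> v = 0" "R \<bullet> v = 0" "S \<bullet> v = 0" for v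
      by (rule RS[OF that])
  qed (simp_all add: nf \<open>j e = 0\<close> linear_iff inner_add_right lie6_simps)
qed

text \<open>A Darboux argument: subtracting from A the product P \<and> Q of its contractions with x
  and y leaves a form that kills x. A form with a kernel has zero Pfaffian, hence is again a
  product.\<close>

lemma iso_h5_rank1:
  assumes ef: "minor2 1 2 e f \<noteq> 0" and "j e = 0" and pf: "pfaffian_form (j f) (j f) \<noteq> 0"
  shows "metric_lie j \<cong>\<^sub>L lie6 [0, 0, 0, 0, 0, wedge 1 2 + wedge 3 4]"
proof -
  define A where "A = j f"
  have A: "A \<in> so" "pfaffian_form A A \<noteq> 0" using pf so by (auto simp: A_def)
  then have "A \<noteq> 0" by (auto simp: pfaffian_form_def)
  then obtain x y where xy: "x \<bullet> (A *v y) = 1" by (rule so_normalized_pair)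
  define P where "P = - (A *v x)"
  define Q where "Q = - (A *v y)"
  have PQ: "x \<bullet> (A *v u) = P \<bullet> u" "y \<bullet> (A *v u) = Q \<bullet> u" for u
    using so_form_skew[OF A(1), of x u] so_form_skew[OF A(1), of y u] by (simp_all add: P_def Q_def inner_commute)
  define W where "W = (\<chi> i k. P $ i * Q $ k - P $ k * Q $ i)"
  have W: "W \<in> so" by (rule soI) (simp add: W_def)
  have Wform: "u \<bullet> (W *v v) = P \<bullet> u * (Q \<bullet> v) - P \<bullet> v * (Q \<bullet> u)" for u v
    unfolding so4_form[OF W] by (simp add: W_def minor2_def inner_vec_def sum_4) algebra
  have pfW: "pfaffian_form W W = 0" by (simp add: W_def pfaffian_form_def algebra_simps)
  define A' where "A' = A - W"
  have A': "A' \<in> so"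
  proof (rule soI)
    show "A' $ k $ i = - (A' $ i $ k)" for i k
      by (simp add: A'_def so_entries[OF A(1), of k i] so_entries[OF W, of k i])
  qed
  have form: "u \<bullet> (A *v v) = u \<bullet> (W *v v) + u \<bullet> (A' *v v)" for u v
    by (simp add: A'_def matrix_vector_mult_diff_rdistrib inner_diff_right)
  have "A' \<noteq> 0" using A(2) pfW by (auto simp: A'_def)
  then obtain x' y' where xy': "x' \<bullet> (A' *v y') = 1" by (rule so_normalized_pair)
  \<comment> \<open>On x the functional P vanishes by skew-symmetry and Q is -1, so P \<and> Q
    agrees with A as soon as one argument is x.\<close>
  have "u \<bullet> (A' *v x) = 0" for u
  proof -
    have "Q \<bullet> x = - 1" "P \<bullet> x = 0"
      using PQ xy so_form_skew[OF A(1), of y x] so_form_self[OF A(1), of x] by (metis PQ)+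
    then show ?thesis
      using form[of u x] so_form_skew[OF A(1), of u x] by (simp add: Wform PQ)
  qed
  moreover have "x \<noteq> 0" using xy by auto
  ultimately have pf': "pfaffian_form A' A' = 0"
    using pfaffian_form_nondegenerate[OF A' A'] by blast
  note nf = decomposable_form[OF A' pf' xy']
  show ?thesis
  proof (rule metric_lie_iso_lie6[OF lin, where e = e and f = f and a = "(\<bullet>) P" and b = "(\<bullet>) Q" and
        c = "\<lambda>v. x' \<bullet> (A' *v v)" and d = "\<lambda>v. y' \<bullet> (A' *v v)"])
    show "u = 0" if "e \<bullet> u = 0" "f \<bullet> u = 0" for u
      by (rule minor2_nondegenerate[OF ef that])
    show "v = 0" if "P \<bullet> v = 0" "Q \<bullet> v = 0" "x' \<bullet> (A' *v v) = 0" "y' \<bullet> (A' *v v) = 0" for v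
    proof (rule pfaffian_form_nondegenerate[OF A(1) A(1) A(2)])
      show "u \<bullet> (A *v v) = 0" "u \<bullet> (A *v v) = 0" for u
        unfolding form Wform nf[of u v] using that by simp_all
    qed
    show "u \<bullet> (j f *v v) = vector [P \<bullet> u, Q \<bullet> u, x' \<bullet> (A' *v u), y' \<bullet> (A' *v u), s, t] \<bullet>
        ((wedge 1 2 + wedge 3 4) *v (vector [P \<bullet> v, Q \<bullet> v, x' \<bullet> (A' *v v), y' \<bullet> (A' *v v), s', t'] :: real^6))"
      for u v s t s' t'
      unfolding A_def[symmetric] form[of u v] Wform nf[of u v] by (simp add: lie6_simps)
  qed (auto simp: \<open>j e = 0\<close> linear_iff inner_add_right matrix_vector_right_distrib linear_form[unfolded linear_iff])
qed

end

lemma inner_matrix_vector_mult: "x \<bullet> (A *v y) = (transpose A *v x) \<bullet> y" for A :: "real^'n^'m"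
  by (simp add: dot_lmul_matrix)

section \<open>Reduction from five to four dimensions\<close>

lemma linear_R4_to_R5: "linear R4_to_R5"
  by (simp add: linear_iff R4_to_R5_def vec_eq_iff forall_5)

abbreviation "R5_to_R4 \<equiv> transpose (matrix R4_to_R5)"

lemma R5_to_R4_nth:
  "(R5_to_R4 *v v) $ 1 = v $ 1" "(R5_to_R4 *v v) $ 2 = v $ 2" "(R5_to_R4 *v v) $ 3 = v $ 3" "(R5_to_R4 *v v) $ 4 = v $ 4"
  by (simp_all add: matrix_vector_mult_def transpose_def matrix_def R4_to_R5_def sum_5 axis_def)

lemma so4_to_so5_form: "x \<bullet> (so4_to_so5 A *v y) = (R5_to_R4 *v x) \<bullet> (A *v (R5_to_R4 *v y))"
  unfolding so4_to_so5_def
  by (simp add: dot_lmul_matrix flip: matrix_vector_mul_assoc)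

lemma linear_matrix_sandwich: "linear (\<lambda>A. P ** A ** Q)" for P :: "real^'n^'m" and Q :: "real^'k^'l"
  by (rule linearI)
    (simp_all add: matrix_matrix_mult_def vec_eq_iff ring_distribs sum.distrib sum_distrib_left mult_ac)

lemma linear_so4_to_so5: "linear so4_to_so5"
  unfolding so4_to_so5_def[abs_def] by (rule linear_matrix_sandwich)

text \<open>After undoing the rotation, the fifth coordinate lies in the kernel of the form. It is
  moved from the complement to the center, where it becomes the second axis of R^2, on which the
  extension of \<open>j'\<close> is zero.\<close>

lemma conjugate_to_so4_iso:
  assumes "conjugate_to_so4 j j'"
  shows "metric_lie j \<cong>\<^sub>L metric_lie (\<lambda>z :: real^2. j' (z $ 1))"
proof -
  obtain g where g: "orthogonal_matrix g" "\<And>z. j z = g ** so4_to_so5 (j' z) ** transpose g"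
    and linj': "linear j'"
    using assms unfolding conjugate_to_so4_def by blast
  have jform: "x \<bullet> (j z *v y) = (transpose g *v x) \<bullet> (so4_to_so5 (j' z) *v (transpose g *v y))" for x y z
    unfolding g(2) by (simp add: dot_lmul_matrix flip: matrix_vector_mul_assoc)
  have linj: "linear j"
    using linear_compose[OF linear_compose[OF linj' linear_so4_to_so5] linear_matrix_sandwich[of g "transpose g"]]
    by (simp add: o_def flip: g(2))
  have linj2: "linear (\<lambda>z :: real^2. j' (z $ 1))"
    using linear_compose[OF bounded_linear.linear[OF bounded_linear_vec_nth] linj', of 1] by (simp add: o_def)
  let ?f = "\<lambda>p. (R5_to_R4 *v (transpose g *v fst p), vector [snd p, (transpose g *v fst p) $ 5] :: real^2)"
  show ?thesis
  proof (rule lie_isoI)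
    show "linear ?f"
      by (simp add: linear_iff vec_eq_iff forall_2 matrix_vector_right_distrib matrix_vector_mult_scaleR
          del: transpose_matrix_vector)
    show "p = 0" if "?f p = 0" for p
    proof -
      have "transpose g *v fst p = 0"
        using that R5_to_R4_nth[of "transpose g *v fst p"]
        by (simp add: vec_eq_iff forall_2 forall_4 forall_5 prod_eq_iff)
      then have "g ** transpose g *v fst p = 0" by (simp flip: matrix_vector_mul_assoc)
      then have "fst p = 0" using g(1) by (simp add: orthogonal_matrix_def)
      then show ?thesis using that by (simp add: vec_eq_iff forall_2 prod_eq_iff)
    qed
    show "DIM((real^5) \<times> real) = DIM((real^4) \<times> (real^2))" by simp
    have fst: "fst (metric_lie i p q) = 0" for i :: "'c::euclidean_space \<Rightarrow> real^'d^'d" and p q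
      by (simp add: metric_lie_def split: prod.split)
    have snd1: "z * snd (metric_lie j p q) = fst p \<bullet> (j z *v fst q)" for z p q
      using inner_metric_lie[OF linj, of z "fst p" "snd p" "fst q" "snd q"] by simp
    have snd2: "z \<bullet> snd (metric_lie (\<lambda>z :: real^2. j' (z $ 1)) p q) = fst p \<bullet> (j' (z $ 1) *v fst q)" for z p q
      using inner_metric_lie[OF linj2, of z "fst p" "snd p" "fst q" "snd q"] by simp
    show "?f (metric_lie j p q) = metric_lie (\<lambda>z. j' (z $ 1)) (?f p) (?f q)" for p q
    proof (rule prod_eqI)
      show "fst (?f (metric_lie j p q)) = fst (metric_lie (\<lambda>z. j' (z $ 1)) (?f p) (?f q))" by (simp add: fst)
      have "z \<bullet> snd (?f (metric_lie j p q)) = z \<bullet> snd (metric_lie (\<lambda>z. j' (z $ 1)) (?f p) (?f q))" for z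
        unfolding snd2 by (simp add: inner_2 snd1 fst jform so4_to_so5_form)
      then show "snd (?f (metric_lie j p q)) = snd (metric_lie (\<lambda>z. j' (z $ 1)) (?f p) (?f q))"
        using vector_eq_ldot by blast
    qed
  qed
qed

text \<open>In odd dimension det A = det (-A) = - det A, so A is singular.\<close>

lemma so5_kernel:
  assumes "A \<in> (so :: (real^5^5) set)"
  obtains w where "norm w = 1" "A *v w = 0"
proof -
  have "transpose A = (\<chi> i. (- 1) *s A $ i)"
    using assms by (simp add: so_def vec_eq_iff)
  then have "det (transpose A) = (- 1) ^ 5 * det A"
    using det_rows_mul[of "\<lambda>_. - 1" "\<lambda>i. A $ i"] by simp
  then have "det A = 0" by simp
  then obtain w where w: "w \<noteq> 0" "A *v w = 0" 
    by (metis invertible_det_nz invertible_left_inverse matrix_left_invertible_ker)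
  then have "norm (w /\<^sub>R norm w) = 1" "A *v (w /\<^sub>R norm w) = 0"
    by (simp_all add: matrix_vector_mult_scaleR)
  then show ?thesis using that by blast
qed

text \<open>Rotating a unit kernel vector to the fifth axis makes the fifth row and column vanish,
  so the matrix is recovered from its 4x4 block. As the source of j is one-dimensional, one rotation
  serves all z.\<close>

lemma obtain_conjugate_to_so4:
  fixes j :: "real \<Rightarrow> real^5^5"
  assumes lin: "linear j" and so: "range j \<subseteq> so"
  obtains j' where "conjugate_to_so4 j j'"
proof -
  define A where "A = j 1"
  have jA: "j z = z *\<^sub>R A" for z using linear_cmul[OF lin, of z 1] by (simp add: A_def)
  have A: "A \<in> so" using so by (auto simp: A_def)
  obtain w where w: "norm w = 1" "A *v w = 0" using so5_kernel[OF A] by blast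
  obtain g where g: "orthogonal_matrix g" "g *v axis 5 1 = w"
    using orthogonal_matrix_exists_basis[OF w(1)] by blast
  define B where "B = transpose g ** A ** g"
  have B: "B \<in> so" using A by (simp add: B_def so_def matrix_transpose_mul matrix_mul_assoc
    linear_neg[OF linear_matrix_sandwich[where P = "transpose g" and Q = g]])
  have Bw: "B *v axis 5 1 = 0" using g(2) w(2) by (simp add: B_def flip: matrix_vector_mul_assoc)
  define A' where "A' = R5_to_R4 ** B ** transpose R5_to_R4"
  have A': "A' \<in> so" using B by (simp add: A'_def so_def matrix_transpose_mul matrix_mul_assoc
    linear_neg[OF linear_matrix_sandwich[where P = R5_to_R4 and Q = "matrix R4_to_R5"]])
  let ?p = "\<lambda>x. transpose R5_to_R4 *v (R5_to_R4 *v x)"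
  have p: "?p x = x - (x $ 5) *\<^sub>R axis 5 1" for x
  proof -
    have "?p x = R4_to_R5 (R5_to_R4 *v x)" using fun_cong[OF matrix_vector_mul(2)[OF linear_R4_to_R5]] by simp
    also have "\<dots> = x - (x $ 5) *\<^sub>R axis 5 1"
      by (simp add: vec_eq_iff forall_5 R4_to_R5_def R5_to_R4_nth axis_def del: transpose_matrix_vector)
    finally show ?thesis .
  qed
  \<comment> \<open>Restricting to R^4 and extending again replaces both arguments by their
    projections along the fifth axis, which B annihilates.\<close>
  have "x \<bullet> (so4_to_so5 A' *v y) = ?p x \<bullet> (B *v ?p y)" for x y
    unfolding so4_to_so5_form A'_def matrix_vector_mul_assoc[symmetric] by (rule inner_matrix_vector_mult)
  also have "?p x \<bullet> (B *v ?p y) = x \<bullet> (B *v y)" for x y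
    unfolding p using so_form_skew[OF B, of "axis 5 1"]
    by (simp add: matrix_vector_mult_diff_distrib inner_diff_left matrix_vector_mult_scaleR Bw)
  finally have "so4_to_so5 A' = B"
    using matrix_form_eq_0_iff[of "so4_to_so5 A' - B"]
    by (simp add: matrix_vector_mult_diff_rdistrib inner_diff_right)
  moreover have "g ** B ** transpose g = A"
  proof -
    have "g ** B ** transpose g = (g ** transpose g) ** A ** (g ** transpose g)"
      by (simp add: B_def matrix_mul_assoc)
    then show ?thesis using g(1) by (simp add: orthogonal_matrix_def)
  qed
  ultimately have "j z = g ** so4_to_so5 (z *\<^sub>R A') ** transpose g" for z
    using linear_cmul[OF linear_matrix_sandwich[of g "transpose g"]]
    by (simp add: linear_cmul[OF linear_so4_to_so5] jA)
  moreover have "linear (\<lambda>z :: real. z *\<^sub>R A')" by (simp add: linear_iff scaleR_left_distrib)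
  moreover have "z *\<^sub>R A' \<in> so" for z
  proof (rule soI)
    show "(z *\<^sub>R A') $ k $ i = - ((z *\<^sub>R A') $ i $ k)" for i k
      by (simp add: so_entries[OF A', of k i])
  qed
  ultimately have "conjugate_to_so4 j (\<lambda>z. z *\<^sub>R A')"
    using g(1) unfolding conjugate_to_so4_def by blast
  then show ?thesis by (rule that)
qed

section \<open>Invariants\<close>

lemma so4_inner_add_scaleR:
  "so4_inner (A + B) C = so4_inner A C + so4_inner B C" "so4_inner (r *\<^sub>R A) C = r * so4_inner A C"
  by (simp_all add: so4_inner_def inner_add_left add_divide_distrib)

lemma inner_3: "x \<bullet> y = x $ 1 * y $ 1 + x $ 2 * y $ 2 + x $ 3 * y $ 3" for x y :: "real^3"
  by (simp add: inner_vec_def sum_3)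

lemma linear_j_plus:
  assumes "linear j"
  shows "linear (j_plus j)"
  by (rule linearI)
    (simp_all add: j_plus_def vec_eq_iff linear_add[OF assms] linear_cmul[OF assms] so4_inner_add_scaleR)

lemma linear_j_minus:
  assumes "linear j"
  shows "linear (j_minus j)"
  by (rule linearI)
    (simp_all add: j_minus_def vec_eq_iff linear_add[OF assms] linear_cmul[OF assms] so4_inner_add_scaleR)

lemma doubleton_mset_eq: "{#a, b#} = {#c, d#} \<longleftrightarrow> a = c \<and> b = d \<or> a = d \<and> b = c"
  by (auto simp: add_eq_conv_ex)

text \<open>The decomposition into self-dual and anti-self-dual forms is orthogonal for the scalar
  product and for the wedge pairing, which is positive on the one part and negative on the other.
  The factor 1/2 arises because each basis element pairs with itself to 2 or -2.\<close>

lemma j_plus_minus_inner: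
  assumes "j z \<in> so" "j w \<in> so"
  shows "j_plus j z \<bullet> j_plus j w + j_minus j z \<bullet> j_minus j w = so4_inner (j z) (j w)"
    and "j_plus j z \<bullet> j_plus j w - j_minus j z \<bullet> j_minus j w = pfaffian_form (j z) (j w) / 2"
proof -
  note s = so_entries[OF assms(1)] and t = so_entries[OF assms(2)]
  have d: "j z $ i $ i = 0" "j w $ i $ i = 0" for i using s[of i i] t[of i i] by auto
  show "j_plus j z \<bullet> j_plus j w + j_minus j z \<bullet> j_minus j w = so4_inner (j z) (j w)"
    unfolding inner_3 j_plus_def j_minus_def vec_lambda_beta so4_inner_basis
    by (simp add: so4_inner_def inner_vec_def sum_4 d s[of 2 1] s[of 3 1] s[of 4 1] s[of 3 2] s[of 4 2] s[of 4 3]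
      t[of 2 1] t[of 3 1] t[of 4 1] t[of 3 2] t[of 4 2] t[of 4 3] field_simps)
  show "j_plus j z \<bullet> j_plus j w - j_minus j z \<bullet> j_minus j w = pfaffian_form (j z) (j w) / 2"
    unfolding inner_3 j_plus_def j_minus_def vec_lambda_beta so4_inner_basis
    by (simp add: pfaffian_form_def s[of 2 1] s[of 3 1] s[of 4 1] s[of 3 2] s[of 4 2] s[of 4 3]
      t[of 2 1] t[of 3 1] t[of 4 1] t[of 3 2] t[of 4 2] t[of 4 3] field_simps)
qed

lemma has_Spec_unique: "has_Spec T M \<Longrightarrow> has_Spec T N \<Longrightarrow> M = N"
  by (simp add: has_Spec_def multiset_eq_iff)

definition orthonormal2 :: "real^2 \<Rightarrow> real^2 \<Rightarrow> bool" where
  "orthonormal2 e f \<longleftrightarrow> e \<bullet> e = 1 \<and> f \<bullet> f = 1 \<and> e \<bullet> f = 0"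

lemma orthonormal2_commute: "orthonormal2 e f \<Longrightarrow> orthonormal2 f e"
  by (auto simp: orthonormal2_def inner_commute)

lemma orthonormal2_axis: "orthonormal2 (axis 1 1) (axis 2 1)"
  by (simp add: orthonormal2_def inner_axis_axis)

lemma orthonormal2_minor2:
  assumes "orthonormal2 e f"
  shows "minor2 1 2 e f \<noteq> 0"
proof
  assume 0: "minor2 1 2 e f = 0"
  have "(e \<bullet> e) * (f \<bullet> f) = (e \<bullet> f)\<^sup>2 + (minor2 1 2 e f)\<^sup>2"
    by (simp add: inner_2 minor2_def) algebra
  then show False using assms 0 by (simp add: orthonormal2_def)
qed

lemma orthonormal2_expansion:
  assumes "orthonormal2 e f"
  shows "v = (e \<bullet> v) *\<^sub>R e + (f \<bullet> v) *\<^sub>R f"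
proof -
  have "v - ((e \<bullet> v) *\<^sub>R e + (f \<bullet> v) *\<^sub>R f) = 0"
    by (rule minor2_nondegenerate[OF orthonormal2_minor2[OF assms]])
      (use assms in \<open>auto simp: orthonormal2_def inner_diff_right inner_add_right inner_commute\<close>)
  then show ?thesis by simp
qed

text \<open>Rotating by half the polar angle of \<open>((Q(e,e) - Q(f,f)) / 2, Q(e,f))\<close> diagonalizes \<open>Q\<close>.\<close>

lemma diagonalize_symmetric_form:
  fixes Q :: "real^2 \<Rightarrow> real^2 \<Rightarrow> real"
  assumes "bilinear Q" and sym: "\<And>x y. Q x y = Q y x"
  obtains e f where "orthonormal2 e f" "Q e f = 0"
proof -
  let ?i = "axis 1 1 :: real^2" and ?k = "axis 2 1 :: real^2"
  obtain r \<phi> where r: "(Q ?i ?i - Q ?k ?k) / 2 = r * cos \<phi>" "Q ?i ?k = r * sin \<phi>"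
    using polar_Ex by blast
  define c where "c = cos (\<phi> / 2)"
  define s where "s = sin (\<phi> / 2)"
  have cs: "cos \<phi> = c\<^sup>2 - s\<^sup>2" "sin \<phi> = 2 * s * c" "s\<^sup>2 + c\<^sup>2 = 1"
    using cos_double[of "\<phi> / 2"] sin_double[of "\<phi> / 2"] by (simp_all add: c_def s_def)
  let ?e = "c *\<^sub>R ?i + s *\<^sub>R ?k" and ?f = "(- s) *\<^sub>R ?i + c *\<^sub>R ?k"
  have "orthonormal2 ?e ?f"
    using cs(3) by (simp add: orthonormal2_def inner_2 axis_def power2_eq_square)
  moreover have "Q ?e ?f = 0"
  proof -
    have "Q ?e ?f = (c\<^sup>2 - s\<^sup>2) * Q ?i ?k - 2 * s * c * ((Q ?i ?i - Q ?k ?k) / 2)"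
      using sym[of ?k ?i]
      by (simp only: bilinear_ladd[OF assms(1)] bilinear_radd[OF assms(1)] bilinear_lmul[OF assms(1)]
        bilinear_rmul[OF assms(1)]) (simp add: field_simps power2_eq_square)
    also have "\<dots> = 0" unfolding r cs by (simp add: algebra_simps)
    finally show ?thesis .
  qed
  ultimately show ?thesis by (rule that)
qed

text \<open>Each eigenspace is cut out by the coordinates whose eigenvalue differs from \<mu>. This
  treats \<alpha> = \<beta> together with the generic case, since the dimension then counts both
  axes.\<close>

lemma has_Spec_diagonal:
  fixes T :: "real^2 \<Rightarrow> real^2"
  assumes "linear T" and on: "orthonormal2 e f" and T: "T e = \<alpha> *\<^sub>R e" "T f = \<beta> *\<^sub>R f"
  shows "has_Spec T {#\<alpha>, \<beta>#}"
proof -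
  have ne: "e \<noteq> 0" "f \<noteq> 0" using on by (auto simp: orthonormal2_def)
  have Tv: "T v = (e \<bullet> v * \<alpha>) *\<^sub>R e + (f \<bullet> v * \<beta>) *\<^sub>R f" for v
    by (subst orthonormal2_expansion[OF on, of v])
      (simp add: linear_add[OF assms(1)] linear_cmul[OF assms(1)] T)
  have inner: "e \<bullet> T v = \<alpha> * (e \<bullet> v)" "f \<bullet> T v = \<beta> * (f \<bullet> v)" for v
    using on by (simp_all add: Tv inner_add_right orthonormal2_def inner_commute[of f e])
  have eig: "{v. T v = \<mu> *\<^sub>R v} = {v. (\<alpha> = \<mu> \<or> e \<bullet> v = 0) \<and> (\<beta> = \<mu> \<or> f \<bullet> v = 0)}" for \<mu>
  proof (intro Collect_cong iffI conjI)
    fix v assume "T v = \<mu> *\<^sub>R v"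
    then have "\<alpha> * (e \<bullet> v) = \<mu> * (e \<bullet> v)" "\<beta> * (f \<bullet> v) = \<mu> * (f \<bullet> v)" by (simp_all flip: inner)
    then show "\<alpha> = \<mu> \<or> e \<bullet> v = 0" "\<beta> = \<mu> \<or> f \<bullet> v = 0" by auto
  next
    fix v assume "(\<alpha> = \<mu> \<or> e \<bullet> v = 0) \<and> (\<beta> = \<mu> \<or> f \<bullet> v = 0)"
    then have "T v = \<mu> *\<^sub>R ((e \<bullet> v) *\<^sub>R e + (f \<bullet> v) *\<^sub>R f)" by (auto simp: Tv algebra_simps)
    then show "T v = \<mu> *\<^sub>R v" using orthonormal2_expansion[OF on, of v] by simp
  qed
  have "{v. f \<bullet> v = 0} = span {e}" "{v. e \<bullet> v = 0} = span {f}"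
  proof -
    have "v \<in> span {e}" if "f \<bullet> v = 0" for v
      using orthonormal2_expansion[OF on, of v] that by (metis add.right_neutral scale_zero_left span_base span_scale insertI1)
    then show "{v. f \<bullet> v = 0} = span {e}"
      using on by (auto simp: span_singleton orthonormal2_def inner_commute)
    have "v \<in> span {f}" if "e \<bullet> v = 0" for v
      using orthonormal2_expansion[OF on, of v] that by (metis add.left_neutral scale_zero_left span_base span_scale insertI1)
    then show "{v. e \<bullet> v = 0} = span {f}"
      using on by (auto simp: span_singleton orthonormal2_def)
  qed
  moreover have "{v. e \<bullet> v = 0 \<and> f \<bullet> v = 0} = {0}"
    using minor2_nondegenerate[OF orthonormal2_minor2[OF on]] by auto
  ultimately show ?thesis
    unfolding has_Spec_def eig using ne by auto
qed

lemma has_Spec_scaleR: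
  "has_Spec ((*\<^sub>R) c :: 'a \<Rightarrow> 'a) (replicate_mset DIM('a::euclidean_space) c)"
proof -
  have "{v :: 'a. c *\<^sub>R v = \<mu> *\<^sub>R v} = (if c = \<mu> then UNIV else {0})" for \<mu> by auto
  then show ?thesis by (auto simp: has_Spec_def count_replicate_mset)
qed

lemma inner_adjoint_self:
  fixes g :: "'a::euclidean_space \<Rightarrow> 'b::euclidean_space"
  shows "linear g \<Longrightarrow> w \<bullet> (adjoint g \<circ> g) z = g w \<bullet> g z"
  by (simp add: adjoint_works)

lemma linear_adjoint_self:
  fixes g :: "'a::euclidean_space \<Rightarrow> 'b::euclidean_space"
  shows "linear g \<Longrightarrow> linear (adjoint g \<circ> g)"
  by (intro linear_compose adjoint_linear)

lemma adjoint_self_eigenvector: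
  fixes g :: "real^2 \<Rightarrow> 'b::euclidean_space"
  assumes "linear g" "orthonormal2 e f" "g e \<bullet> g f = 0"
  shows "(adjoint g \<circ> g) e = (g e \<bullet> g e) *\<^sub>R e"
  using orthonormal2_expansion[OF assms(2), of "(adjoint g \<circ> g) e"]
  unfolding inner_adjoint_self[OF assms(1)] using assms(3) by (simp add: inner_commute)

lemma has_Spec_adjoint_self:
  fixes g :: "real^2 \<Rightarrow> 'b::euclidean_space"
  assumes "linear g" "orthonormal2 e f" "g e \<bullet> g f = 0"
  shows "has_Spec (adjoint g \<circ> g) {#g e \<bullet> g e, g f \<bullet> g f#}"
  using assms by (intro has_Spec_diagonal[OF linear_adjoint_self[OF assms(1)] assms(2)]
      adjoint_self_eigenvector[OF assms] adjoint_self_eigenvector[OF assms(1) orthonormal2_commute[OF assms(2)]])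
    (simp add: inner_commute)

lemma invariants_diagonalI:
  assumes "linear j" "orthonormal2 e f" "j_plus j e \<bullet> j_plus j f = 0" "j_minus j e \<bullet> j_minus j f = 0"
    and "{#\<alpha>p, \<beta>p#} = {#j_plus j e \<bullet> j_plus j e, j_plus j f \<bullet> j_plus j f#}" "\<alpha>p \<le> \<beta>p"
    and "{#\<alpha>m, \<beta>m#} = {#j_minus j e \<bullet> j_minus j e, j_minus j f \<bullet> j_minus j f#}" "\<alpha>m \<le> \<beta>m"
    and "t = trace (matrix ((adjoint (j_plus j) \<circ> j_plus j) \<circ> (adjoint (j_minus j) \<circ> j_minus j)))"
  shows "invariants j \<alpha>p \<beta>p \<alpha>m \<beta>m t"
proof -
  have "0 \<le> \<alpha>p" "0 \<le> \<alpha>m"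
    using assms(5,7) by (auto simp: doubleton_mset_eq)
  then show ?thesis
    unfolding invariants_def Let_def
    using assms has_Spec_adjoint_self[OF linear_j_plus[OF assms(1)] assms(2,3)]
      has_Spec_adjoint_self[OF linear_j_minus[OF assms(1)] assms(2,4)] by auto
qed

lemma isometric_so4D:
  assumes "isometric_so4 j"
  shows "linear j" "j z \<in> so" "j_plus j z \<bullet> j_plus j w + j_minus j z \<bullet> j_minus j w = z \<bullet> w"
    "j z = 0 \<Longrightarrow> z = 0"
proof -
  show so: "linear j" "j z \<in> so" for z using assms unfolding isometric_so4_def by auto
  have iso: "so4_inner (j z) (j w) = z \<bullet> w" for z w using assms unfolding isometric_so4_def by auto
  show "j_plus j z \<bullet> j_plus j w + j_minus j z \<bullet> j_minus j w = z \<bullet> w"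
    by (simp add: j_plus_minus_inner(1)[of j z w, OF so(2) so(2)] iso)
  show "z = 0" if "j z = 0"
    using iso[of z z] that by (simp add: so4_inner_def)
qed

text \<open>For isometric j the two operators add up to the identity, so axes diagonalizing the plus
  part diagonalize the minus part as well. Swapping e and f arranges the order.\<close>

lemma obtain_principal_axes:
  fixes j :: "real^2 \<Rightarrow> real^4^4"
  assumes "isometric_so4 j"
  obtains e f where "orthonormal2 e f" "j_plus j e \<bullet> j_plus j f = 0" "j_minus j e \<bullet> j_minus j f = 0"
    "j_plus j e \<bullet> j_plus j e \<le> j_plus j f \<bullet> j_plus j f"
proof -
  note j = isometric_so4D[OF assms]
  note lp = linear_j_plus[OF j(1)]
  have "bilinear (\<lambda>z w. j_plus j z \<bullet> j_plus j w)"
    by (auto simp: bilinear_def linear_iff linear_add[OF lp] linear_cmul[OF lp] inner_add_left inner_add_right)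
  then obtain e f where ef: "orthonormal2 e f" "j_plus j e \<bullet> j_plus j f = 0"
    by (rule diagonalize_symmetric_form) (rule inner_commute)
  have "j_minus j e \<bullet> j_minus j f = 0" using j(3)[of e f] ef by (simp add: orthonormal2_def)
  then show ?thesis
    using that[of e f] that[of f e] ef by (cases "j_plus j e \<bullet> j_plus j e \<le> j_plus j f \<bullet> j_plus j f")
      (auto simp: orthonormal2_commute inner_commute)
qed

text \<open>On a unit vector the squared lengths of the two components add up to 1, so the axis with
  the smaller plus part has the larger minus part. Thus \<open>\<alpha>p\<close> is paired with
  \<open>\<beta>m\<close>, and \<open>\<beta>p\<close> with \<open>\<alpha>m\<close>.\<close>

lemma isometric_invariantsE:
  assumes iso: "isometric_so4 j" and inv: "invariants j \<alpha>p \<beta>p \<alpha>m \<beta>m t"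
  obtains e f where "orthonormal2 e f" "pfaffian_form (j e) (j f) = 0"
    "pfaffian_form (j e) (j e) = 2 * (2 * \<alpha>p - 1)" "pfaffian_form (j f) (j f) = 2 * (1 - 2 * \<alpha>m)"
    "\<alpha>p + \<beta>m = 1" "\<alpha>m + \<beta>p = 1" "\<alpha>p \<le> \<beta>p" "\<alpha>m \<le> \<beta>m"
proof -
  note j = isometric_so4D[OF iso]
  obtain e f where ef: "orthonormal2 e f" "j_plus j e \<bullet> j_plus j f = 0" "j_minus j e \<bullet> j_minus j f = 0"
    "j_plus j e \<bullet> j_plus j e \<le> j_plus j f \<bullet> j_plus j f"
    using obtain_principal_axes[OF iso] by blast
  have le: "\<alpha>p \<le> \<beta>p" "\<alpha>m \<le> \<beta>m"
    and "{#\<alpha>p, \<beta>p#} = {#j_plus j e \<bullet> j_plus j e, j_plus j f \<bullet> j_plus j f#}"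
    and "{#\<alpha>m, \<beta>m#} = {#j_minus j e \<bullet> j_minus j e, j_minus j f \<bullet> j_minus j f#}"
    using inv has_Spec_unique has_Spec_adjoint_self[OF linear_j_plus[OF j(1)] ef(1,2)]
      has_Spec_adjoint_self[OF linear_j_minus[OF j(1)] ef(1,3)]
    unfolding invariants_def Let_def by auto
  moreover have sum: "j_plus j e \<bullet> j_plus j e + j_minus j e \<bullet> j_minus j e = 1"
    "j_plus j f \<bullet> j_plus j f + j_minus j f \<bullet> j_minus j f = 1"
    using j(3)[of e e] j(3)[of f f] ef(1) by (auto simp: orthonormal2_def)
  ultimately have vals: "j_plus j e \<bullet> j_plus j e = \<alpha>p" "j_plus j f \<bullet> j_plus j f = \<beta>p"
      "j_minus j e \<bullet> j_minus j e = \<beta>m" "j_minus j f \<bullet> j_minus j f = \<alpha>m"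
    using ef(4) by (auto simp: doubleton_mset_eq)
  show ?thesis
  proof (rule that[OF ef(1) _ _ _ _ _ le])
    show "\<alpha>p + \<beta>m = 1" "\<alpha>m + \<beta>p = 1" using sum vals by auto
    show "pfaffian_form (j e) (j f) = 0"
      using j_plus_minus_inner(2)[of j e f, OF j(2) j(2)] ef by simp
    show "pfaffian_form (j e) (j e) = 2 * (2 * \<alpha>p - 1)" "pfaffian_form (j f) (j f) = 2 * (1 - 2 * \<alpha>m)"
      using j_plus_minus_inner(2)[of j e e, OF j(2) j(2)] j_plus_minus_inner(2)[of j f f, OF j(2) j(2)] sum vals
      by auto
  qed
qed

lemma obtain_labelled_invariants:
  assumes "isometric_so4 j"
  obtains \<alpha>p \<beta>p \<alpha>m \<beta>m t where "labelled_invariants j \<alpha>p \<beta>p \<alpha>m \<beta>m t"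
proof -
  note j = isometric_so4D[OF assms]
  obtain e f where ef: "orthonormal2 e f" "j_plus j e \<bullet> j_plus j f = 0" "j_minus j e \<bullet> j_minus j f = 0"
    "j_plus j e \<bullet> j_plus j e \<le> j_plus j f \<bullet> j_plus j f"
    using obtain_principal_axes[OF assms] by blast
  have "j_minus j f \<bullet> j_minus j f \<le> j_minus j e \<bullet> j_minus j e"
    using ef(4) j(3)[of e e] j(3)[of f f] ef(1) by (auto simp: orthonormal2_def)
  then obtain \<alpha>p \<beta>p \<alpha>m \<beta>m t where "invariants j \<alpha>p \<beta>p \<alpha>m \<beta>m t"
    using invariants_diagonalI[OF j(1) ef(1-3) refl ef(4) add_mset_commute _ refl] by blast
  then show ?thesis
    using that[of \<alpha>p \<beta>p \<alpha>m \<beta>m t] that[of \<alpha>m \<beta>m \<alpha>p \<beta>p t] unfolding labelled_invariants_def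
    by linarith
qed

lemma isometric_so4_pencil: "isometric_so4 j \<Longrightarrow> so4_pencil j"
  unfolding so4_pencil_def using isometric_so4D(1,2) by blast

text \<open>The conditions are symmetric under interchange of the signs, so one statement serves
  both alternatives in \<open>labelled_invariants\<close>.\<close>

lemma isometric_iso_types:
  assumes iso: "isometric_so4 j" and inv: "invariants j \<alpha>p \<beta>p \<alpha>m \<beta>m t"
  shows "\<alpha>p < 1/2 \<Longrightarrow> \<alpha>m < 1/2 \<Longrightarrow> metric_lie j \<cong>\<^sub>L lie6 [0, 0, 0, 0, wedge 1 2, wedge 3 4]"
    and "(\<alpha>p = 1/2) \<noteq> (\<alpha>m = 1/2) \<Longrightarrow> metric_lie j \<cong>\<^sub>L lie6 [0, 0, 0, 0, wedge 1 2, wedge 1 4 + wedge 2 3]"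
    and "\<alpha>p = 1/2 \<Longrightarrow> \<alpha>m = 1/2 \<Longrightarrow> metric_lie j \<cong>\<^sub>L lie6 [0, 0, 0, 0, wedge 1 2, wedge 1 3]"
    and "(\<alpha>p - 1/2) * (\<alpha>m - 1/2) < 0 \<Longrightarrow>
      metric_lie j \<cong>\<^sub>L lie6 [0, 0, 0, 0, wedge 1 3 + wedge 4 2, wedge 1 4 + wedge 2 3]"
proof -
  interpret so4_pencil j by (rule isometric_so4_pencil[OF iso])
  obtain e f where ef: "orthonormal2 e f" "pfaffian_form (j e) (j f) = 0"
    "pfaffian_form (j e) (j e) = 2 * (2 * \<alpha>p - 1)" "pfaffian_form (j f) (j f) = 2 * (1 - 2 * \<alpha>m)"
    by (rule isometric_invariantsE[OF iso inv])
  note m = orthonormal2_minor2[OF ef(1)] orthonormal2_minor2[OF orthonormal2_commute[OF ef(1)]]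
  note inj = isometric_so4D(4)[OF iso]
  have "e \<noteq> 0" "f \<noteq> 0" using ef(1) by (auto simp: orthonormal2_def)
  then have ne: "j e \<noteq> 0" "j f \<noteq> 0" using inj by blast+
  show "metric_lie j \<cong>\<^sub>L lie6 [0, 0, 0, 0, wedge 1 2, wedge 3 4]" if "\<alpha>p < 1/2" "\<alpha>m < 1/2"
    using that by (intro iso_h3_h3[OF m(1) ef(2)]) (simp add: ef mult_less_0_iff)
  show "metric_lie j \<cong>\<^sub>L lie6 [0, 0, 0, 0, wedge 1 2, wedge 1 4 + wedge 2 3]" if "(\<alpha>p = 1/2) \<noteq> (\<alpha>m = 1/2)"
  proof (cases "\<alpha>p = 1/2")
    case True
    then show ?thesis using that by (intro iso_semidefinite[OF m(1) ef(2) _ _ ne(1)]) (simp_all add: ef)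
  next
    case False
    then show ?thesis
      \<comment> \<open>Here the isotropic direction is f, so e and f exchange their roles.\<close>
      using that ef(2) by (intro iso_semidefinite[OF m(2) _ _ _ ne(2)]) (simp_all add: ef pfaffian_form_commute[of "j f" "j e"])
  qed
  show "metric_lie j \<cong>\<^sub>L lie6 [0, 0, 0, 0, wedge 1 2, wedge 1 3]" if "\<alpha>p = 1/2" "\<alpha>m = 1/2"
    using that by (intro iso_n5[OF m(1) ef(2) _ _ inj]) (simp_all add: ef)
  show "metric_lie j \<cong>\<^sub>L lie6 [0, 0, 0, 0, wedge 1 3 + wedge 4 2, wedge 1 4 + wedge 2 3]"
    if "(\<alpha>p - 1/2) * (\<alpha>m - 1/2) < 0"
  proof (intro iso_h3_complex[OF m(1) ef(2)])
    have "pfaffian_form (j e) (j e) * pfaffian_form (j f) (j f) = - 16 * ((\<alpha>p - 1/2) * (\<alpha>m - 1/2))"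
      by (simp add: ef field_simps)
    then show "pfaffian_form (j e) (j e) * pfaffian_form (j f) (j f) > 0" using that by linarith
  qed
qed

text \<open>No isometry is assumed, because the metric obtained from an abstract algebra is
  arbitrary; its type is read off from the signs of a diagonalized Pfaffian.\<close>

lemma so4_pencil_types:
  fixes j :: "real^2 \<Rightarrow> real^4^4"
  assumes "so4_pencil j" and inj: "\<And>z. j z = 0 \<Longrightarrow> z = 0"
  shows "metric_lie j \<cong>\<^sub>L lie6 [0, 0, 0, 0, wedge 1 2, wedge 3 4] \<or>
    metric_lie j \<cong>\<^sub>L lie6 [0, 0, 0, 0, wedge 1 2, wedge 1 4 + wedge 2 3] \<or>
    metric_lie j \<cong>\<^sub>L lie6 [0, 0, 0, 0, wedge 1 2, wedge 1 3] \<or>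
    metric_lie j \<cong>\<^sub>L lie6 [0, 0, 0, 0, wedge 1 3 + wedge 4 2, wedge 1 4 + wedge 2 3]"
proof -
  interpret so4_pencil j by fact
  have "bilinear (\<lambda>z w. pfaffian_form (j z) (j w))"
    by (auto simp: bilinear_def linear_iff pencil_simps)
  then obtain e f where ef: "orthonormal2 e f" "pfaffian_form (j e) (j f) = 0"
    by (rule diagonalize_symmetric_form) (rule pfaffian_form_commute)
  note m = orthonormal2_minor2[OF ef(1)] orthonormal2_minor2[OF orthonormal2_commute[OF ef(1)]]
  have ef2: "pfaffian_form (j f) (j e) = 0" using ef(2) by (simp add: pfaffian_form_commute)
  have "e \<noteq> 0" "f \<noteq> 0" using ef(1) by (auto simp: orthonormal2_def)
  then have ne: "j e \<noteq> 0" "j f \<noteq> 0" using inj by blast+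
  consider "pfaffian_form (j e) (j e) * pfaffian_form (j f) (j f) < 0"
    | "pfaffian_form (j e) (j e) * pfaffian_form (j f) (j f) > 0"
    | "pfaffian_form (j e) (j e) = 0" "pfaffian_form (j f) (j f) \<noteq> 0"
    | "pfaffian_form (j f) (j f) = 0" "pfaffian_form (j e) (j e) \<noteq> 0"
    | "pfaffian_form (j e) (j e) = 0" "pfaffian_form (j f) (j f) = 0"
    by (metis less_linear mult_eq_0_iff)
  then show ?thesis
  proof cases
    case 1
    then show ?thesis using iso_h3_h3[OF m(1) ef(2)] by blast
  next
    case 2
    then show ?thesis using iso_h3_complex[OF m(1) ef(2)] by blast
  next
    case 3
    then show ?thesis using iso_semidefinite[OF m(1) ef(2) _ _ ne(1)] by blast
  next
    case 4
    then show ?thesis using iso_semidefinite[OF m(2) ef2 _ _ ne(2)] by blast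
  next
    case 5
    then show ?thesis using iso_n5[OF m(1) ef(2) _ _ inj] by blast
  qed
qed

section \<open>Examples with isometric \<open>j\<close>\<close>

text \<open>The two axes go into orthogonal lines of both R^3_+ and R^3_-, so they are principal
  axes. Squared components are eigenvalues, and isometry amounts to both axes having image of length
  one.\<close>

definition diagonal_j :: "real \<Rightarrow> real \<Rightarrow> real \<Rightarrow> real \<Rightarrow> real^2 \<Rightarrow> real^4^4" where
  "diagonal_j p m p' m' z = (z $ 1) *\<^sub>R (p *\<^sub>R e_plus $ 1 + m *\<^sub>R e_minus $ 1)
     + (z $ 2) *\<^sub>R (p' *\<^sub>R e_plus $ 2 + m' *\<^sub>R e_minus $ 2)"

lemma wedge_skew: "wedge i k $ b $ a = - (wedge i k $ a $ b)"
  by (simp only: wedge_def vec_lambda_beta conj_commute[of "b = _"] minus_diff_eq)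

lemma e_plus_minus_skew:
  "e_plus $ i $ b $ a = - (e_plus $ i $ a $ b)" "e_minus $ i $ b $ a = - (e_minus $ i $ a $ b)"
proof -
  note [simp] = wedge_skew[of _ _ b a]
  show "e_plus $ i $ b $ a = - (e_plus $ i $ a $ b)" "e_minus $ i $ b $ a = - (e_minus $ i $ a $ b)"
    using exhaust_3[of i] by (auto simp: e_plus_def e_minus_def)
qed

lemma linear_diagonal_j: "linear (diagonal_j p m p' m')"
  by (simp add: linear_iff diagonal_j_def algebra_simps)

lemma diagonal_j_so: "diagonal_j p m p' m' z \<in> so"
proof (rule soI)
  show "diagonal_j p m p' m' z $ k $ i = - (diagonal_j p m p' m' z $ i $ k)" for i k
    by (simp add: diagonal_j_def e_plus_minus_skew[of _ k i] algebra_simps)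
qed

lemma e_minus_plus_orthogonal: "so4_inner (e_minus $ i) (e_plus $ k) = 0"
  using e_plus_minus_orthonormal(3)[of k i] by (simp add: so4_inner_def inner_commute)

lemma diagonal_j_components:
  "j_plus (diagonal_j p m p' m') z = vector [p * z $ 1, p' * z $ 2, 0]"
  "j_minus (diagonal_j p m p' m') z = vector [m * z $ 1, m' * z $ 2, 0]"
  by (simp_all add: vec_eq_iff forall_3 j_plus_def j_minus_def diagonal_j_def so4_inner_add_scaleR
      e_plus_minus_orthonormal e_minus_plus_orthogonal)

lemma isometric_diagonal_j:
  assumes "p\<^sup>2 + m\<^sup>2 = 1" "p'\<^sup>2 + m'\<^sup>2 = 1"
  shows "isometric_so4 (diagonal_j p m p' m')"
proof -
  have "so4_inner (diagonal_j p m p' m' z) (diagonal_j p m p' m' w) = z \<bullet> w" for z w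
  proof -
    have "so4_inner (diagonal_j p m p' m' z) (diagonal_j p m p' m' w) =
        (p\<^sup>2 + m\<^sup>2) * (z $ 1 * w $ 1) + (p'\<^sup>2 + m'\<^sup>2) * (z $ 2 * w $ 2)"
      unfolding j_plus_minus_inner(1)[of "diagonal_j p m p' m'" z w, OF diagonal_j_so diagonal_j_so, symmetric] diagonal_j_components inner_3
      by (simp add: algebra_simps power2_eq_square)
    then show ?thesis by (simp add: assms inner_2)
  qed
  then show ?thesis
    unfolding isometric_so4_def using linear_diagonal_j diagonal_j_so by blast
qed

lemma invariants_diagonal_j:
  assumes "p\<^sup>2 \<le> p'\<^sup>2" "m'\<^sup>2 \<le> m\<^sup>2"
  obtains t where "invariants (diagonal_j p m p' m') (p\<^sup>2) (p'\<^sup>2) (m'\<^sup>2) (m\<^sup>2) t"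
  by (rule that, rule invariants_diagonalI[OF linear_diagonal_j orthonormal2_axis])
    (use assms in \<open>auto simp: diagonal_j_components inner_3 axis_def power2_eq_square add_mset_commute\<close>)

definition axis_j :: "real \<Rightarrow> real \<Rightarrow> real \<Rightarrow> real^4^4" where
  "axis_j p m z = diagonal_j p m 0 0 (vector [z, 0])"

lemma axis_j_components:
  "j_plus (axis_j p m) z = vector [p * z, 0, 0]" "j_minus (axis_j p m) z = vector [m * z, 0, 0]"
  using diagonal_j_components[of p m 0 0 "vector [z, 0]"] by (simp_all add: axis_j_def j_plus_def j_minus_def)

lemma isometric_axis_j:
  assumes "p\<^sup>2 + m\<^sup>2 = 1"
  shows "isometric_so4 (axis_j p m)"
proof -
  have so: "axis_j p m z \<in> so" for z by (simp add: axis_j_def diagonal_j_so)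
  have "so4_inner (axis_j p m z) (axis_j p m w) = (p\<^sup>2 + m\<^sup>2) * (z * w)" for z w
    unfolding j_plus_minus_inner(1)[of "axis_j p m" z w, OF so so, symmetric] axis_j_components inner_3
    by (simp add: algebra_simps power2_eq_square)
  moreover have "linear (axis_j p m)"
    by (simp add: linear_iff axis_j_def diagonal_j_def scaleR_left_distrib)
  ultimately show ?thesis unfolding isometric_so4_def using so assms by auto
qed

lemma conjugate_to_so4_self:
  assumes "isometric_so4 j"
  shows "conjugate_to_so4 (so4_to_so5 \<circ> j) j"
  using assms unfolding conjugate_to_so4_def isometric_so4_def
  by (auto intro!: exI[of _ "mat 1"] simp: orthogonal_matrix_id)

section \<open>A single two-form on R^4, extended by zero to R^2\<close>

context
  fixes j :: "real \<Rightarrow> real^4^4" and j2 :: "real^2 \<Rightarrow> real^4^4"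
  assumes lin: "linear j" and so: "range j \<subseteq> so"
  defines "j2 \<equiv> \<lambda>z. j (z $ 1)"
begin

lemma linear_rank1_extension: "linear j2"
  using linear_compose[OF bounded_linear.linear[OF bounded_linear_vec_nth] lin, of 1] by (simp add: j2_def o_def)

lemma rank1_extension_axis:
  "j_plus j2 (axis 1 1) = j_plus j 1" "j_minus j2 (axis 1 1) = j_minus j 1"
  "j_plus j2 (axis 2 1) = 0" "j_minus j2 (axis 2 1) = 0"
  using linear_0[OF linear_j_plus[OF lin]] linear_0[OF linear_j_minus[OF lin]]
  by (simp_all add: j2_def j_plus_def j_minus_def axis_def)

lemma rank1_extension_has_Spec:
  "has_Spec (adjoint (j_plus j2) \<circ> j_plus j2) {#j_plus j 1 \<bullet> j_plus j 1, 0#}"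
  "has_Spec (adjoint (j_minus j2) \<circ> j_minus j2) {#j_minus j 1 \<bullet> j_minus j 1, 0#}"
  using has_Spec_adjoint_self[OF linear_j_plus[OF linear_rank1_extension] orthonormal2_axis]
    has_Spec_adjoint_self[OF linear_j_minus[OF linear_rank1_extension] orthonormal2_axis]
  by (simp_all add: rank1_extension_axis)

lemma rank1_extension_invariantsD:
  assumes "invariants j2 \<alpha>p \<beta>p \<alpha>m \<beta>m t"
  shows "{#\<alpha>p, \<beta>p#} = {#j_plus j 1 \<bullet> j_plus j 1, 0#}" "{#\<alpha>m, \<beta>m#} = {#j_minus j 1 \<bullet> j_minus j 1, 0#}"
  using assms has_Spec_unique rank1_extension_has_Spec unfolding invariants_def Let_def by blast+

text \<open>Both operators vanish on the second axis and scale the first, so the trace of their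
  product is the product of the two squared lengths.\<close>

lemma rank1_extension_invariants:
  "invariants j2 0 (j_plus j 1 \<bullet> j_plus j 1) 0 (j_minus j 1 \<bullet> j_minus j 1)
     ((j_plus j 1 \<bullet> j_plus j 1) * (j_minus j 1 \<bullet> j_minus j 1))"
proof (rule invariants_diagonalI[OF linear_rank1_extension orthonormal2_axis])
  let ?P = "adjoint (j_plus j2) \<circ> j_plus j2" and ?M = "adjoint (j_minus j2) \<circ> j_minus j2"
  note linP = linear_j_plus[OF linear_rank1_extension] and linM = linear_j_minus[OF linear_rank1_extension]
  have "?P (axis 1 1) = (j_plus j 1 \<bullet> j_plus j 1) *\<^sub>R axis 1 1"
    "?M (axis 1 1) = (j_minus j 1 \<bullet> j_minus j 1) *\<^sub>R axis 1 1"
    using adjoint_self_eigenvector[OF linP orthonormal2_axis] adjoint_self_eigenvector[OF linM orthonormal2_axis]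
    by (simp_all add: rank1_extension_axis)
  moreover have "?M (axis 2 1) = 0"
    using adjoint_self_eigenvector[OF linM orthonormal2_commute[OF orthonormal2_axis]]
    by (simp add: rank1_extension_axis)
  ultimately have "(?P \<circ> ?M) (axis 1 1) = ((j_plus j 1 \<bullet> j_plus j 1) * (j_minus j 1 \<bullet> j_minus j 1)) *\<^sub>R axis 1 1"
    "(?P \<circ> ?M) (axis 2 1) = 0"
    using linear_cmul[OF linear_adjoint_self[OF linP]] linear_0[OF linear_adjoint_self[OF linP]]
    by (simp_all add: mult.commute)
  then show "(j_plus j 1 \<bullet> j_plus j 1) * (j_minus j 1 \<bullet> j_minus j 1) = trace (matrix (?P \<circ> ?M))"
    by (simp add: trace_def matrix_def sum_2 axis_def)
qed (simp_all add: rank1_extension_axis add_mset_commute)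

lemma rank1_extension_iso:
  assumes "j 1 \<noteq> 0"
  shows "pfaffian_form (j 1) (j 1) = 0 \<Longrightarrow> metric_lie j2 \<cong>\<^sub>L lie6 [0, 0, 0, 0, 0, wedge 1 2]"
    and "pfaffian_form (j 1) (j 1) \<noteq> 0 \<Longrightarrow> metric_lie j2 \<cong>\<^sub>L lie6 [0, 0, 0, 0, 0, wedge 1 2 + wedge 3 4]"
proof -
  interpret so4_pencil j2
    by (rule so4_pencil.intro[OF linear_rank1_extension]) (use so in \<open>auto simp: j2_def\<close>)
  \<comment> \<open>The basis is taken in reverse order: the second axis, which is killed, plays the
    role of e.\<close>
  note m = orthonormal2_minor2[OF orthonormal2_commute[OF orthonormal2_axis]]
  have ax: "j2 (axis 2 1) = 0" "j2 (axis 1 1) = j 1"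
    using linear_0[OF lin] by (simp_all add: j2_def axis_def)
  show "metric_lie j2 \<cong>\<^sub>L lie6 [0, 0, 0, 0, 0, wedge 1 2]" if "pfaffian_form (j 1) (j 1) = 0"
    by (rule iso_h3_rank1[OF m]) (use that assms in \<open>simp_all add: ax\<close>)
  show "metric_lie j2 \<cong>\<^sub>L lie6 [0, 0, 0, 0, 0, wedge 1 2 + wedge 3 4]" if "pfaffian_form (j 1) (j 1) \<noteq> 0"
    by (rule iso_h5_rank1[OF m]) (use that in \<open>simp_all add: ax\<close>)
qed

end

section \<open>One-dimensional commutator ideals: types and isometric examples\<close>

lemma conjugate_to_so4D: "conjugate_to_so4 j j' \<Longrightarrow> linear j' \<and> range j' \<subseteq> so"
  by (simp add: conjugate_to_so4_def)

lemma invariants_so5_iso_h5: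
  assumes "invariants_so5 j 0 0 0 1 0"
  shows "metric_lie j \<cong>\<^sub>L lie6 [0, 0, 0, 0, 0, wedge 1 2 + wedge 3 4]"
proof -
  obtain j' where j': "conjugate_to_so4 j j'" "labelled_invariants (\<lambda>z. j' (z $ 1)) 0 0 0 1 0"
    using assms unfolding invariants_so5_def by blast
  note lin = conjugate_to_so4D[OF j'(1), THEN conjunct1] and so = conjugate_to_so4D[OF j'(1), THEN conjunct2]
  have so1: "j' 1 \<in> so" using so by blast
  \<comment> \<open>The squared lengths are 0 and 1 in one order or the other, depending on the
    labelling; their difference is nonzero either way.\<close>
  have "j_plus j' 1 \<bullet> j_plus j' 1 - j_minus j' 1 \<bullet> j_minus j' 1 \<noteq> 0"
    using j'(2) rank1_extension_invariantsD[OF lin so] unfolding labelled_invariants_def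
    by (fastforce simp: doubleton_mset_eq)
  then have pf: "pfaffian_form (j' 1) (j' 1) \<noteq> 0"
    using j_plus_minus_inner(2)[of j' 1 1, OF so1 so1] by simp
  then have "j' 1 \<noteq> 0" by (auto simp: pfaffian_form_def)
  then show ?thesis
    using lie_iso_trans[OF conjugate_to_so4_iso[OF j'(1)] rank1_extension_iso(2)[OF lin so _ pf]] by blast
qed

lemma invariants_so5_iso_h3:
  assumes "invariants_so5 j 0 (1/2) 0 (1/2) (1/4)"
  shows "metric_lie j \<cong>\<^sub>L lie6 [0, 0, 0, 0, 0, wedge 1 2]"
proof -
  obtain j' where j': "conjugate_to_so4 j j'" "invariants (\<lambda>z. j' (z $ 1)) 0 (1/2) 0 (1/2) (1/4)"
    using assms unfolding invariants_so5_def labelled_invariants_def by blast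
  note lin = conjugate_to_so4D[OF j'(1), THEN conjunct1] and so = conjugate_to_so4D[OF j'(1), THEN conjunct2]
  have so1: "j' 1 \<in> so" using so by blast
  have val: "j_plus j' 1 \<bullet> j_plus j' 1 = 1/2" "j_minus j' 1 \<bullet> j_minus j' 1 = 1/2"
    using rank1_extension_invariantsD[OF lin so j'(2)] by (auto simp: doubleton_mset_eq)
  then have pf: "pfaffian_form (j' 1) (j' 1) = 0"
    using j_plus_minus_inner(2)[of j' 1 1, OF so1 so1] by simp
  have "j' 1 \<noteq> 0" using val by (auto simp: j_plus_def so4_inner_def inner_3)
  then show ?thesis
    using lie_iso_trans[OF conjugate_to_so4_iso[OF j'(1)] rank1_extension_iso(1)[OF lin so _ pf]] by blast
qed

lemma isometric_so5_axis_j: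
  assumes "p\<^sup>2 + m\<^sup>2 = 1" "p\<^sup>2 \<le> m\<^sup>2"
  shows "isometric_so5 (so4_to_so5 \<circ> axis_j p m)" "invariants_so5 (so4_to_so5 \<circ> axis_j p m) 0 (p\<^sup>2) 0 (m\<^sup>2) (p\<^sup>2 * m\<^sup>2)"
proof -
  note iso = isometric_axis_j[OF assms(1)]
  note conj = conjugate_to_so4_self[OF iso]
  show "isometric_so5 (so4_to_so5 \<circ> axis_j p m)" unfolding isometric_so5_def using iso conj by blast
  have "invariants (\<lambda>z. axis_j p m (z $ 1)) 0 (p\<^sup>2) 0 (m\<^sup>2) (p\<^sup>2 * m\<^sup>2)"
    using rank1_extension_invariants[of "axis_j p m"] conjugate_to_so4D[OF conj]
    by (simp add: axis_j_components inner_3 power2_eq_square)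
  then show "invariants_so5 (so4_to_so5 \<circ> axis_j p m) 0 (p\<^sup>2) 0 (m\<^sup>2) (p\<^sup>2 * m\<^sup>2)"
    unfolding invariants_so5_def labelled_invariants_def using conj assms(2) by blast
qed

lemma obtain_h5_metric: obtains j where "isometric_so5 j" "invariants_so5 j 0 0 0 1 0"
  using isometric_so5_axis_j[of 0 1] that by simp

text \<open>Equal plus and minus parts make the Pfaffian vanish. Unit length then forces both
  squared lengths to be 1/2, whence t = 1/4.\<close>

lemma obtain_h3_metric: obtains j where "isometric_so5 j" "invariants_so5 j 0 (1/2) 0 (1/2) (1/4)"
  using isometric_so5_axis_j[of "sqrt (1/2)" "sqrt (1/2)"] that by simp

lemma commutator_dim_1_types:
  fixes br :: "'a::real_vector \<Rightarrow> 'a \<Rightarrow> 'a"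
  assumes "nonabelian_2step_dim6 br" "dim (commutator_ideal br) = 1"
  shows "br \<cong>\<^sub>L lie6 [0, 0, 0, 0, 0, wedge 1 2] \<or> br \<cong>\<^sub>L lie6 [0, 0, 0, 0, 0, wedge 1 2 + wedge 3 4]"
proof -
  obtain j :: "real \<Rightarrow> real^5^5" where j: "linear j" "range j \<subseteq> so" "\<And>w. j w = 0 \<Longrightarrow> w = 0" "br \<cong>\<^sub>L metric_lie j"
    using obtain_metric_lie[of br, where 'n = 5 and 'b = real] assms unfolding nonabelian_2step_dim6_def by auto
  obtain j' where j': "conjugate_to_so4 j j'" by (rule obtain_conjugate_to_so4[OF j(1,2)])
  note lin = conjugate_to_so4D[OF j', THEN conjunct1] and so = conjugate_to_so4D[OF j', THEN conjunct2]
  have "j' 1 \<noteq> 0"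
  proof
    assume "j' 1 = 0"
    then have "j 1 = 0"
      using j' linear_0[OF linear_so4_to_so5] unfolding conjugate_to_so4_def by auto
    then show False using j(3) by fastforce
  qed
  note types = rank1_extension_iso[OF lin so this]
  show ?thesis
    using lie_iso_trans[OF lie_iso_trans[OF j(4) conjugate_to_so4_iso[OF j']]] types by blast
qed

text \<open>One representative per regime, with (\<open>\<alpha>p\<close>, \<open>\<alpha>m\<close>)
  equal to (0, 0), (0, 1/2), (1/2, 1/2) and (0, 1). An axis contributes 0 and 1 to the two parts, or
  1/2 to each.\<close>

lemma obtain_isometric_examples:
  obtains j1 t1 j2 t2 j3 t3 j4 t4 where
    "isometric_so4 j1" "invariants j1 0 1 0 1 t1"
    "isometric_so4 j2" "invariants j2 0 (1/2) (1/2) 1 t2"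
    "isometric_so4 j3" "invariants j3 (1/2) (1/2) (1/2) (1/2) t3"
    "isometric_so4 j4" "invariants j4 0 0 1 1 t4"
proof -
  let ?h = "sqrt (1/2)"
  obtain t1 where 1: "invariants (diagonal_j 0 1 1 0) 0 1 0 1 t1"
    using invariants_diagonal_j[of 0 1 0 1] by auto
  obtain t2 where 2: "invariants (diagonal_j 0 1 ?h ?h) 0 (1/2) (1/2) 1 t2"
    using invariants_diagonal_j[of 0 ?h ?h 1] by auto
  obtain t3 where 3: "invariants (diagonal_j ?h ?h ?h ?h) (1/2) (1/2) (1/2) (1/2) t3"
    using invariants_diagonal_j[of ?h ?h ?h ?h] by auto
  obtain t4 where 4: "invariants (diagonal_j 0 1 0 1) 0 0 1 1 t4"
    using invariants_diagonal_j[of 0 0 1 1] by auto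
  show ?thesis
    by (rule that[OF _ 1 _ 2 _ 3 _ 4]; rule isometric_diagonal_j) simp_all
qed

text \<open>The given metric is discarded: its normal form determines one of the four types, and the
  isometric example of that type is isomorphic to the same normal form.\<close>

lemma commutator_dim_2_isometric:
  fixes br :: "'a::real_vector \<Rightarrow> 'a \<Rightarrow> 'a"
  assumes "nonabelian_2step_dim6 br" "dim (commutator_ideal br) = 2"
  obtains j :: "real^2 \<Rightarrow> real^4^4" where "isometric_so4 j" "br \<cong>\<^sub>L metric_lie j"
proof -
  obtain j :: "real^2 \<Rightarrow> real^4^4" where j: "linear j" "range j \<subseteq> so" "\<And>w. j w = 0 \<Longrightarrow> w = 0" "br \<cong>\<^sub>L metric_lie j"
    using obtain_metric_lie[of br, where 'n = 4 and 'b = "real^2"] assms unfolding nonabelian_2step_dim6_def by auto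
  have "so4_pencil j" using j(1,2) by (auto simp: so4_pencil_def)
  then consider "metric_lie j \<cong>\<^sub>L lie6 [0, 0, 0, 0, wedge 1 2, wedge 3 4]"
    | "metric_lie j \<cong>\<^sub>L lie6 [0, 0, 0, 0, wedge 1 2, wedge 1 4 + wedge 2 3]"
    | "metric_lie j \<cong>\<^sub>L lie6 [0, 0, 0, 0, wedge 1 2, wedge 1 3]"
    | "metric_lie j \<cong>\<^sub>L lie6 [0, 0, 0, 0, wedge 1 3 + wedge 4 2, wedge 1 4 + wedge 2 3]"
    using so4_pencil_types j(3) by blast
  note types = this
  obtain j1 t1 j2 t2 j3 t3 j4 t4 where ex:
    "isometric_so4 j1" "invariants j1 0 1 0 1 t1"
    "isometric_so4 j2" "invariants j2 0 (1/2) (1/2) 1 t2"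
    "isometric_so4 j3" "invariants j3 (1/2) (1/2) (1/2) (1/2) t3"
    "isometric_so4 j4" "invariants j4 0 0 1 1 t4"
    by (rule obtain_isometric_examples)
  note iso = isometric_iso_types(1)[OF ex(1,2)] isometric_iso_types(2)[OF ex(3,4)]
    isometric_iso_types(3)[OF ex(5,6)] isometric_iso_types(4)[OF ex(7,8)]
  show ?thesis
  proof (cases rule: types)
    case 1
    from lie_iso_trans[OF j(4) lie_iso_trans[OF 1 lie_iso_sym[OF iso(1)]]]
    show ?thesis by (rule that[OF ex(1)]) simp_all
  next
    case 2
    from lie_iso_trans[OF j(4) lie_iso_trans[OF 2 lie_iso_sym[OF iso(2)]]]
    show ?thesis by (rule that[OF ex(3)]) simp
  next
    case 3
    from lie_iso_trans[OF j(4) lie_iso_trans[OF 3 lie_iso_sym[OF iso(3)]]]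
    show ?thesis by (rule that[OF ex(5)]) simp_all
  next
    case 4
    from lie_iso_trans[OF j(4) lie_iso_trans[OF 4 lie_iso_sym[OF iso(4)]]]
    show ?thesis by (rule that[OF ex(7)]) simp
  qed
qed

text \<open>In the scalar product of so(4) each elementary two-form has squared length 1/2, hence
  the factor sqrt 2 for an isometric embedding.\<close>

definition free_j :: "real^3 \<Rightarrow> real^3^3" where
  "free_j z = sqrt 2 *\<^sub>R (z $ 1 *\<^sub>R wedge 1 2 + z $ 2 *\<^sub>R wedge 1 3 + z $ 3 *\<^sub>R wedge 2 3)"

lemma linear_free_j: "linear free_j"
  by (simp add: linear_iff free_j_def algebra_simps)

lemma free_j_so: "free_j z \<in> so"
proof (rule soI)
  show "free_j z $ k $ i = - (free_j z $ i $ k)" for i k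
    by (simp add: free_j_def wedge_skew[of _ _ k i] algebra_simps)
qed

lemma so3_to_so4_so:
  assumes "A \<in> so"
  shows "so3_to_so4 A \<in> so"
  using assms by (simp add: so3_to_so4_def so_def matrix_transpose_mul matrix_mul_assoc
    linear_neg[OF linear_matrix_sandwich[where P = "matrix R3_to_R4" and Q = "transpose (matrix R3_to_R4)"]])

text \<open>The forms 12, 13, 23 are half the sum, half the sum and half the difference of the
  corresponding plus and minus basis elements, which explains the sign in the last
  component.\<close>

lemma free_j_components:
  "j_plus (so3_to_so4 \<circ> free_j) z = (sqrt 2 / 2) *\<^sub>R z"
  "j_minus (so3_to_so4 \<circ> free_j) z = (sqrt 2 / 2) *\<^sub>R vector [z $ 1, z $ 2, - z $ 3]"
  unfolding vec_eq_iff forall_3 j_plus_def j_minus_def vec_lambda_beta so4_inner_basis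
  by (simp_all add: so3_to_so4_def free_j_def matrix_matrix_mult_def transpose_def matrix_def R3_to_R4_def
      sum_3 axis_def wedge_def)

lemma free_j_components_inner:
  "j_plus (so3_to_so4 \<circ> free_j) w \<bullet> j_plus (so3_to_so4 \<circ> free_j) z = (w \<bullet> z) / 2"
  "j_minus (so3_to_so4 \<circ> free_j) w \<bullet> j_minus (so3_to_so4 \<circ> free_j) z = (w \<bullet> z) / 2"
proof -
  have "sqrt 2 / 2 * (sqrt 2 / 2 * r) = (sqrt 2 * sqrt 2) * r / 4" for r :: real by simp
  then have s: "sqrt 2 / 2 * (sqrt 2 / 2 * r) = r / 2" for r :: real by simp
  show "j_plus (so3_to_so4 \<circ> free_j) w \<bullet> j_plus (so3_to_so4 \<circ> free_j) z = (w \<bullet> z) / 2"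
    unfolding free_j_components inner_scaleR_left inner_scaleR_right s ..
  show "j_minus (so3_to_so4 \<circ> free_j) w \<bullet> j_minus (so3_to_so4 \<circ> free_j) z = (w \<bullet> z) / 2"
    unfolding free_j_components inner_scaleR_left inner_scaleR_right s by (simp add: inner_3)
qed

lemma isometric_so3_free_j: "isometric_so3 free_j"
proof -
  let ?j = "so3_to_so4 \<circ> free_j"
  have so: "?j z \<in> so" for z by (simp add: so3_to_so4_so free_j_so)
  have "so4_inner (?j z) (?j w) = z \<bullet> w" for z w
    unfolding j_plus_minus_inner(1)[of ?j z w, OF so so, symmetric] free_j_components_inner by simp
  moreover have "linear ?j"
    unfolding so3_to_so4_def[abs_def] by (intro linear_compose linear_free_j linear_matrix_sandwich)
  ultimately show ?thesis
    unfolding isometric_so3_def isometric_so4_def using linear_free_j free_j_so so by blast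
qed

text \<open>Each component is an isometry scaled by 1 / sqrt 2, so both operators are half the
  identity of R^3 and the eigenvalue 1/2 occurs three times.\<close>

lemma invariants_so3_free_j: "invariants_so3 free_j (1/2) (1/2) (1/2)"
proof -
  let ?j = "so3_to_so4 \<circ> free_j"
  have lin: "linear ?j" using isometric_so3_free_j by (simp add: isometric_so3_def isometric_so4_def)
  have "w \<bullet> (adjoint (j_plus ?j) \<circ> j_plus ?j) z = w \<bullet> ((1/2) *\<^sub>R z)"
    "w \<bullet> (adjoint (j_minus ?j) \<circ> j_minus ?j) z = w \<bullet> ((1/2) *\<^sub>R z)" for w z
    unfolding inner_adjoint_self[OF linear_j_plus[OF lin]] inner_adjoint_self[OF linear_j_minus[OF lin]]
      free_j_components_inner by simp_all
  then have "adjoint (j_plus ?j) \<circ> j_plus ?j = (*\<^sub>R) (1/2)" "adjoint (j_minus ?j) \<circ> j_minus ?j = (*\<^sub>R) (1/2)"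
    using vector_eq_ldot by (blast intro: ext)+
  then show ?thesis
    using has_Spec_scaleR[where 'a = "real^3" and c = "1/2"]
    by (simp add: invariants_so3_def numeral_3_eq_3)
qed

section \<open>The classification\<close>

text \<open>The labelling gives \<open>\<alpha>p\<close> \<le> \<open>\<alpha>m\<close>, and
  \<open>\<alpha>p\<close> \<le> \<open>\<beta>p\<close> = 1 - \<open>\<alpha>m\<close>. Hence
  \<open>\<alpha>p\<close> \<le> 1/2, and equality forces \<open>\<alpha>m\<close> = 1/2, which
  leaves exactly the listed regimes.\<close>

lemma labelled_iso_types:
  assumes iso: "isometric_so4 j" and lab: "labelled_invariants j \<alpha>p \<beta>p \<alpha>m \<beta>m t"
  shows "(\<alpha>p < 1/2 \<and> \<alpha>m < 1/2) \<or> (\<alpha>p < 1/2 \<and> \<alpha>m = 1/2) \<or>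
      (\<alpha>p = 1/2 \<and> \<alpha>m = 1/2) \<or> (\<alpha>p < 1/2 \<and> \<alpha>m > 1/2)"
    and "\<alpha>p < 1/2 \<Longrightarrow> \<alpha>m < 1/2 \<Longrightarrow> metric_lie j \<cong>\<^sub>L lie6 [0, 0, 0, 0, wedge 1 2, wedge 3 4]"
    and "\<alpha>p < 1/2 \<Longrightarrow> \<alpha>m = 1/2 \<Longrightarrow> metric_lie j \<cong>\<^sub>L lie6 [0, 0, 0, 0, wedge 1 2, wedge 1 4 + wedge 2 3]"
    and "\<alpha>p = 1/2 \<Longrightarrow> \<alpha>m = 1/2 \<Longrightarrow> metric_lie j \<cong>\<^sub>L lie6 [0, 0, 0, 0, wedge 1 2, wedge 1 3]"
    and "\<alpha>p < 1/2 \<Longrightarrow> \<alpha>m > 1/2 \<Longrightarrow>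
      metric_lie j \<cong>\<^sub>L lie6 [0, 0, 0, 0, wedge 1 3 + wedge 4 2, wedge 1 4 + wedge 2 3]"
proof -
  have le: "\<beta>p \<le> \<beta>m" using lab by (simp add: labelled_invariants_def)
  have neg: "(a - 1/2) * (b - 1/2) < 0" if "a < 1/2 \<and> b > 1/2 \<or> a > 1/2 \<and> b < 1/2" for a b :: real
    using that by (auto simp: mult_less_0_iff)
  consider "invariants j \<alpha>p \<beta>p \<alpha>m \<beta>m t" | "invariants j \<alpha>m \<beta>m \<alpha>p \<beta>p t"
    using lab unfolding labelled_invariants_def by blast
  note cases = this
  show "(\<alpha>p < 1/2 \<and> \<alpha>m < 1/2) \<or> (\<alpha>p < 1/2 \<and> \<alpha>m = 1/2) \<or>
      (\<alpha>p = 1/2 \<and> \<alpha>m = 1/2) \<or> (\<alpha>p < 1/2 \<and> \<alpha>m > 1/2)"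
  proof (cases rule: cases)
    case 1
    show ?thesis by (rule isometric_invariantsE[OF iso 1]) (use le in linarith)
  next
    case 2
    show ?thesis by (rule isometric_invariantsE[OF iso 2]) (use le in linarith)
  qed
  show "metric_lie j \<cong>\<^sub>L lie6 [0, 0, 0, 0, wedge 1 2, wedge 3 4]" if "\<alpha>p < 1/2" "\<alpha>m < 1/2"
    by (cases rule: cases) (use that isometric_iso_types(1)[OF iso] in blast)+
  show "metric_lie j \<cong>\<^sub>L lie6 [0, 0, 0, 0, wedge 1 2, wedge 1 4 + wedge 2 3]" if "\<alpha>p < 1/2" "\<alpha>m = 1/2"
    by (cases rule: cases) (rule isometric_iso_types(2)[OF iso], assumption, use that in simp)+
  show "metric_lie j \<cong>\<^sub>L lie6 [0, 0, 0, 0, wedge 1 2, wedge 1 3]" if "\<alpha>p = 1/2" "\<alpha>m = 1/2"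
    by (cases rule: cases) (use that isometric_iso_types(3)[OF iso] in blast)+
  show "metric_lie j \<cong>\<^sub>L lie6 [0, 0, 0, 0, wedge 1 3 + wedge 4 2, wedge 1 4 + wedge 2 3]"
    if "\<alpha>p < 1/2" "\<alpha>m > 1/2"
    by (cases rule: cases) (rule isometric_iso_types(4)[OF iso], assumption, rule neg, use that in simp)+
qed

theorem mainTheorem4:
  shows
    "(\<forall>br :: 'a::real_vector \<Rightarrow> 'a \<Rightarrow> 'a. nonabelian_2step_dim6 br \<longrightarrow>
        dim (commutator_ideal br) \<in> {1, 2, 3}) \<and>

     ((\<forall>br :: 'a \<Rightarrow> 'a \<Rightarrow> 'a.
         nonabelian_2step_dim6 br \<and> dim (commutator_ideal br) = 1 \<longrightarrow>
         (\<exists>j. isometric_so5 j \<and> br \<cong>\<^sub>L metric_lie j \<and>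
            (invariants_so5 j 0 0 0 1 0 \<or> invariants_so5 j 0 (1/2) 0 (1/2) (1/4)))) \<and>
      (\<exists>j. isometric_so5 j \<and> invariants_so5 j 0 0 0 1 0) \<and>
      (\<exists>j. isometric_so5 j \<and> invariants_so5 j 0 (1/2) 0 (1/2) (1/4)) \<and>
      (\<forall>j. isometric_so5 j \<and> invariants_so5 j 0 0 0 1 0 \<longrightarrow>
         metric_lie j \<cong>\<^sub>L lie6 [0, 0, 0, 0, 0, wedge 1 2 + wedge 3 4]) \<and>
      (\<forall>j. isometric_so5 j \<and> invariants_so5 j 0 (1/2) 0 (1/2) (1/4) \<longrightarrow>
         metric_lie j \<cong>\<^sub>L lie6 [0, 0, 0, 0, 0, wedge 1 2]) \<and>
      lie6 [0, 0, 0, 0, 0, wedge 1 2 + wedge 3 4] \<cong>\<^sub>L h5 \<oplus>\<^sub>L (zero_bracket :: real \<Rightarrow> _) \<and>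
      lie6 [0, 0, 0, 0, 0, wedge 1 2] \<cong>\<^sub>L h3 \<oplus>\<^sub>L (zero_bracket :: real^3 \<Rightarrow> _) \<and>
      \<not> lie6 [0, 0, 0, 0, 0, wedge 1 2 + wedge 3 4] \<cong>\<^sub>L lie6 [0, 0, 0, 0, 0, wedge 1 2]) \<and>

     ((\<forall>br :: 'a \<Rightarrow> 'a \<Rightarrow> 'a.
         nonabelian_2step_dim6 br \<and> dim (commutator_ideal br) = 2 \<longrightarrow>
         (\<exists>j :: real^2 \<Rightarrow> real^4^4. isometric_so4 j \<and> br \<cong>\<^sub>L metric_lie j)) \<and>
      (\<forall>j \<alpha>p \<beta>p \<alpha>m \<beta>m t. isometric_so4 j \<and> invariants j \<alpha>p \<beta>p \<alpha>m \<beta>m t \<longrightarrow>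
         (\<beta>m \<ge> \<beta>p \<longleftrightarrow> \<alpha>m \<ge> \<alpha>p)) \<and>
      (\<forall>j. isometric_so4 j \<longrightarrow> (\<exists>\<alpha>p \<beta>p \<alpha>m \<beta>m t. labelled_invariants j \<alpha>p \<beta>p \<alpha>m \<beta>m t)) \<and>
      (\<forall>j \<alpha>p \<beta>p \<alpha>m \<beta>m t. isometric_so4 j \<and> labelled_invariants j \<alpha>p \<beta>p \<alpha>m \<beta>m t \<longrightarrow>
         ((\<alpha>p < 1/2 \<and> \<alpha>m < 1/2) \<or> (\<alpha>p < 1/2 \<and> \<alpha>m = 1/2) \<or>
          (\<alpha>p = 1/2 \<and> \<alpha>m = 1/2) \<or> (\<alpha>p < 1/2 \<and> \<alpha>m > 1/2)) \<and>
         (\<alpha>p < 1/2 \<and> \<alpha>m < 1/2 \<longrightarrow>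
            metric_lie j \<cong>\<^sub>L lie6 [0, 0, 0, 0, wedge 1 2, wedge 3 4]) \<and>
         (\<alpha>p < 1/2 \<and> \<alpha>m = 1/2 \<longrightarrow>
            metric_lie j \<cong>\<^sub>L lie6 [0, 0, 0, 0, wedge 1 2, wedge 1 4 + wedge 2 3]) \<and>
         (\<alpha>p = 1/2 \<and> \<alpha>m = 1/2 \<longrightarrow>
            metric_lie j \<cong>\<^sub>L lie6 [0, 0, 0, 0, wedge 1 2, wedge 1 3]) \<and>
         (\<alpha>p < 1/2 \<and> \<alpha>m > 1/2 \<longrightarrow>
            metric_lie j \<cong>\<^sub>L lie6 [0, 0, 0, 0, wedge 1 3 + wedge 4 2, wedge 1 4 + wedge 2 3])) \<and>
      (\<exists>j \<alpha>p \<beta>p \<alpha>m \<beta>m t. isometric_so4 j \<and> labelled_invariants j \<alpha>p \<beta>p \<alpha>m \<beta>m t \<and>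
         \<alpha>p < 1/2 \<and> \<alpha>m < 1/2) \<and>
      (\<exists>j \<alpha>p \<beta>p \<alpha>m \<beta>m t. isometric_so4 j \<and> labelled_invariants j \<alpha>p \<beta>p \<alpha>m \<beta>m t \<and>
         \<alpha>p < 1/2 \<and> \<alpha>m = 1/2) \<and>
      (\<exists>j \<alpha>p \<beta>p \<alpha>m \<beta>m t. isometric_so4 j \<and> labelled_invariants j \<alpha>p \<beta>p \<alpha>m \<beta>m t \<and>
         \<alpha>p = 1/2 \<and> \<alpha>m = 1/2) \<and>
      (\<exists>j \<alpha>p \<beta>p \<alpha>m \<beta>m t. isometric_so4 j \<and> labelled_invariants j \<alpha>p \<beta>p \<alpha>m \<beta>m t \<and>
         \<alpha>p < 1/2 \<and> \<alpha>m > 1/2) \<and>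
      sorted_wrt (\<lambda>br br'. \<not> br \<cong>\<^sub>L br')
        [lie6 [0, 0, 0, 0, wedge 1 2, wedge 3 4],
         lie6 [0, 0, 0, 0, wedge 1 2, wedge 1 4 + wedge 2 3],
         lie6 [0, 0, 0, 0, wedge 1 2, wedge 1 3],
         lie6 [0, 0, 0, 0, wedge 1 3 + wedge 4 2, wedge 1 4 + wedge 2 3]] \<and>
      lie6 [0, 0, 0, 0, wedge 1 2, wedge 3 4] \<cong>\<^sub>L h3 \<oplus>\<^sub>L h3 \<and>
      lie6 [0, 0, 0, 0, wedge 1 2, wedge 1 3] \<cong>\<^sub>L n5 \<oplus>\<^sub>L (zero_bracket :: real \<Rightarrow> _) \<and>
      lie6 [0, 0, 0, 0, wedge 1 3 + wedge 4 2, wedge 1 4 + wedge 2 3] \<cong>\<^sub>L h3_complex) \<and>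

     ((\<forall>br :: 'a \<Rightarrow> 'a \<Rightarrow> 'a.
         nonabelian_2step_dim6 br \<and> dim (commutator_ideal br) = 3 \<longrightarrow>
         br \<cong>\<^sub>L lie6 [0, 0, 0, wedge 1 2, wedge 1 3, wedge 2 3]) \<and>
      (\<exists>j. isometric_so3 j \<and> invariants_so3 j (1/2) (1/2) (1/2) \<and>
         metric_lie j \<cong>\<^sub>L lie6 [0, 0, 0, wedge 1 2, wedge 1 3, wedge 2 3]))"
proof (intro conjI allI impI; (elim conjE)?)
  fix br :: "'a \<Rightarrow> 'a \<Rightarrow> 'a"
  assume "nonabelian_2step_dim6 br"
  then show "dim (commutator_ideal br) \<in> {1, 2, 3}" by (rule dim_commutator_ideal)
next
  fix br :: "'a \<Rightarrow> 'a \<Rightarrow> 'a"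
  assume br: "nonabelian_2step_dim6 br" "dim (commutator_ideal br) = 1"
  obtain j where j: "isometric_so5 j" "invariants_so5 j 0 0 0 1 0" by (rule obtain_h5_metric)
  obtain i where i: "isometric_so5 i" "invariants_so5 i 0 (1/2) 0 (1/2) (1/4)" by (rule obtain_h3_metric)
  show "\<exists>j. isometric_so5 j \<and> br \<cong>\<^sub>L metric_lie j \<and>
      (invariants_so5 j 0 0 0 1 0 \<or> invariants_so5 j 0 (1/2) 0 (1/2) (1/4))"
    using commutator_dim_1_types[OF br]
  proof
    assume "br \<cong>\<^sub>L lie6 [0, 0, 0, 0, 0, wedge 1 2]"
    then have "br \<cong>\<^sub>L metric_lie i"
      by (rule lie_iso_trans[OF _ lie_iso_sym[OF invariants_so5_iso_h3[OF i(2)]]])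
    then show ?thesis using i by blast
  next
    assume "br \<cong>\<^sub>L lie6 [0, 0, 0, 0, 0, wedge 1 2 + wedge 3 4]"
    then have "br \<cong>\<^sub>L metric_lie j"
      by (rule lie_iso_trans[OF _ lie_iso_sym[OF invariants_so5_iso_h5[OF j(2)]]])
    then show ?thesis using j by blast
  qed
next
  show "\<exists>j. isometric_so5 j \<and> invariants_so5 j 0 0 0 1 0" by (rule obtain_h5_metric) blast
next
  show "\<exists>j. isometric_so5 j \<and> invariants_so5 j 0 (1/2) 0 (1/2) (1/4)" by (rule obtain_h3_metric) blast
next
  fix j assume "invariants_so5 j 0 0 0 1 0"
  then show "metric_lie j \<cong>\<^sub>L lie6 [0, 0, 0, 0, 0, wedge 1 2 + wedge 3 4]" by (rule invariants_so5_iso_h5)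
next
  fix j assume "invariants_so5 j 0 (1/2) 0 (1/2) (1/4)"
  then show "metric_lie j \<cong>\<^sub>L lie6 [0, 0, 0, 0, 0, wedge 1 2]" by (rule invariants_so5_iso_h3)
next
  fix br :: "'a \<Rightarrow> 'a \<Rightarrow> 'a"
  assume br: "nonabelian_2step_dim6 br" "dim (commutator_ideal br) = 2"
  show "\<exists>j :: real^2 \<Rightarrow> real^4^4. isometric_so4 j \<and> br \<cong>\<^sub>L metric_lie j"
    by (rule commutator_dim_2_isometric[OF br]) blast
next
  fix j \<alpha>p \<beta>p \<alpha>m \<beta>m t
  assume iso: "isometric_so4 j" and inv: "invariants j \<alpha>p \<beta>p \<alpha>m \<beta>m t"
  show "\<beta>m \<ge> \<beta>p \<longleftrightarrow> \<alpha>m \<ge> \<alpha>p" by (rule isometric_invariantsE[OF iso inv]) linarith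
next
  fix j :: "real^2 \<Rightarrow> real^4^4"
  assume "isometric_so4 j"
  then show "\<exists>\<alpha>p \<beta>p \<alpha>m \<beta>m t. labelled_invariants j \<alpha>p \<beta>p \<alpha>m \<beta>m t"
    by (rule obtain_labelled_invariants) blast
next
  fix j \<alpha>p \<beta>p \<alpha>m \<beta>m t
  assume "isometric_so4 j" "labelled_invariants j \<alpha>p \<beta>p \<alpha>m \<beta>m t"
  note types = labelled_iso_types[OF this]
  show "(\<alpha>p < 1/2 \<and> \<alpha>m < 1/2) \<or> (\<alpha>p < 1/2 \<and> \<alpha>m = 1/2) \<or>
          (\<alpha>p = 1/2 \<and> \<alpha>m = 1/2) \<or> (\<alpha>p < 1/2 \<and> \<alpha>m > 1/2)"
    by (rule types)
  show "metric_lie j \<cong>\<^sub>L lie6 [0, 0, 0, 0, wedge 1 2, wedge 3 4]" if "\<alpha>p < 1/2" "\<alpha>m < 1/2"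
    using types(2) that by blast
  show "metric_lie j \<cong>\<^sub>L lie6 [0, 0, 0, 0, wedge 1 2, wedge 1 4 + wedge 2 3]" if "\<alpha>p < 1/2" "\<alpha>m = 1/2"
    using types(3) that by blast
  show "metric_lie j \<cong>\<^sub>L lie6 [0, 0, 0, 0, wedge 1 2, wedge 1 3]" if "\<alpha>p = 1/2" "\<alpha>m = 1/2"
    using types(4) that by blast
  show "metric_lie j \<cong>\<^sub>L lie6 [0, 0, 0, 0, wedge 1 3 + wedge 4 2, wedge 1 4 + wedge 2 3]"
    if "\<alpha>p < 1/2" "\<alpha>m > 1/2"
    using types(5) that by blast
next
  show "\<exists>j \<alpha>p \<beta>p \<alpha>m \<beta>m t. isometric_so4 j \<and> labelled_invariants j \<alpha>p \<beta>p \<alpha>m \<beta>m t \<and>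
      \<alpha>p < 1/2 \<and> \<alpha>m < 1/2"
  proof (rule obtain_isometric_examples)
    fix j t assume "isometric_so4 j" "invariants j 0 1 0 1 t"
    then show ?thesis unfolding labelled_invariants_def
      by (intro exI[of _ j] exI[of _ 0] exI[of _ 1] exI[of _ t]) simp
  qed
next
  show "\<exists>j \<alpha>p \<beta>p \<alpha>m \<beta>m t. isometric_so4 j \<and> labelled_invariants j \<alpha>p \<beta>p \<alpha>m \<beta>m t \<and>
      \<alpha>p < 1/2 \<and> \<alpha>m = 1/2"
  proof (rule obtain_isometric_examples)
    fix j t assume "isometric_so4 j" "invariants j 0 (1/2) (1/2) 1 t"
    then show ?thesis unfolding labelled_invariants_def
      by (intro exI[of _ j] exI[of _ 0] exI[of _ "1/2"] exI[of _ 1] exI[of _ t]) simp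
  qed
next
  show "\<exists>j \<alpha>p \<beta>p \<alpha>m \<beta>m t. isometric_so4 j \<and> labelled_invariants j \<alpha>p \<beta>p \<alpha>m \<beta>m t \<and>
      \<alpha>p = 1/2 \<and> \<alpha>m = 1/2"
  proof (rule obtain_isometric_examples)
    fix j t assume "isometric_so4 j" "invariants j (1/2) (1/2) (1/2) (1/2) t"
    then show ?thesis unfolding labelled_invariants_def
      by (intro exI[of _ j] exI[of _ "1/2"] exI[of _ t]) simp
  qed
next
  show "\<exists>j \<alpha>p \<beta>p \<alpha>m \<beta>m t. isometric_so4 j \<and> labelled_invariants j \<alpha>p \<beta>p \<alpha>m \<beta>m t \<and>
      \<alpha>p < 1/2 \<and> \<alpha>m > 1/2"
  proof (rule obtain_isometric_examples)
    fix j t assume "isometric_so4 j" "invariants j 0 0 1 1 t"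
    then show ?thesis unfolding labelled_invariants_def
      by (intro exI[of _ j] exI[of _ 0] exI[of _ 1] exI[of _ t]) simp
  qed
next
  \<comment> \<open>Each algebra is compared only with the later ones in the list; this is enough
    because isomorphism is symmetric.\<close>
  show "sorted_wrt (\<lambda>br br'. \<not> br \<cong>\<^sub>L br')
        [lie6 [0, 0, 0, 0, wedge 1 2, wedge 3 4],
         lie6 [0, 0, 0, 0, wedge 1 2, wedge 1 4 + wedge 2 3],
         lie6 [0, 0, 0, 0, wedge 1 2, wedge 1 3],
         lie6 [0, 0, 0, 0, wedge 1 3 + wedge 4 2, wedge 1 4 + wedge 2 3]]"
    by (simp add: h3_h3_not_iso_others semidefinite_not_iso_n5 semidefinite_not_iso_h3_complex
        n5_not_iso_h3_complex)
next
  fix br :: "'a \<Rightarrow> 'a \<Rightarrow> 'a"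
  assume br: "nonabelian_2step_dim6 br" "dim (commutator_ideal br) = 3"
  obtain j :: "real^3 \<Rightarrow> real^3^3"
    where j: "linear j" "range j \<subseteq> so" "\<And>w. j w = 0 \<Longrightarrow> w = 0" "br \<cong>\<^sub>L metric_lie j"
    using obtain_metric_lie[of br, where 'n = 3 and 'b = "real^3"] br unfolding nonabelian_2step_dim6_def
    by auto
  show "br \<cong>\<^sub>L lie6 [0, 0, 0, wedge 1 2, wedge 1 3, wedge 2 3]"
    by (rule lie_iso_trans[OF j(4) so3_iso_free[OF j(1,2)]]) (rule j(3))
next
  have "metric_lie free_j \<cong>\<^sub>L lie6 [0, 0, 0, wedge 1 2, wedge 1 3, wedge 2 3]"
  proof (rule so3_iso_free)
    show "linear free_j" "range free_j \<subseteq> so"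
      using isometric_so3_free_j by (auto simp: isometric_so3_def)
    \<comment> \<open>Injectivity is inherited from the isometric composite with the inclusion into
      so(4).\<close>
    show "z = 0" if "free_j z = 0" for z
      using isometric_so4D(4)[of "so3_to_so4 \<circ> free_j" z] isometric_so3_free_j that
      by (simp add: isometric_so3_def so3_to_so4_def)
  qed
  then show "\<exists>j. isometric_so3 j \<and> invariants_so3 j (1/2) (1/2) (1/2) \<and>
      metric_lie j \<cong>\<^sub>L lie6 [0, 0, 0, wedge 1 2, wedge 1 3, wedge 2 3]"
    using isometric_so3_free_j invariants_so3_free_j by blast
qed (rule lie6_h5 lie6_h3 h5_not_iso_h3 lie6_h3_h3 lie6_n5 lie6_h3_complex)+

end
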